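(* Let $n,d\ge 1$ be integers, let $B^n=\{\mathbf{x}\in\mathbb{R}^n:\|\mathbf{x}\|^2\le 1\}$ be the $n$-dimensional unit ball, and let $f\in\mathbb{R}[\mathbf{x}]=\mathbb{R}[x_1,\dots,x_n]$ be a polynomial of degree $d$. Write $f_{\min}=\min_{\mathbf{x}\in B^n}f(\mathbf{x})$ and $f_{\max}=\max_{\mathbf{x}\in B^n}f(\mathbf{x})$. Then for every integer $r\ge 2nd\sqrt{d}$, the Schm\"udgen-type lower bound $\mathrm{lb}(f,\mathcal{T}(B^n))_r$ satisfies $$f_{\min}-\mathrm{lb}(f,\mathcal{T}(B^n))_r\le \frac{C_B(n,d)}{r^2}\,(f_{\max}-f_{\min}),\qquad\text{where } C_B(n,d)=2n^2d^3\,\gamma(B^n)_d .$$ The constant $C_B(n,d)$ depends only on $n$ and $d$; it depends polynomially on $n$ (for fixed $d$) and polynomially on $d$ (for fixed $n$).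
   Context: $\mathbb{R}[\mathbf{x}]_k$ denotes polynomials of degree at most $k$; $\Sigma[\mathbf{x}]$ denotes the set of sums of squares of polynomials in $\mathbb{R}[\mathbf{x}]$. Truncated preordering of the ball (described by the single inequality $1-\|\mathbf{x}\|^2\ge0$): $$\mathcal{T}(B^n)_{2r}=\{\sigma_0+\sigma_1\cdot(1-\|\mathbf{x}\|^2):\ \sigma_0,\sigma_1\in\Sigma[\mathbf{x}],\ \deg(\sigma_0)\le 2r,\ \deg(\sigma_1(1-\|\mathbf{x}\|^2))\le 2r\}.$$ Lower bound: $\mathrm{lb}(f,\mathcal{T}(B^n))_r=\max\{\lambda\in\mathbb{R}: f-\lambda\in\mathcal{T}(B^n)_{2r}\}$ (read as a supremum). The constant $\gamma(B^n)_d$: equip $B^n$ with the probability measure $d\mu_B(\mathbf{x})=c_n(1-\|\mathbf{x}\|^2)^{-1/2}d\mathbf{x}$ ($c_n>0$ a normalization constant) and the inner product $\langle p,q\rangle=\int_{B^n}pq\,d\mu_B$. Let $H_k=\{p\in\mathbb{R}[\mathbf{x}]_k:\langle p,q\rangle=0\ \text{for all } q\in\mathbb{R}[\mathbf{x}]_{k-1}\}$ (with $H_0$ the constants). Every $p\in\mathbb{R}[\mathbf{x}]_d$ decomposes uniquely as $p=\sum_{k=0}^d p_k$ with $p_k\in H_k$. With $\|p\|_{B^n}=\max_{\mathbf{x}\in B^n}|p(\mathbf{x})|$, set $$\gamma(B^n)_d=\max_{0\ne p\in\mathbb{R}[\mathbf{x}]_d}\ \max_{0\le k\le d}\frac{\|p_k\|_{B^n}}{\|p\|_{B^n}}<\infty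 .$$ "Depends polynomially on $n$ (for fixed $d$)" means: for each fixed $d$ the quantity is bounded above by a polynomial in $n$; similarly with the roles of $n$ and $d$ exchanged. *)

theory Defs
  imports
    "HOL-Analysis.Analysis"
    "HOL-Library.Poly_Mapping"
    "HOL-Computational_Algebra.Polynomial"
begin

text \<open>
  The number n of variables is a natural number and not the cardinality of an index type,
  because the dependence of a constant on n has to be expressible inside a formula.
  A monomial is its finitely supported exponent vector; addition of exponent vectors makes
  the convolution product on finitely supported maps the usual product of polynomials.
\<close>

type_synonym mpoly = "(nat \<Rightarrow>\<^sub>0 nat) \<Rightarrow>\<^sub>0 real"

definition mconst :: "real \<Rightarrow> mpoly" where
  "mconst c = Poly_Mapping.single 0 c"

definition mvar :: "nat \<Rightarrow> mpoly" where
  "mvar i = Poly_Mapping.single (Poly_Mapping.single i 1) 1"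

definition polys :: "nat \<Rightarrow> mpoly set" where
  "polys n = {p. \<forall>m\<in>Poly_Mapping.keys p. Poly_Mapping.keys m \<subseteq> {..<n}}"

text \<open>The zero polynomial gets total degree 0.\<close>

definition total_degree :: "mpoly \<Rightarrow> nat" where
  "total_degree p =
     Max (insert 0 ((\<lambda>m. \<Sum>i\<in>Poly_Mapping.keys m. Poly_Mapping.lookup m i) ` Poly_Mapping.keys p))"

definition polys_le :: "nat \<Rightarrow> nat \<Rightarrow> mpoly set" where
  "polys_le n k = {p \<in> polys n. total_degree p \<le> k}"

definition peval :: "mpoly \<Rightarrow> (nat \<Rightarrow> real) \<Rightarrow> real" where
  "peval p x = (\<Sum>m\<in>Poly_Mapping.keys p. Poly_Mapping.lookup p m *
                  (\<Prod>i\<in>Poly_Mapping.keys m. x i ^ Poly_Mapping.lookup m i))"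

text \<open>
  Points are extensional functions on \<open>{..<n}\<close>, so that they are the points of the
  product space \<open>\<Pi>\<^sub>M i\<in>{..<n}. lborel\<close>, which is n-dimensional Lebesgue measure.
\<close>

definition unit_ball :: "nat \<Rightarrow> (nat \<Rightarrow> real) set" where
  "unit_ball n = {x \<in> {..<n} \<rightarrow>\<^sub>E UNIV. (\<Sum>i<n. (x i)\<^sup>2) \<le> 1}"

text \<open>Infima and suprema of polynomials over the ball are attained, the ball being compact.\<close>

definition fmin :: "nat \<Rightarrow> mpoly \<Rightarrow> real" where
  "fmin n f = (INF x\<in>unit_ball n. peval f x)"

definition fmax :: "nat \<Rightarrow> mpoly \<Rightarrow> real" where
  "fmax n f = (SUP x\<in>unit_ball n. peval f x)"

definition sup_norm :: "nat \<Rightarrow> mpoly \<Rightarrow> real" where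
  "sup_norm n p = (SUP x\<in>unit_ball n. \<bar>peval p x\<bar>)"

definition sos :: "nat \<Rightarrow> mpoly set" where
  "sos n = {\<Sum>i<m. (g i)\<^sup>2 | (m :: nat) g. \<forall>i<m. g i \<in> polys n}"

definition ball_poly :: "nat \<Rightarrow> mpoly" where
  "ball_poly n = 1 - (\<Sum>i<n. (mvar i)\<^sup>2)"

definition preordering :: "nat \<Rightarrow> nat \<Rightarrow> mpoly set" where
  "preordering n k = {\<sigma>0 + \<sigma>1 * ball_poly n | \<sigma>0 \<sigma>1.
     \<sigma>0 \<in> sos n \<and> \<sigma>1 \<in> sos n \<and> total_degree \<sigma>0 \<le> k \<and> total_degree (\<sigma>1 * ball_poly n) \<le> k}"

text \<open>
  The supremum is taken in the extended reals: if no \<open>c\<close> were feasible, the bound would be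
  minus infinity rather than an unspecified real number.
\<close>

definition lb :: "nat \<Rightarrow> mpoly \<Rightarrow> nat \<Rightarrow> ereal" where
  "lb n f r = (SUP c\<in>{c. f - mconst c \<in> preordering n (2 * r)}. ereal c)"

text \<open>
  On the unit sphere \<open>ball_weight\<close> is 0 (division by zero); this is a Lebesgue null set.
\<close>

definition ball_weight :: "nat \<Rightarrow> (nat \<Rightarrow> real) \<Rightarrow> real" where
  "ball_weight n x = indicator (unit_ball n) x / sqrt (1 - (\<Sum>i<n. (x i)\<^sup>2))"

definition ball_const :: "nat \<Rightarrow> real" where
  "ball_const n = 1 / (LINT x|(\<Pi>\<^sub>M i\<in>{..<n}. lborel). ball_weight n x)"

definition ball_measure :: "nat \<Rightarrow> (nat \<Rightarrow> real) measure" where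
  "ball_measure n =
     density (\<Pi>\<^sub>M i\<in>{..<n}. lborel) (\<lambda>x. ennreal (ball_const n * ball_weight n x))"

definition ball_inner :: "nat \<Rightarrow> mpoly \<Rightarrow> mpoly \<Rightarrow> real" where
  "ball_inner n p q = (LINT x|ball_measure n. peval p x * peval q x)"

text \<open>
  \<open>total_degree q < k\<close> stands for degree at most \<open>k - 1\<close>; for \<open>k = 0\<close> there is no
  such \<open>q\<close>, and the definition yields the constants.
\<close>

definition H_space :: "nat \<Rightarrow> nat \<Rightarrow> mpoly set" where
  "H_space n k = {p \<in> polys_le n k. \<forall>q\<in>polys n. total_degree q < k \<longrightarrow> ball_inner n p q = 0}"

definition decomposes :: "nat \<Rightarrow> nat \<Rightarrow> mpoly \<Rightarrow> (nat \<Rightarrow> mpoly) \<Rightarrow> bool" where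
  "decomposes n d p P \<longleftrightarrow> (\<forall>k\<le>d. P k \<in> H_space n k) \<and> p = (\<Sum>k\<le>d. P k)"

text \<open>
  The components \<open>P k\<close> are determined by \<open>p\<close>. As for \<open>lb\<close>, the supremum is taken in the
  extended reals, so an upper bound on \<open>gamma\<close> by a real number includes its finiteness.
\<close>

definition gamma :: "nat \<Rightarrow> nat \<Rightarrow> ereal" where
  "gamma n d = Sup {ereal (sup_norm n (P k) / sup_norm n p) | p P k.
     p \<in> polys_le n d \<and> p \<noteq> 0 \<and> decomposes n d p P \<and> k \<le> d}"

definition C_B :: "nat \<Rightarrow> nat \<Rightarrow> ereal" where
  "C_B n d = ereal (2 * real n ^ 2 * real d ^ 3) * gamma n d"

end

theory Submission
  imports Defs
begin

text \<open>
  The ball with weight \<open>(1 - dot n x x) powr (- 1 / 2)\<close> is the projection of the sphere in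
  \<open>n + 1\<close> coordinates, and a function on the ball is a function on the sphere that ignores the
  last coordinate. For a univariate polynomial \<open>u\<close> of degree at most \<open>r\<close> let
  \<open>K f X\<close> be the spherical mean of \<open>u (dot X y) ^ 2 * f y\<close>. Averaging over the two
  hemispheres removes the odd powers of \<open>sqrt (1 - dot n x x)\<close>, so \<open>K g\<close> lies in the
  preordering whenever \<open>g\<close> is nonnegative on the ball. Also \<open>K\<close> preserves the degree, and it is
  close to the identity: averaging \<open>f\<close> over \<open>y\<close> and its mirror image with respect to the axis
  \<open>X\<close> gives an even trigonometric polynomial of the angle, so
  \<open>K f - f\<close> is bounded by \<open>sqrt 2 * d ^ 3\<close> times the norm of \<open>f\<close> times the mean of
  \<open>u (dot X y) ^ 2 * (1 - dot X y)\<close>. That mean is \<open>O (n ^ 2 / r ^ 2)\<close> for a polynomial \<open>u\<close>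
  whose roots are quadrature nodes on the circle. Hence \<open>K\<close> is invertible on polynomials of degree
  at most \<open>d\<close>, and \<open>f - fmin + e = K g\<close> with \<open>g\<close> nonnegative. Of \<open>gamma\<close> only
  \<open>gamma \<ge> 1\<close> is used here; its upper bound is the dimension of the space of polynomials, because
  the Christoffel function of that space is constant on the sphere by rotation invariance.
\<close>

section \<open>Polynomials\<close>

text \<open>The obstacle is rotation invariance: the measure is given only by a density on the ball.
  Invariance is obtained from the moments. Wick's formula expresses the mean of a product of linear
  forms through scalar products alone, so a map that preserves scalar products preserves the mean,
  and no change of variables is made. The same formula yields the degree bound for \<open>K\<close>.
  Quadrature on the circle reaches the sphere in \<open>n + 1\<close> coordinates only for odd
  \<open>n\<close>, because a factor \<open>1 - t^2\<close> in the weight raises \<open>n\<close> by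
  two. For even \<open>n\<close> the result for \<open>n + 1\<close> is brought down by slicing the
  sphere. The constants: with x = n^2 d^3 / r^2 the deviation of \<open>K\<close> from the identity
  is at most sqrt 2 * pi^2 * x / 8, hence at most 2 x. The hypothesis on \<open>r\<close> says that
  x is at most 1/4, so the deviation is at most 1/2 and inverting \<open>K\<close> costs at most 4 x
  times the norm. Centring \<open>f\<close> at the midpoint of its range makes that norm half of
  \<open>fmax - fmin\<close>, which leaves the 2 in \<open>C_B\<close>.\<close>

abbreviation lookup where "lookup \<equiv> Poly_Mapping.lookup"
abbreviation keys where "keys \<equiv> Poly_Mapping.keys"
abbreviation single where "single \<equiv> Poly_Mapping.single"

definition mdeg :: "(nat \<Rightarrow>\<^sub>0 nat) \<Rightarrow> nat" where
  "mdeg m = (\<Sum>i\<in>keys m. lookup m i)"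

definition meval :: "(nat \<Rightarrow>\<^sub>0 nat) \<Rightarrow> (nat \<Rightarrow> real) \<Rightarrow> real" where
  "meval m x = (\<Prod>i\<in>keys m. x i ^ lookup m i)"

definition monoms :: "nat \<Rightarrow> nat \<Rightarrow> (nat \<Rightarrow>\<^sub>0 nat) set" where
  "monoms n k = {m. keys m \<subseteq> {..<n} \<and> mdeg m \<le> k}"

lemma meval_superset:
  assumes "finite A" "keys m \<subseteq> A"
  shows "meval m x = (\<Prod>i\<in>A. x i ^ lookup m i)"
  unfolding meval_def using assms
  by (intro prod.mono_neutral_left) (auto simp: in_keys_iff)

lemma mdeg_superset:
  assumes "finite A" "keys m \<subseteq> A"
  shows "mdeg m = (\<Sum>i\<in>A. lookup m i)"
  unfolding mdeg_def using assms
  by (intro sum.mono_neutral_left) (auto simp: in_keys_iff)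

lemma keys_add_nat:
  fixes a b :: "'a \<Rightarrow>\<^sub>0 nat"
  shows "keys (a + b) = keys a \<union> keys b"
  by (auto simp: in_keys_iff lookup_add)

lemma meval_add: "meval (a + b) x = meval a x * meval b x"
proof -
  define A where "A = keys a \<union> keys b"
  have "finite A" "keys a \<subseteq> A" "keys b \<subseteq> A" "keys (a + b) \<subseteq> A"
    by (auto simp: A_def keys_add_nat)
  then show ?thesis
    by (simp add: meval_superset[of A] lookup_add power_add prod.distrib)
qed

lemma mdeg_add: "mdeg (a + b) = mdeg a + mdeg b"
proof -
  define A where "A = keys a \<union> keys b"
  have "finite A" "keys a \<subseteq> A" "keys b \<subseteq> A" "keys (a + b) \<subseteq> A"
    by (auto simp: A_def keys_add_nat)
  then show ?thesis
    by (simp add: mdeg_superset[of A] lookup_add sum.distrib)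
qed

lemma meval_0 [simp]: "meval 0 x = 1" and mdeg_0 [simp]: "mdeg 0 = 0"
  by (simp_all add: meval_def mdeg_def)

lemma meval_single [simp]: "meval (single i k) x = x i ^ k"
  and mdeg_single [simp]: "mdeg (single i k) = k"
  by (cases "k = 0"; simp add: meval_def mdeg_def)+

lemma monoms_add: "a \<in> monoms n k \<Longrightarrow> b \<in> monoms n l \<Longrightarrow> a + b \<in> monoms n (k + l)"
  by (auto simp: monoms_def mdeg_add keys_add_nat)

lemma mpoly_sum_monoms: "(p :: mpoly) = (\<Sum>m\<in>keys p. single m (lookup p m))"
  by (rule poly_mapping_eqI)
    (simp add: lookup_sum lookup_single when_def in_keys_iff)

lemma peval_superset:
  assumes "finite A" "keys p \<subseteq> A"
  shows "peval p x = (\<Sum>m\<in>A. lookup p m * meval m x)"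
  unfolding peval_def meval_def[symmetric] using assms
  by (intro sum.mono_neutral_left) (auto simp: in_keys_iff)

lemma peval_add [simp]: "peval (p + q) x = peval p x + peval q x"
proof -
  define A where "A = keys p \<union> keys q"
  have "finite A" "keys p \<subseteq> A" "keys q \<subseteq> A" "keys (p + q) \<subseteq> A"
    using keys_add[of p q] by (auto simp: A_def)
  then show ?thesis
    by (simp add: peval_superset[of A] lookup_add sum.distrib algebra_simps)
qed

lemma peval_0 [simp]: "peval 0 x = 0"
  by (simp add: peval_def)

lemma peval_single [simp]: "peval (single m c) x = c * meval m x"
  by (cases "c = 0") (simp_all add: peval_def meval_def)

lemma peval_sum [simp]: "peval (\<Sum>i\<in>A. f i) x = (\<Sum>i\<in>A. peval (f i) x)"
  by (induction A rule: infinite_finite_induct) simp_all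

lemma peval_uminus [simp]: "peval (- p) x = - peval p x"
  using peval_add[of p "- p" x] by simp

lemma peval_diff [simp]: "peval (p - q) x = peval p x - peval q x"
  using peval_add[of p "- q" x] by simp

lemma mpoly_mult_eq:
  "(p :: mpoly) * q = (\<Sum>a\<in>keys p. \<Sum>b\<in>keys q.
     single (a + b) (lookup p a * lookup q b))"
proof -
  have "p * q = (\<Sum>m\<in>keys p. single m (lookup p m)) *
      (\<Sum>m\<in>keys q. single m (lookup q m))"
    using mpoly_sum_monoms[of p] mpoly_sum_monoms[of q] by simp
  then show ?thesis
    by (simp only: sum_product mult_single)
qed

lemma peval_mult [simp]: "peval (p * q) x = peval p x * peval q x"
proof -
  have "peval (p * q) x = (\<Sum>a\<in>keys p. \<Sum>b\<in>keys q.
      (lookup p a * meval a x) * (lookup q b * meval b x))"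
    by (subst mpoly_mult_eq) (simp add: meval_add algebra_simps)
  also have "\<dots> = peval p x * peval q x"
    unfolding sum_product[symmetric] peval_def meval_def ..
  finally show ?thesis .
qed

lemma peval_mconst [simp]: "peval (mconst c) x = c"
  by (simp add: mconst_def)

lemma peval_1 [simp]: "peval 1 x = 1"
  using peval_mconst[of 1 x] by (simp add: mconst_def)

lemma peval_mvar [simp]: "peval (mvar i) x = x i"
  by (simp add: mvar_def)

lemma peval_power [simp]: "peval (p ^ k) x = peval p x ^ k"
  by (induction k) simp_all

lemma mconst_0 [simp]: "mconst 0 = 0" and mconst_1 [simp]: "mconst 1 = 1"
  by (simp_all add: mconst_def)

lemma mconst_add: "mconst (a + b) = mconst a + mconst b"
  by (simp add: mconst_def single_add)

lemma mconst_mult: "mconst (a * b) = mconst a * mconst b"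
  by (simp add: mconst_def mult_single)

lemma total_degree_le_iff:
  "total_degree p \<le> k \<longleftrightarrow> (\<forall>m\<in>keys p. mdeg m \<le> k)"
  by (simp add: total_degree_def mdeg_def)

lemma mpoly_expand: "p = (\<Sum>m\<in>keys p. mconst (lookup p m) * single m 1)"
  by (subst mpoly_sum_monoms) (simp add: mconst_def mult_single)

lemma polys_le_iff: "p \<in> polys_le n k \<longleftrightarrow> keys p \<subseteq> monoms n k"
  by (auto simp: polys_le_def polys_def total_degree_le_iff monoms_def)

lemma polys_le_mono: "p \<in> polys_le n k \<Longrightarrow> n \<le> n' \<Longrightarrow> k \<le> k' \<Longrightarrow> p \<in> polys_le n' k'"
  by (force simp: polys_le_iff monoms_def)

lemma polys_in_polys_le: "p \<in> polys n \<Longrightarrow> p \<in> polys_le n (total_degree p)"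
  by (simp add: polys_le_def)

lemma polys_le_imp_polys: "p \<in> polys_le n k \<Longrightarrow> p \<in> polys n"
  by (simp add: polys_le_def)

lemma polys_le_0 [simp]: "0 \<in> polys_le n k"
  by (simp add: polys_le_iff)

lemma polys_le_add: "p \<in> polys_le n k \<Longrightarrow> q \<in> polys_le n k \<Longrightarrow> p + q \<in> polys_le n k"
  using keys_add[of p q] by (auto simp: polys_le_iff)

lemma polys_le_sum: "(\<And>i. i \<in> A \<Longrightarrow> f i \<in> polys_le n k) \<Longrightarrow> (\<Sum>i\<in>A. f i) \<in> polys_le n k"
  by (induction A rule: infinite_finite_induct) (simp_all add: polys_le_add)

lemma polys_le_single: "m \<in> monoms n k \<Longrightarrow> single m c \<in> polys_le n k"
  by (simp add: polys_le_iff)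

lemma polys_le_mult: "p \<in> polys_le n k \<Longrightarrow> q \<in> polys_le n l \<Longrightarrow> p * q \<in> polys_le n (k + l)"
  by (subst mpoly_mult_eq, intro polys_le_sum polys_le_single monoms_add) (auto simp: polys_le_iff)

lemma polys_le_mconst [simp]: "mconst c \<in> polys_le n k"
  by (simp add: mconst_def polys_le_single monoms_def)

lemma polys_le_1 [simp]: "1 \<in> polys_le n k"
  using polys_le_mconst[of 1] by simp

lemma polys_le_cmult: "p \<in> polys_le n k \<Longrightarrow> mconst c * p \<in> polys_le n k"
  using polys_le_mult[OF polys_le_mconst[of c n 0]] by simp

lemma mconst_uminus: "mconst (- c) = - mconst c"
  by (simp add: mconst_def single_uminus)

lemma polys_le_uminus: "p \<in> polys_le n k \<Longrightarrow> - p \<in> polys_le n k"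
  using polys_le_cmult[of p n k "- 1"] by (simp add: mconst_uminus)

lemma polys_le_diff: "p \<in> polys_le n k \<Longrightarrow> q \<in> polys_le n k \<Longrightarrow> p - q \<in> polys_le n k"
  using polys_le_add[of p n k "- q"] polys_le_uminus by simp

lemma polys_le_mvar: "i < n \<Longrightarrow> 1 \<le> k \<Longrightarrow> mvar i \<in> polys_le n k"
  by (simp add: mvar_def polys_le_single monoms_def)

lemma polys_le_power: "p \<in> polys_le n k \<Longrightarrow> p ^ j \<in> polys_le n (j * k)"
  by (induction j) (auto dest: polys_le_mult)

definition dot :: "nat \<Rightarrow> (nat \<Rightarrow> real) \<Rightarrow> (nat \<Rightarrow> real) \<Rightarrow> real" where
  "dot n x y = (\<Sum>i<n. x i * y i)"

definition lform :: "nat \<Rightarrow> (nat \<Rightarrow> real) \<Rightarrow> mpoly" where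
  "lform n x = (\<Sum>i<n. mconst (x i) * mvar i)"

lemma peval_lform [simp]: "peval (lform n x) y = dot n x y"
  by (simp add: lform_def dot_def)

lemma polys_le_lform: "n \<le> n' \<Longrightarrow> 1 \<le> k \<Longrightarrow> lform n x \<in> polys_le n' k"
  unfolding lform_def by (intro polys_le_sum polys_le_cmult polys_le_mvar) auto

lemma peval_cong:
  assumes "p \<in> polys n" "\<And>i. i < n \<Longrightarrow> x i = y i"
  shows "peval p x = peval p y"
  unfolding peval_def
proof (intro sum.cong refl arg_cong2[where f = "(*)"] prod.cong)
  fix m i assume "m \<in> keys p" "i \<in> keys m"
  with assms show "x i ^ lookup m i = y i ^ lookup m i"
    unfolding polys_def by force
qed

text \<open>Kronecker's substitution \<open>x i = t ^ (B ^ i)\<close> separates monomials of degree less than \<open>B\<close>.\<close>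

lemma base_digits_unique:
  fixes a b :: "nat \<Rightarrow> nat"
  assumes "\<And>i. i < n \<Longrightarrow> a i < B" "\<And>i. i < n \<Longrightarrow> b i < B"
    and "(\<Sum>i<n. a i * B ^ i) = (\<Sum>i<n. b i * B ^ i)"
  shows "\<forall>i<n. a i = b i"
  using assms
proof (induction n arbitrary: a b)
  case 0
  then show ?case by simp
next
  case (Suc n)
  have split: "(\<Sum>i<Suc n. c i * B ^ i) = c 0 + B * (\<Sum>i<n. c (Suc i) * B ^ i)" for c :: "nat \<Rightarrow> nat"
    by (simp add: sum.lessThan_Suc_shift sum_distrib_left algebra_simps del: sum.lessThan_Suc)
  have B: "B > 0" using Suc.prems(1)[of 0] by simp
  have eq: "a 0 + B * (\<Sum>i<n. a (Suc i) * B ^ i) = b 0 + B * (\<Sum>i<n. b (Suc i) * B ^ i)"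
    using Suc.prems(3) unfolding split .
  have "a 0 = b 0"
    using arg_cong[OF eq, of "\<lambda>x. x mod B"] Suc.prems(1,2)[of 0] by simp
  moreover have "\<forall>i<n. a (Suc i) = b (Suc i)"
    using eq \<open>a 0 = b 0\<close> B by (intro Suc.IH) (auto intro: Suc.prems(1,2))
  ultimately show ?case by (auto simp: less_Suc_eq_0_disj)
qed

lemma dot_self: "dot n x x = (\<Sum>i<n. (x i)\<^sup>2)"
  by (simp add: dot_def power2_eq_square)

lemma unit_ball_iff: "x \<in> unit_ball n \<longleftrightarrow> x \<in> extensional {..<n} \<and> dot n x x \<le> 1"
  by (auto simp: unit_ball_def dot_self PiE_def)

text \<open>Membership in \<open>preordering\<close> concerns formal polynomials, whereas all
  averages are computed pointwise; this lemma passes from the second kind of identity to the first.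
  Along the curve of the substitution \<open>p\<close> becomes a univariate polynomial with
  infinitely many zeros, and injectivity of \<open>e\<close> on the monomials of \<open>p\<close>
  recovers each coefficient.\<close>

lemma polys_zero_on_ball:
  assumes p: "p \<in> polys n" and z: "\<And>x. x \<in> unit_ball n \<Longrightarrow> peval p x = 0"
  shows "p = 0"
proof -
  define B where "B = Suc (total_degree p)"
  define e where "e m = (\<Sum>i<n. lookup m i * B ^ i)" for m :: "nat \<Rightarrow>\<^sub>0 nat"
  let ?K = "keys p"
  have sub: "keys m \<subseteq> {..<n}" if "m \<in> ?K" for m
    using p that by (auto simp: polys_def)
  have small: "lookup m i < B" if "m \<in> ?K" for m i
  proof (cases "i \<in> keys m")
    case True
    have "lookup m i \<le> mdeg m" unfolding mdeg_def using True by (intro member_le_sum) auto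
    also have "\<dots> \<le> total_degree p" using that total_degree_le_iff by blast
    finally show ?thesis by (simp add: B_def)
  qed (simp add: B_def in_keys_iff)
  have inj: "inj_on e ?K"
  proof (rule inj_onI)
    fix a b assume ab: "a \<in> ?K" "b \<in> ?K" "e a = e b"
    then have "\<forall>i<n. lookup a i = lookup b i"
      by (intro base_digits_unique[of n _ B]) (auto simp: e_def small)
    moreover have "lookup a i = 0 \<and> lookup b i = 0" if "\<not> i < n" for i
      using sub[OF ab(1)] sub[OF ab(2)] that by (auto simp: in_keys_iff)
    ultimately show "a = b" by (intro poly_mapping_eqI) metis
  qed
  define Q where "Q = (\<Sum>m\<in>?K. monom (lookup p m) (e m))"
  have ev: "poly Q t = peval p (\<lambda>i. t ^ (B ^ i))" for t
    unfolding Q_def peval_superset[OF finite_keys subset_refl]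
    by (auto simp: poly_sum poly_monom e_def meval_superset[OF _ sub] power_sum
        power_mult[symmetric] mult.commute intro!: sum.cong)
  \<comment> \<open>The curve starts at the origin: each squared coordinate is at most
    \<open>t\<close>, so the curve stays in the ball as long as \<open>n * t\<close> is at most
    1.\<close>
  have "poly Q t = 0" if t: "0 < t" "t < 1 / Suc n" for t
  proof -
    let ?x = "restrict (\<lambda>i. t ^ (B ^ i)) {..<n}"
    have t1: "t \<le> 1" using t by (auto simp: field_simps) (smt (verit) mult_nonneg_nonneg of_nat_0_le_iff)
    have "dot n ?x ?x \<le> (\<Sum>i<n. t)"
      unfolding dot_def
    proof (intro sum_mono)
      fix i assume "i \<in> {..<n}"
      have "t ^ (B ^ i) \<le> t ^ 1" using t t1 by (intro power_decreasing) (auto simp: B_def Suc_leI)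
      then have "t ^ (B ^ i) * t ^ (B ^ i) \<le> t * 1"
        using t t1 by (intro mult_mono) (auto intro: power_le_one)
      then show "?x i * ?x i \<le> t" using \<open>i \<in> _\<close> by simp
    qed
    also have "\<dots> \<le> 1" using t by (simp add: field_simps)
    finally have "?x \<in> unit_ball n" by (simp add: unit_ball_iff)
    from z[OF this] have "peval p (\<lambda>i. t ^ (B ^ i)) = 0"
      by (subst peval_cong[OF p, where y = ?x]) auto
    then show ?thesis by (simp add: ev)
  qed
  then have "{0<..<1 / real (Suc n)} \<subseteq> {t. poly Q t = 0}" by auto
  moreover have "infinite {0<..<1 / real (Suc n)}" by (intro infinite_Ioo) simp
  ultimately have "Q = 0" using poly_roots_finite finite_subset by blast
  have "lookup p m = 0" if "m \<in> ?K" for m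
  proof -
    have "coeff Q (e m) = (\<Sum>m'\<in>?K. if m' = m then lookup p m' else 0)"
      unfolding Q_def coeff_sum coeff_monom using inj that
      by (intro sum.cong) (auto dest: inj_onD)
    also have "\<dots> = lookup p m" using that by simp
    finally show ?thesis using \<open>Q = 0\<close> by simp
  qed
  then have "lookup p m = 0" for m by (cases "m \<in> ?K") (auto simp: in_keys_iff)
  then show ?thesis by (intro poly_mapping_eqI) simp
qed

section \<open>Moments of the ball\<close>

lemma Beta_real_pos: "a > 0 \<Longrightarrow> b > 0 \<Longrightarrow> Beta a b > (0 :: real)"
  by (simp add: Beta_def)

lemma nn_integral_even_lborel:
  fixes f :: "real \<Rightarrow> ennreal"
  assumes [measurable]: "f \<in> borel_measurable borel" and even: "\<And>x. f (- x) = f x"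
  shows "(\<integral>\<^sup>+x. f x \<partial>lborel) = 2 * (\<integral>\<^sup>+x. f x * indicator {0..} x \<partial>lborel)"
proof -
  have "(\<integral>\<^sup>+x. f x \<partial>lborel) = (\<integral>\<^sup>+x. f x * indicator {0..} x + f x * indicator {..0} x \<partial>lborel)"
    by (intro nn_integral_cong_AE eventually_mono[OF AE_lborel_singleton[of 0]])
      (auto simp: indicator_def)
  also have "\<dots> = (\<integral>\<^sup>+x. f x * indicator {0..} x \<partial>lborel) + (\<integral>\<^sup>+x. f x * indicator {..0} x \<partial>lborel)"
    by (rule nn_integral_add) auto
  also have "(\<integral>\<^sup>+x. f x * indicator {..0} x \<partial>lborel) = (\<integral>\<^sup>+x. f x * indicator {0..} x \<partial>lborel)"
    by (subst nn_integral_real_affine[where c = "-1" and t = 0])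
      (auto simp: even indicator_def intro!: nn_integral_cong)
  finally show ?thesis by (simp add: mult_2)
qed

text \<open>Euler's Beta integral under the substitution v = y^2, doubled by evenness. As
  \<open>0 powr b\<close> is 0, the \<open>max\<close> cuts the integrand off outside the interval
  from -1 to 1.\<close>

lemma nn_integral_Beta_square:
  fixes b :: real and a :: nat
  assumes b: "b > -1"
  shows "(\<integral>\<^sup>+y. ennreal (\<bar>y\<bar> ^ a * max 0 (1 - y\<^sup>2) powr b) \<partial>lborel)
    = ennreal (Beta ((real a + 1) / 2) (b + 1))"
proof -
  define h where "h v = v powr ((real a - 1) / 2) * (1 - v) powr b" for v :: real
  have [measurable]: "h \<in> borel_measurable borel" unfolding h_def by measurable
  have beta: "(\<integral>\<^sup>+v. ennreal (h v) * indicator {0..1} v \<partial>lborel) = ennreal (Beta ((real a + 1) / 2) (b + 1))"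
  proof (rule nn_integral_has_integral_lebesgue')
    have "((real a + 1) / 2 - 1) = (real a - 1) / 2" by (simp add: field_simps)
    then show "(h has_integral Beta ((real a + 1) / 2) (b + 1)) {0..1}"
      using has_integral_Beta_real[of "(real a + 1) / 2" "b + 1"] b unfolding h_def by simp
  qed (auto simp: h_def)
  have "(\<integral>\<^sup>+v. ennreal (h v) * indicator {0..1} v \<partial>lborel)
    = (\<integral>\<^sup>+v. ennreal (h v) * indicator {0\<^sup>2..1\<^sup>2} v \<partial>lborel)" by simp
  also have "\<dots> = (\<integral>\<^sup>+t. ennreal (h (t\<^sup>2)) * ennreal (2 * t) * indicator {0..1} t \<partial>lborel)"
    by (rule nn_integral_substitution_aux) (auto intro!: derivative_eq_intros continuous_intros)
  also have "\<dots> = (\<integral>\<^sup>+t. 2 * (ennreal (\<bar>t\<bar> ^ a * max 0 (1 - t\<^sup>2) powr b) * indicator {0..} t) \<partial>lborel)"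
  proof (intro nn_integral_cong_AE eventually_mono[OF AE_lborel_singleton[of 0]])
    fix t :: real assume t: "t \<noteq> 0"
    show "ennreal (h (t\<^sup>2)) * ennreal (2 * t) * indicator {0..1} t
      = 2 * (ennreal (\<bar>t\<bar> ^ a * max 0 (1 - t\<^sup>2) powr b) * indicator {0..} t)"
    proof (cases "t \<in> {0..1}")
      case True
      then have pos: "t > 0" "t\<^sup>2 \<le> 1" using t by (auto simp: power_le_one)
      have "(t\<^sup>2) powr ((real a - 1) / 2) = t powr (real a - 1)"
      proof -
        have "(t powr 2) powr ((real a - 1) / 2) = t powr (2 * ((real a - 1) / 2))" by (rule powr_powr)
        moreover have "2 * ((real a - 1) / 2) = real a - 1" by simp
        ultimately show ?thesis using pos by (simp only: powr_numeral)
      qed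
      then have "(t\<^sup>2) powr ((real a - 1) / 2) * t = t ^ a"
        using pos by (simp add: powr_diff powr_realpow)
      then have "h (t\<^sup>2) * (2 * t) = 2 * (\<bar>t\<bar> ^ a * max 0 (1 - t\<^sup>2) powr b)"
        using pos by (simp add: h_def algebra_simps)
      moreover have "h (t\<^sup>2) \<ge> 0" by (simp add: h_def)
      ultimately have "ennreal (h (t\<^sup>2)) * ennreal (2 * t) = ennreal (2 * (\<bar>t\<bar> ^ a * max 0 (1 - t\<^sup>2) powr b))"
        using pos by (simp add: ennreal_mult'[symmetric])
      also have "\<dots> = 2 * ennreal (\<bar>t\<bar> ^ a * max 0 (1 - t\<^sup>2) powr b)"
        by (subst ennreal_mult') auto
      finally show ?thesis using True by simp
    next
      case False
      then have "t < 0 \<or> max 0 (1 - t\<^sup>2) = 0"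
        by (auto simp: max_def) (smt (verit) one_le_power)
      then show ?thesis using False by auto
    qed
  qed
  also have "\<dots> = (\<integral>\<^sup>+t. ennreal (\<bar>t\<bar> ^ a * max 0 (1 - t\<^sup>2) powr b) \<partial>lborel)"
    by (subst nn_integral_cmult, measurable, subst (2) nn_integral_even_lborel) auto
  finally show ?thesis using beta by simp
qed

text \<open>Rescaling by \<open>sqrt R\<close>. The result is again a power of
  \<open>max 0 R\<close>, so in the induction over the dimension the integrand keeps its shape and
  only \<open>b\<close> grows.\<close>

lemma nn_integral_Beta_square_scaled:
  fixes b R :: real and a :: nat
  assumes b: "b > -1"
  shows "(\<integral>\<^sup>+y. ennreal (\<bar>y\<bar> ^ a * max 0 (R - y\<^sup>2) powr b) \<partial>lborel)
    = ennreal (max 0 R powr (b + (real a + 1) / 2) * Beta ((real a + 1) / 2) (b + 1))"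
proof (cases "R > 0")
  case False
  then have "max 0 (R - y\<^sup>2) = 0" for y by (simp add: max_def) (smt (verit) zero_le_power2)
  then show ?thesis using False by simp
next
  case True
  define s where "s = sqrt R"
  have s: "s > 0" "s\<^sup>2 = R" using True by (simp_all add: s_def)
  have eq: "\<bar>s * y\<bar> ^ a * max 0 (R - (s * y)\<^sup>2) powr b
      = (s ^ a * R powr b) * (\<bar>y\<bar> ^ a * max 0 (1 - y\<^sup>2) powr b)" for y
  proof -
    have "max 0 (R - (s * y)\<^sup>2) = R * max 0 (1 - y\<^sup>2)"
      using True s by (simp add: power_mult_distrib max_def algebra_simps mult_le_cancel_left1)
    then show ?thesis using s True
      by (simp add: powr_mult abs_mult power_mult_distrib)
  qed
  have "(\<integral>\<^sup>+y. ennreal (\<bar>y\<bar> ^ a * max 0 (R - y\<^sup>2) powr b) \<partial>lborel)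
    = ennreal s * (\<integral>\<^sup>+y. ennreal (\<bar>s * y\<bar> ^ a * max 0 (R - (s * y)\<^sup>2) powr b) \<partial>lborel)"
    using s by (subst nn_integral_real_affine[where c = s and t = 0]) auto
  also have "\<dots> = ennreal s * (\<integral>\<^sup>+y. ennreal (s ^ a * R powr b) * ennreal (\<bar>y\<bar> ^ a * max 0 (1 - y\<^sup>2) powr b) \<partial>lborel)"
    unfolding eq using s by (subst ennreal_mult) auto
  also have "\<dots> = ennreal s * (ennreal (s ^ a * R powr b) * ennreal (Beta ((real a + 1) / 2) (b + 1)))"
    by (subst nn_integral_cmult, measurable, subst nn_integral_Beta_square[OF b]) auto
  also have "\<dots> = ennreal (s * (s ^ a * R powr b) * Beta ((real a + 1) / 2) (b + 1))"
    using s b Beta_real_pos[of "(real a + 1) / 2" "b + 1"] by (simp add: ennreal_mult mult.assoc)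
  also have "s * (s ^ a * R powr b) = max 0 R powr (b + (real a + 1) / 2)"
  proof -
    have "s * s ^ a = s powr (real a + 1)" using s by (simp add: powr_add powr_realpow)
    also have "\<dots> = R powr ((real a + 1) / 2)"
      using True by (simp add: s_def powr_half_sqrt[symmetric] powr_powr)
    finally show ?thesis using True by (simp add: powr_add mult_ac)
  qed
  finally show ?thesis .
qed

interpretation lebesgue_product: product_sigma_finite "\<lambda>_ :: nat. lborel :: real measure"
  by standard

abbreviation lebn :: "nat \<Rightarrow> (nat \<Rightarrow> real) measure" where
  "lebn n \<equiv> \<Pi>\<^sub>M i\<in>{..<n}. lborel"

lemma measurable_dot [measurable]: "(\<lambda>x. dot n x x) \<in> borel_measurable (lebn n)"
  unfolding dot_def by measurable

lemma measurable_ball_moment [measurable]: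
  "(\<lambda>x. (\<Prod>i<n. \<bar>x i\<bar> ^ a i) * max 0 (1 - dot n x x) powr b) \<in> borel_measurable (lebn n)"
proof -
  have [measurable]: "(\<lambda>x. \<Prod>i<n. \<bar>x i\<bar> ^ a i) \<in> borel_measurable (lebn n)"
    by (intro borel_measurable_prod) measurable
  show ?thesis by measurable
qed

text \<open>Dirichlet's integral. Integrating out the last coordinate leaves the same problem in one
  dimension less, with \<open>b\<close> raised by \<open>(a n + 1) / 2\<close>. Absolute values and
  the extended integral postpone every question of integrability.\<close>

theorem nn_integral_ball_moment:
  fixes b :: real and a :: "nat \<Rightarrow> nat"
  assumes b: "b > -1"
  shows "(\<integral>\<^sup>+x. ennreal ((\<Prod>i<n. \<bar>x i\<bar> ^ a i) * max 0 (1 - dot n x x) powr b) \<partial>lebn n)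
    = ennreal (Gamma (b + 1) * (\<Prod>i<n. Gamma ((real (a i) + 1) / 2)) / Gamma (b + 1 + (\<Sum>i<n. (real (a i) + 1) / 2)))"
  using b
proof (induction n arbitrary: b)
  case 0
  have "Gamma (b + 1) > 0" using 0 by (intro Gamma_real_pos) simp
  then show ?case
    by (subst lessThan_0, subst lebesgue_product.nn_integral_empty) (simp_all add: dot_def)
next
  case (Suc n)
  let ?b = "b + (real (a n) + 1) / 2"
  have [measurable]: "(\<lambda>x. ennreal ((\<Prod>i<Suc n. \<bar>x i\<bar> ^ a i) * max 0 (1 - dot (Suc n) x x) powr b))
      \<in> borel_measurable (lebn (Suc n))"
    by (intro measurable_ennreal measurable_ball_moment measurable_compose[OF measurable_ball_moment])
  have "(\<integral>\<^sup>+x. ennreal ((\<Prod>i<Suc n. \<bar>x i\<bar> ^ a i) * max 0 (1 - dot (Suc n) x x) powr b) \<partial>lebn (Suc n))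
    = (\<integral>\<^sup>+x. \<integral>\<^sup>+y. ennreal ((\<Prod>i<Suc n. \<bar>(x(n := y)) i\<bar> ^ a i) *
         max 0 (1 - dot (Suc n) (x(n := y)) (x(n := y))) powr b) \<partial>lborel \<partial>lebn n)"
    unfolding lessThan_Suc
    by (rule lebesgue_product.product_nn_integral_insert) (use \<open>_ \<in> borel_measurable _\<close> in \<open>auto simp: lessThan_Suc\<close>)
  also have "\<dots> = (\<integral>\<^sup>+x. \<integral>\<^sup>+y. ennreal (\<Prod>i<n. \<bar>x i\<bar> ^ a i) *
      ennreal (\<bar>y\<bar> ^ a n * max 0 ((1 - dot n x x) - y\<^sup>2) powr b) \<partial>lborel \<partial>lebn n)"
  proof (intro nn_integral_cong)
    fix x :: "nat \<Rightarrow> real" and y :: real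
    have "(\<Prod>i<n. \<bar>(x(n := y)) i\<bar> ^ a i) = (\<Prod>i<n. \<bar>x i\<bar> ^ a i)" by (intro prod.cong) auto
    moreover have "dot n (x(n := y)) (x(n := y)) = dot n x x"
      unfolding dot_def by (intro sum.cong) auto
    then have "dot (Suc n) (x(n := y)) (x(n := y)) = dot n x x + y\<^sup>2"
      by (simp add: dot_def power2_eq_square)
    ultimately show "ennreal ((\<Prod>i<Suc n. \<bar>(x(n := y)) i\<bar> ^ a i) *
         max 0 (1 - dot (Suc n) (x(n := y)) (x(n := y))) powr b)
       = ennreal (\<Prod>i<n. \<bar>x i\<bar> ^ a i) * ennreal (\<bar>y\<bar> ^ a n * max 0 ((1 - dot n x x) - y\<^sup>2) powr b)"
      by (subst ennreal_mult[symmetric]) (auto simp: algebra_simps prod_nonneg)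
  qed
  also have "\<dots> = (\<integral>\<^sup>+x. ennreal (Beta ((real (a n) + 1) / 2) (b + 1)) *
      ennreal ((\<Prod>i<n. \<bar>x i\<bar> ^ a i) * max 0 (1 - dot n x x) powr ?b) \<partial>lebn n)"
    using Suc.prems Beta_real_pos[of "(real (a n) + 1) / 2" "b + 1"]
    by (intro nn_integral_cong, subst nn_integral_cmult)
      (auto simp: nn_integral_Beta_square_scaled ennreal_mult[symmetric] prod_nonneg mult_ac)
  also have "\<dots> = ennreal (Beta ((real (a n) + 1) / 2) (b + 1)) *
      ennreal (Gamma (?b + 1) * (\<Prod>i<n. Gamma ((real (a i) + 1) / 2)) / Gamma (?b + 1 + (\<Sum>i<n. (real (a i) + 1) / 2)))"
    using Suc.prems by (subst nn_integral_cmult, measurable, subst Suc.IH) (auto simp: add_pos_nonneg intro: less_le_trans)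
  also have "\<dots> = ennreal (Beta ((real (a n) + 1) / 2) (b + 1) * (Gamma (?b + 1) * (\<Prod>i<n. Gamma ((real (a i) + 1) / 2)) / Gamma (?b + 1 + (\<Sum>i<n. (real (a i) + 1) / 2))))"
    using Suc.prems Beta_real_pos[of "(real (a n) + 1) / 2" "b + 1"]
    by (intro ennreal_mult'[symmetric]) auto
  also have "Beta ((real (a n) + 1) / 2) (b + 1) * (Gamma (?b + 1) * (\<Prod>i<n. Gamma ((real (a i) + 1) / 2)) / Gamma (?b + 1 + (\<Sum>i<n. (real (a i) + 1) / 2)))
    = Gamma (b + 1) * (\<Prod>i<Suc n. Gamma ((real (a i) + 1) / 2)) / Gamma (b + 1 + (\<Sum>i<Suc n. (real (a i) + 1) / 2))"
  proof -
    \<comment> \<open>The denominator of the Beta value is the leading Gamma factor of the induction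
      hypothesis, and the two cancel.\<close>
    have "(real (a n) + 1) / 2 > 0" by simp
    then have "?b + 1 > 0" using Suc.prems by linarith
    then have "Gamma (?b + 1) > 0" by (rule Gamma_real_pos)
    then have "x * y / Gamma (?b + 1) * (Gamma (?b + 1) * p / D) = y * (p * x) / D" for x y p D :: real
      by simp
    moreover have "?b + 1 + (\<Sum>i<n. (real (a i) + 1) / 2) = b + 1 + (\<Sum>i<Suc n. (real (a i) + 1) / 2)"
      by simp
    moreover have "(real (a n) + 1) / 2 + (b + 1) = ?b + 1" by simp
    ultimately show ?thesis unfolding Beta_def prod.lessThan_Suc by presburger
  qed
  finally show ?case .
qed

section \<open>The mean over the sphere\<close>

definition hgt :: "nat \<Rightarrow> (nat \<Rightarrow> real) \<Rightarrow> real" where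
  "hgt n x = sqrt (1 - dot n x x)"

definition up :: "nat \<Rightarrow> (nat \<Rightarrow> real) \<Rightarrow> nat \<Rightarrow> real" where
  "up n x = x(n := hgt n x)"

definition dn :: "nat \<Rightarrow> (nat \<Rightarrow> real) \<Rightarrow> nat \<Rightarrow> real" where
  "dn n x = x(n := - hgt n x)"

text \<open>The mean over the unit sphere in \<open>n + 1\<close> coordinates, realised by lifting \<open>ball_measure\<close> to
  the two hemispheres over the ball.\<close>

definition sphere_mean :: "nat \<Rightarrow> mpoly \<Rightarrow> real" where
  "sphere_mean n p = (LINT x|ball_measure n. (peval p (up n x) + peval p (dn n x)) / 2)"

lemma dot_cong: "(\<And>i. i < n \<Longrightarrow> x i = x' i) \<Longrightarrow> (\<And>i. i < n \<Longrightarrow> y i = y' i) \<Longrightarrow> dot n x y = dot n x' y'"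
  by (simp add: dot_def)

lemma dot_Suc: "dot (Suc n) x y = dot n x y + x n * y n"
  by (simp add: dot_def)

lemma dot_commute: "dot n x y = dot n y x"
  by (simp add: dot_def mult.commute)

lemma dot_nonneg: "dot n x x \<ge> 0"
  by (simp add: dot_self sum_nonneg)

lemma dot_up [simp]: "dot n x x \<le> 1 \<Longrightarrow> dot (Suc n) (up n x) (up n x) = 1"
  and dot_dn [simp]: "dot n x x \<le> 1 \<Longrightarrow> dot (Suc n) (dn n x) (dn n x) = 1"
proof -
  have "dot n (up n x) (up n x) = dot n x x" "dot n (dn n x) (dn n x) = dot n x x"
    by (intro dot_cong; simp add: up_def dn_def)+
  then show "dot n x x \<le> 1 \<Longrightarrow> dot (Suc n) (up n x) (up n x) = 1"
    "dot n x x \<le> 1 \<Longrightarrow> dot (Suc n) (dn n x) (dn n x) = 1"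
    by (simp_all add: dot_Suc, simp_all add: up_def dn_def hgt_def)
qed

lemma dot_le_one_coord:
  assumes "dot n x x \<le> 1" "i < n" shows "\<bar>x i\<bar> \<le> 1"
proof -
  have "(x i)\<^sup>2 \<le> dot n x x" unfolding dot_self using assms by (intro member_le_sum) auto
  then show ?thesis using assms abs_square_le_1 by force
qed

text \<open>On the unit sphere both sides are 0 by convention, the left by division by zero and the
  right by \<open>0 powr _\<close>. In the new form the weight is the case
  \<open>b = - 1 / 2\<close> of \<open>nn_integral_ball_moment\<close>.\<close>

lemma ball_weight_eq:
  assumes "x \<in> space (lebn n)"
  shows "ball_weight n x = max 0 (1 - dot n x x) powr (- 1 / 2)"
proof -
  have ball: "x \<in> unit_ball n \<longleftrightarrow> dot n x x \<le> 1"
    using assms by (auto simp: unit_ball_iff space_PiM PiE_def)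
  have "(1 - dot n x x) powr (- 1 / 2) = 1 / sqrt (1 - dot n x x)" if "dot n x x < 1"
    using that by (simp add: powr_minus powr_half_sqrt[symmetric] field_simps)
  then show ?thesis
    by (cases "dot n x x < 1"; cases "dot n x x = 1") (auto simp: ball_weight_def ball dot_self)
qed

text \<open>Half the surface area of the unit sphere in \<open>n + 1\<close> coordinates, that is,
  the area of the hemisphere over the ball.\<close>

definition ball_mass :: "nat \<Rightarrow> real" where
  "ball_mass n = Gamma (1 / 2) ^ Suc n / Gamma (real (Suc n) / 2)"

lemma ball_mass_pos: "ball_mass n > 0"
  unfolding ball_mass_def by (intro divide_pos_pos zero_less_power Gamma_real_pos) auto

lemma measurable_ball_weight [measurable]: "ball_weight n \<in> borel_measurable (lebn n)"
proof -
  have "(\<lambda>x. max 0 (1 - dot n x x) powr (- 1 / 2)) \<in> borel_measurable (lebn n)" by measurable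
  then show ?thesis by (subst measurable_cong[OF ball_weight_eq])
qed

lemma ball_weight_nonneg [simp]: "ball_weight n x \<ge> 0"
  by (auto simp: ball_weight_def unit_ball_iff dot_self indicator_def)

lemma nn_integral_ball_weight: "(\<integral>\<^sup>+x. ennreal (ball_weight n x) \<partial>lebn n) = ennreal (ball_mass n)"
proof -
  have "(\<integral>\<^sup>+x. ennreal (ball_weight n x) \<partial>lebn n)
    = (\<integral>\<^sup>+x. ennreal ((\<Prod>i<n. \<bar>x i\<bar> ^ 0) * max 0 (1 - dot n x x) powr (- 1 / 2)) \<partial>lebn n)"
    by (intro nn_integral_cong) (simp add: ball_weight_eq)
  also have "\<dots> = ennreal (ball_mass n)"
    by (subst nn_integral_ball_moment) (simp_all add: ball_mass_def field_simps)
  finally show ?thesis .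
qed

lemma ball_const_eq: "ball_const n = 1 / ball_mass n"
  unfolding ball_const_def
  by (subst integral_eq_nn_integral) (use ball_mass_pos[of n] in \<open>auto simp: nn_integral_ball_weight\<close>)

lemma ball_const_pos: "ball_const n > 0"
  using ball_mass_pos by (simp add: ball_const_eq)

lemma space_ball_measure [simp]: "space (ball_measure n) = space (lebn n)"
  and sets_ball_measure [measurable_cong]: "sets (ball_measure n) = sets (lebn n)"
  by (simp_all add: ball_measure_def)

lemma emeasure_space_ball_measure: "emeasure (ball_measure n) (space (ball_measure n)) = 1"
proof -
  have "emeasure (ball_measure n) (space (ball_measure n))
      = (\<integral>\<^sup>+x. ennreal (ball_const n) * ennreal (ball_weight n x) \<partial>lebn n)"
    unfolding ball_measure_def using ball_const_pos[of n]
    by (simp add: emeasure_density ennreal_mult[symmetric] cong: nn_integral_cong)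
  also have "\<dots> = 1"
    using ball_mass_pos[of n]
    by (subst nn_integral_cmult) (auto simp: nn_integral_ball_weight ball_const_eq ennreal_mult''[symmetric])
  finally show ?thesis .
qed

lemma finite_measure_ball_measure: "finite_measure (ball_measure n)"
  by (rule finite_measureI) (simp add: emeasure_space_ball_measure del: space_ball_measure)

lemma measure_space_ball_measure: "measure (ball_measure n) (space (ball_measure n)) = 1"
  by (simp add: measure_def emeasure_space_ball_measure del: space_ball_measure)

lemma integral_ball_measure:
  assumes "g \<in> borel_measurable (lebn n)"
  shows "(LINT x|ball_measure n. g x) = ball_const n * (LINT x|lebn n. ball_weight n x * g x)"
  unfolding ball_measure_def using assms ball_const_pos[of n]
  by (subst integral_density) (auto simp: mult.assoc)

text \<open>For drawing contradictions, and with them points, from statements that hold almost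
  everywhere.\<close>

lemma not_AE_False_ball: "\<not> (AE x in ball_measure n. False)"
proof
  assume "AE x in ball_measure n. False"
  then have "space (ball_measure n) \<in> null_sets (ball_measure n)"
    by (simp add: AE_iff_null del: space_ball_measure)
  then have "emeasure (ball_measure n) (space (ball_measure n)) = 0" by (rule null_setsD1)
  then show False by (simp add: emeasure_space_ball_measure del: space_ball_measure)
qed

lemma AE_ball_measure: "AE x in ball_measure n. x \<in> unit_ball n"
  unfolding ball_measure_def
  by (subst AE_density, measurable) (auto simp: ball_weight_def indicator_def split: if_splits)

lemma measurable_hgt [measurable]: "hgt n \<in> borel_measurable (lebn n)"
  unfolding hgt_def by measurable

lemma measurable_meval_ball:
  assumes g: "g = up n \<or> g = dn n" and m: "keys m \<subseteq> {..<Suc n}"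
  shows "(\<lambda>x. meval m (g x)) \<in> borel_measurable (lebn n)"
  unfolding meval_def
proof (intro borel_measurable_prod borel_measurable_power)
  fix i assume "i \<in> keys m"
  with m have "i < n \<or> i = n" by auto
  with g show "(\<lambda>x. g x i) \<in> borel_measurable (lebn n)"
    by (auto simp: up_def dn_def)
qed

lemma measurable_peval_ball:
  assumes g: "g = up n \<or> g = dn n" and p: "p \<in> polys (Suc n)"
  shows "(\<lambda>x. peval p (g x)) \<in> borel_measurable (lebn n)"
  unfolding peval_superset[OF finite_keys subset_refl]
  by (intro borel_measurable_sum borel_measurable_times borel_measurable_const measurable_meval_ball[OF g])
    (use p in \<open>auto simp: polys_def\<close>)

lemma peval_bounded:
  assumes p: "p \<in> polys n" and x: "\<And>i. i < n \<Longrightarrow> \<bar>x i\<bar> \<le> 1"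
  shows "\<bar>peval p x\<bar> \<le> (\<Sum>m\<in>keys p. \<bar>lookup p m\<bar>)"
  unfolding peval_superset[OF finite_keys subset_refl]
proof (rule order_trans[OF sum_abs], intro sum_mono)
  fix m assume m: "m \<in> keys p"
  have "\<bar>meval m x\<bar> \<le> 1" unfolding meval_def abs_prod
  proof (intro prod_le_1 conjI)
    fix i assume "i \<in> keys m"
    with p m have "i < n" by (auto simp: polys_def)
    then show "\<bar>x i ^ lookup m i\<bar> \<le> 1" by (simp add: power_abs power_le_one x)
  qed simp
  then show "\<bar>lookup p m * meval m x\<bar> \<le> \<bar>lookup p m\<bar>"
    by (simp add: abs_mult mult_left_le)
qed

lemma sphere_coord: "dot n y y = 1 \<Longrightarrow> i < n \<Longrightarrow> \<bar>y i\<bar> \<le> 1"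
  by (rule dot_le_one_coord) auto

lemma integrable_peval_ball:
  assumes g: "g = up n \<or> g = dn n" and p: "p \<in> polys (Suc n)"
  shows "integrable (ball_measure n) (\<lambda>x. peval p (g x))"
proof -
  interpret finite_measure "ball_measure n" by (rule finite_measure_ball_measure)
  show ?thesis
  proof (rule integrable_const_bound)
    show "AE x in ball_measure n. norm (peval p (g x)) \<le> (\<Sum>m\<in>keys p. \<bar>lookup p m\<bar>)"
      using AE_ball_measure
    proof eventually_elim
      case (elim x)
      with g have "dot (Suc n) (g x) (g x) = 1" by (auto simp: unit_ball_iff)
      then show ?case using peval_bounded[OF p] sphere_coord by simp
    qed
    show "(\<lambda>x. peval p (g x)) \<in> borel_measurable (ball_measure n)"
      using measurable_peval_ball[OF g p] by (simp add: measurable_cong_sets[OF sets_ball_measure refl])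
  qed
qed

lemma polys_add: "p \<in> polys n \<Longrightarrow> q \<in> polys n \<Longrightarrow> p + q \<in> polys n"
  using keys_add[of p q] unfolding polys_def by blast

lemma polys_mult: "p \<in> polys n \<Longrightarrow> q \<in> polys n \<Longrightarrow> p * q \<in> polys n"
  using polys_le_mult polys_in_polys_le polys_le_imp_polys by blast

lemma polys_mconst [simp]: "mconst c \<in> polys n"
  using polys_le_mconst polys_le_imp_polys by blast

lemma polys_1 [simp]: "1 \<in> polys n" and polys_0 [simp]: "0 \<in> polys n"
  using polys_mconst[of 1 n] polys_mconst[of 0 n] by simp_all

lemma polys_sum: "(\<And>i. i \<in> A \<Longrightarrow> f i \<in> polys n) \<Longrightarrow> (\<Sum>i\<in>A. f i) \<in> polys n"
  by (induction A rule: infinite_finite_induct) (auto intro: polys_add)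

lemma polys_uminus: "p \<in> polys n \<Longrightarrow> - p \<in> polys n"
  by (simp add: polys_def)

lemma polys_diff: "p \<in> polys n \<Longrightarrow> q \<in> polys n \<Longrightarrow> p - q \<in> polys n"
  using polys_add[of p n "- q"] polys_uminus by simp

lemma polys_power: "p \<in> polys n \<Longrightarrow> p ^ k \<in> polys n"
  by (induction k) (auto intro: polys_mult)

lemma polys_mono: "p \<in> polys n \<Longrightarrow> n \<le> n' \<Longrightarrow> p \<in> polys n'"
  unfolding polys_def by force

lemma polys_lform: "n \<le> n' \<Longrightarrow> lform n x \<in> polys n'"
  using polys_le_lform[of n n' 1] polys_le_imp_polys by blast

lemma polys_mvar: "i < n \<Longrightarrow> mvar i \<in> polys n"
  using polys_le_mvar[of i n 1] polys_le_imp_polys by blast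

lemma polys_single: "keys m \<subseteq> {..<n} \<Longrightarrow> single m c \<in> polys n"
  by (simp add: polys_def)

lemmas polys_intros = polys_add polys_mult polys_sum polys_diff polys_power polys_lform polys_mvar polys_uminus polys_mconst polys_1 polys_0

lemma sphere_mean_add:
  assumes "p \<in> polys (Suc n)" "q \<in> polys (Suc n)"
  shows "sphere_mean n (p + q) = sphere_mean n p + sphere_mean n q"
proof -
  have i: "integrable (ball_measure n) (\<lambda>x. (peval p (up n x) + peval p (dn n x)) / 2)"
    if "p \<in> polys (Suc n)" for p
    using that by (intro integrable_divide_zero Bochner_Integration.integrable_add integrable_peval_ball) auto
  show ?thesis
    unfolding sphere_mean_def using assms
    by (subst Bochner_Integration.integral_add[OF i i, symmetric]) (auto simp: add_divide_distrib algebra_simps)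
qed

lemma sphere_mean_cmult: "sphere_mean n (mconst c * p) = c * sphere_mean n p"
  unfolding sphere_mean_def
  by (subst integral_mult_right_zero[symmetric]) (simp add: field_simps)

lemma sphere_mean_0 [simp]: "sphere_mean n 0 = 0"
  by (simp add: sphere_mean_def)

lemma sphere_mean_1 [simp]: "sphere_mean n 1 = 1"
proof -
  show ?thesis using measure_space_ball_measure[of n] unfolding sphere_mean_def by simp
qed

lemma sphere_mean_mconst [simp]: "sphere_mean n (mconst c) = c"
  using sphere_mean_cmult[of n c 1] by simp

lemma sphere_mean_sum:
  "(\<And>i. i \<in> A \<Longrightarrow> f i \<in> polys (Suc n)) \<Longrightarrow> sphere_mean n (\<Sum>i\<in>A. f i) = (\<Sum>i\<in>A. sphere_mean n (f i))"
  by (induction A rule: infinite_finite_induct) (auto simp: sphere_mean_add polys_sum)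

lemma sphere_mean_diff:
  assumes "p \<in> polys (Suc n)" "q \<in> polys (Suc n)"
  shows "sphere_mean n (p - q) = sphere_mean n p - sphere_mean n q"
  using sphere_mean_add[OF assms(1), of "- q"] sphere_mean_cmult[of n "-1" q] assms
  by (simp add: mconst_uminus polys_uminus)

lemma sphere_mean_nonneg:
  assumes "\<And>y. dot (Suc n) y y = 1 \<Longrightarrow> peval p y \<ge> 0"
  shows "sphere_mean n p \<ge> 0"
  unfolding sphere_mean_def
proof (rule integral_nonneg_AE)
  show "AE x in ball_measure n. 0 \<le> (peval p (up n x) + peval p (dn n x)) / 2"
    using AE_ball_measure
  proof eventually_elim
    case (elim x)
    then show ?case using assms[of "up n x"] assms[of "dn n x"] by (simp add: unit_ball_iff)
  qed
qed

lemma sphere_mean_mono: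
  assumes "p \<in> polys (Suc n)" "q \<in> polys (Suc n)"
    and "\<And>y. dot (Suc n) y y = 1 \<Longrightarrow> peval p y \<le> peval q y"
  shows "sphere_mean n p \<le> sphere_mean n q"
  using sphere_mean_nonneg[of n "q - p"] assms by (simp add: sphere_mean_diff)

lemma sphere_mean_cong:
  assumes "p \<in> polys (Suc n)" "q \<in> polys (Suc n)"
    and "\<And>y. dot (Suc n) y y = 1 \<Longrightarrow> peval p y = peval q y"
  shows "sphere_mean n p = sphere_mean n q"
  by (intro antisym sphere_mean_mono) (use assms in auto)

text \<open>A polynomial in the first \<open>n\<close> variables has the same value at both lifts of
  a point, so orthogonality on the ball is orthogonality on the sphere.\<close>

lemma ball_inner_eq:
  assumes "p \<in> polys n" "q \<in> polys n"
  shows "ball_inner n p q = sphere_mean n (p * q)"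
proof -
  have "peval r (up n x) = peval r x" "peval r (dn n x) = peval r x" if "r \<in> polys n" for r x
    by (rule peval_cong[OF that]; simp add: up_def dn_def)+
  with assms show ?thesis by (simp add: ball_inner_def sphere_mean_def)
qed

text \<open>Changing the sign of the last coordinate exchanges the two lifts, so this instance of
  invariance is visible from the definition of the mean.\<close>

lemma sphere_mean_reflect:
  assumes "p \<in> polys (Suc n)" "q \<in> polys (Suc n)"
    and "\<And>y. peval q y = peval p (y(n := - y n))"
  shows "sphere_mean n q = sphere_mean n p"
proof -
  have "up n x = (dn n x)(n := - dn n x n)" "dn n x = (up n x)(n := - up n x n)" for x
    by (auto simp: up_def dn_def)
  then have "peval q (dn n x) = peval p (up n x)" "peval q (up n x) = peval p (dn n x)" for x
    using assms(3) by simp_all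
  then show ?thesis by (simp add: sphere_mean_def add.commute)
qed

lemma integral_odd_coordinate:
  fixes h :: "(nat \<Rightarrow> real) \<Rightarrow> real"
  assumes h: "integrable (lebn n) h" and i: "i < n" and odd: "\<And>x y. h (x(i := - y)) = - h (x(i := y))"
  shows "(LINT x|lebn n. h x) = 0"
proof -
  let ?I = "{..<n} - {i}"
  have eq: "insert i ?I = {..<n}" using i by auto
  have "(LINT x|lebn n. h x) = (LINT x|Pi\<^sub>M ?I (\<lambda>_. lborel). LINT y|lborel. h (x(i := y)))"
    using lebesgue_product.product_integral_insert[of ?I i h, unfolded eq, OF _ _ h] by simp
  also have "\<dots> = 0"
  proof -
    have "(LINT y|lborel. h (x(i := y))) = - (LINT y|lborel. h (x(i := y)))" for x
      by (subst lborel_integral_real_affine[where c = "-1" and t = 0]) (simp_all add: odd)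
    then have "(LINT y|lborel. h (x(i := y))) = 0" for x by simp
    then show ?thesis by simp
  qed
  finally show ?thesis .
qed

text \<open>All \<open>N\<close> coordinates enter symmetrically: this is what makes the weight \<open>ball_weight\<close> special.\<close>

definition sphere_moment :: "nat \<Rightarrow> (nat \<Rightarrow>\<^sub>0 nat) \<Rightarrow> real" where
  "sphere_moment N m = (if \<forall>i<N. even (lookup m i)
     then Gamma (real N / 2) / Gamma (1 / 2) ^ N * (\<Prod>i<N. Gamma ((real (lookup m i) + 1) / 2)) /
       Gamma (\<Sum>i<N. (real (lookup m i) + 1) / 2)
     else 0)"

text \<open>The last coordinate of a lift is plus or minus \<open>hgt n x\<close>, and an even power
  of it merges with the weight into one power of \<open>1 - dot n x x\<close>; Dirichlet's integral
  then treats the last exponent like the others. An odd last exponent cancels between the lifts, any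
  other odd exponent by \<open>integral_odd_coordinate\<close>.\<close>

theorem sphere_mean_monomial:
  assumes m: "keys m \<subseteq> {..<Suc n}"
  shows "sphere_mean n (single m 1) = sphere_moment (Suc n) m"
proof -
  let ?a = "lookup m"
  have ev: "meval m (g x) = (\<Prod>i<n. x i ^ ?a i) * (g x n) ^ ?a n" if "g = up n \<or> g = dn n" for g x
  proof -
    have "(\<Prod>i<n. g x i ^ ?a i) = (\<Prod>i<n. x i ^ ?a i)"
      using that by (intro prod.cong) (auto simp: up_def dn_def)
    moreover have "meval m (g x) = (\<Prod>i<Suc n. g x i ^ ?a i)"
      using m by (rule meval_superset[OF finite_lessThan])
    ultimately show ?thesis by simp
  qed
  show ?thesis
  proof (cases "even (?a n)")
    case False
    have "meval m (up n x) + meval m (dn n x) = 0" for x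
      using False by (simp add: ev) (simp add: up_def dn_def)
    moreover have "sphere_moment (Suc n) m = 0" using False by (auto simp: sphere_moment_def)
    ultimately show ?thesis by (simp add: sphere_mean_def)
  next
    case True
    define b where "b = real (?a n) / 2 - 1 / 2"
    have b: "b > -1" by (simp add: b_def)
    define w where "w x = max 0 (1 - dot n x x) powr b" for x
    define h where "h x = (\<Prod>i<n. x i ^ ?a i) * w x" for x
    have [measurable]: "h \<in> borel_measurable (lebn n)"
    proof -
      have [measurable]: "(\<lambda>x. \<Prod>i<n. x i ^ ?a i) \<in> borel_measurable (lebn n)"
        by (intro borel_measurable_prod) measurable
      show ?thesis unfolding h_def w_def by measurable
    qed
    have wh: "ball_weight n x * ((meval m (up n x) + meval m (dn n x)) / 2) = h x"
      if x: "x \<in> space (lebn n)" for x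
    proof -
      have "max 0 (1 - dot n x x) powr (- 1 / 2) * hgt n x ^ ?a n = w x"
      proof (cases "dot n x x < 1")
        case True
        have "hgt n x ^ ?a n = ((1 - dot n x x) powr (1 / 2)) powr real (?a n)"
          using True by (simp add: hgt_def powr_half_sqrt powr_realpow)
        also have "\<dots> = (1 - dot n x x) powr (real (?a n) / 2)"
          by (simp add: powr_powr)
        finally have "max 0 (1 - dot n x x) powr (- 1 / 2) * hgt n x ^ ?a n
            = (1 - dot n x x) powr (- 1 / 2 + real (?a n) / 2)"
          using True powr_add[of "1 - dot n x x" "- 1 / 2" "real (?a n) / 2"] by simp
        also have "- 1 / 2 + real (?a n) / 2 = b" by (simp add: b_def)
        finally show ?thesis using True by (simp add: w_def)
      next
        case False
        then have "max 0 (1 - dot n x x) = 0" by simp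
        then show ?thesis by (simp add: w_def)
      qed
      moreover have "meval m (up n x) = (\<Prod>i<n. x i ^ ?a i) * hgt n x ^ ?a n"
        "meval m (dn n x) = (\<Prod>i<n. x i ^ ?a i) * hgt n x ^ ?a n"
        using True by (simp_all add: ev, simp_all add: up_def dn_def)
      ultimately show ?thesis by (simp add: ball_weight_eq[OF x] h_def)
    qed
    have "sphere_mean n (single m 1)
        = ball_const n * (LINT x|lebn n. ball_weight n x * ((meval m (up n x) + meval m (dn n x)) / 2))"
      unfolding sphere_mean_def peval_single mult_1
      by (rule integral_ball_measure) (intro borel_measurable_add borel_measurable_divide borel_measurable_const measurable_meval_ball[OF _ m]; simp)
    also have "(LINT x|lebn n. ball_weight n x * ((meval m (up n x) + meval m (dn n x)) / 2)) = (LINT x|lebn n. h x)"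
      by (intro Bochner_Integration.integral_cong wh refl)
    finally have L: "sphere_mean n (single m 1) = ball_const n * (LINT x|lebn n. h x)" .
    define V where "V = Gamma (b + 1) * (\<Prod>i<n. Gamma ((real (?a i) + 1) / 2)) / Gamma (b + 1 + (\<Sum>i<n. (real (?a i) + 1) / 2))"
    have V: "V \<ge> 0"
    proof -
      have b1: "b + 1 > 0" using b by simp
      then have "b + 1 + (\<Sum>i<n. (real (?a i) + 1) / 2) > 0" by (rule add_pos_nonneg) (auto intro!: sum_nonneg)
      then show ?thesis unfolding V_def using b1
        by (intro divide_nonneg_nonneg mult_nonneg_nonneg prod_nonneg less_imp_le[OF Gamma_real_pos]) auto
    qed
    \<comment> \<open>The moment of the absolute value settles integrability before the signs
      produced by odd exponents matter.\<close>
    have absh: "(\<integral>\<^sup>+x. ennreal \<bar>h x\<bar> \<partial>lebn n) = ennreal V"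
      unfolding V_def nn_integral_ball_moment[OF b, symmetric]
      by (intro nn_integral_cong) (simp add: h_def w_def abs_mult abs_prod power_abs)
    then have int: "integrable (lebn n) h"
      by (intro integrableI_bounded) auto
    show ?thesis
    proof (cases "\<forall>i<n. even (?a i)")
      case False
      then obtain i where i: "i < n" "odd (?a i)" by auto
      have "h (x(i := - y)) = - h (x(i := y))" for x y
      proof -
        have "dot n (x(i := - y)) (x(i := - y)) = dot n (x(i := y)) (x(i := y))"
          unfolding dot_def by (intro sum.cong) auto
        moreover have "(\<Prod>j<n. (x(i := y)) j ^ ?a j) = y ^ ?a i * (\<Prod>j\<in>{..<n} - {i}. x j ^ ?a j)" for y
          using i by (subst prod.remove[of _ i]) auto
        ultimately show ?thesis using i by (simp add: h_def w_def)
      qed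
      then have "(LINT x|lebn n. h x) = 0" using integral_odd_coordinate[OF int i(1)] by simp
      moreover have "sphere_moment (Suc n) m = 0" using i by (auto simp: sphere_moment_def)
      ultimately show ?thesis using L by simp
    next
      case ev: True
      have nn: "h x \<ge> 0" for x
        using ev unfolding h_def w_def by (intro mult_nonneg_nonneg prod_nonneg) (auto simp: zero_le_even_power)
      then have "(LINT x|lebn n. h x) = V"
        using absh V by (subst integral_eq_nn_integral) auto
      moreover have b': "b + 1 = (real (?a n) + 1) / 2" by (simp add: b_def field_simps)
      moreover have "(\<Sum>i<Suc n. (real (?a i) + 1) / 2) = b + 1 + (\<Sum>i<n. (real (?a i) + 1) / 2)"
        unfolding b' by simp
      moreover have "(\<Prod>i<Suc n. Gamma ((real (?a i) + 1) / 2)) = Gamma (b + 1) * (\<Prod>i<n. Gamma ((real (?a i) + 1) / 2))"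
        unfolding b' by simp
      moreover have "\<forall>i<Suc n. even (?a i)" using ev True by (auto simp: less_Suc_eq)
      ultimately show ?thesis
        unfolding L ball_const_eq ball_mass_def sphere_moment_def V_def
        by (simp only: if_P divide_divide_eq_right mult_1 times_divide_eq_right times_divide_eq_left simp_thms)
    qed
  qed
qed

section \<open>Wick's formula\<close>

lemma sphere_moment_odd:
  "i < N \<Longrightarrow> odd (lookup m i) \<Longrightarrow> sphere_moment N m = 0"
  by (auto simp: sphere_moment_def)

text \<open>Raising exponent \<open>i\<close> by two shifts the argument of one Gamma factor in the
  numerator and that of the denominator by 1, so the functional equation applies to both. The number
  \<open>N + mdeg m\<close> is twice the argument in the denominator.\<close>

lemma sphere_moment_rec:
  assumes i: "i < N" and m: "keys m \<subseteq> {..<N}"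
  shows "real (N + mdeg m) * sphere_moment N (m + single i 2) = real (lookup m i + 1) * sphere_moment N m"
proof (cases "\<forall>j<N. even (lookup m j)")
  case False
  then show ?thesis by (auto simp: sphere_moment_def lookup_add lookup_single when_def)
next
  case True
  let ?m = "m + single i 2"
  have lk: "lookup ?m j = (if j = i then lookup m i + 2 else lookup m j)" for j
    by (simp add: lookup_add lookup_single when_def)
  let ?g = "\<lambda>j. (real (lookup m j) + 1) / 2"
  have ev: "\<forall>j<N. even (lookup ?m j)" using True by (simp add: lk)
  have sum: "(\<Sum>j<N. ?g j) = real (N + mdeg m) / 2"
    using mdeg_superset[OF finite_lessThan m] by (simp add: sum_divide_distrib[symmetric] sum.distrib)
  have pos: "(\<Sum>j<N. ?g j) > 0" using i by (simp add: sum add_pos_nonneg)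
  have sum': "(\<Sum>j<N. (real (lookup ?m j) + 1) / 2) = (\<Sum>j<N. ?g j) + 1"
  proof -
    have "(\<Sum>j<N. (real (lookup ?m j) + 1) / 2) = (\<Sum>j<N. ?g j + (if j = i then 1 else 0))"
      by (intro sum.cong) (auto simp: lk field_simps)
    also have "\<dots> = (\<Sum>j<N. ?g j) + 1" using i by (simp add: sum.distrib)
    finally show ?thesis .
  qed
  have G: "Gamma ((\<Sum>j<N. ?g j) + 1) = (\<Sum>j<N. ?g j) * Gamma (\<Sum>j<N. ?g j)"
    using pos by (intro Gamma_plus1) (auto elim!: nonpos_Ints_cases)
  have gi: "Gamma (?g i + 1) = ?g i * Gamma (?g i)"
  proof (rule Gamma_plus1)
    have "?g i > 0" by simp
    then show "?g i \<notin> \<int>\<^sub>\<le>\<^sub>0" by (metis nonpos_Ints_nonpos not_le)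
  qed
  have prod: "(\<Prod>j<N. Gamma ((real (lookup ?m j) + 1) / 2)) = ?g i * (\<Prod>j<N. Gamma (?g j))"
  proof -
    have "(\<Prod>j<N. Gamma ((real (lookup ?m j) + 1) / 2))
        = Gamma (?g i + 1) * (\<Prod>j\<in>{..<N} - {i}. Gamma (?g j))"
      using i by (subst prod.remove[of _ i]) (auto simp: lk add_divide_distrib intro!: prod.cong arg_cong[where f = Gamma])
    also have "\<dots> = ?g i * (\<Prod>j<N. Gamma (?g j))"
      using i by (subst (2) prod.remove[of _ i]) (auto simp: gi)
    finally show ?thesis .
  qed
  have N: "real (N + mdeg m) = 2 * (\<Sum>j<N. ?g j)" using sum by simp
  have M: "real (lookup m i + 1) = 2 * ?g i" by simp
  have cancel: "2 * S * (A * (g * P) / (S * G)) = 2 * g * (A * P / G)" if "S \<noteq> 0" for S A g P G :: real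
    using that by simp
  show ?thesis
    unfolding N M sphere_moment_def if_P[OF True] if_P[OF ev] sum' prod G
    by (rule cancel) (use pos in simp)
qed

definition lprod :: "nat \<Rightarrow> (nat \<Rightarrow> real) list \<Rightarrow> mpoly" where
  "lprod N zs = prod_list (map (lform N) zs)"

text \<open>The derivative of \<open>lprod N zs\<close> in direction \<open>x\<close>, defined
  through the product rule.\<close>

primrec dprod :: "nat \<Rightarrow> (nat \<Rightarrow> real) \<Rightarrow> (nat \<Rightarrow> real) list \<Rightarrow> mpoly" where
  "dprod N x [] = 0"
| "dprod N x (z # zs) = mconst (dot N x z) * lprod N zs + lform N z * dprod N x zs"

lemma lprod_Nil [simp]: "lprod N [] = 1"
  and lprod_Cons [simp]: "lprod N (z # zs) = lform N z * lprod N zs"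
  and lprod_append [simp]: "lprod N (xs @ ys) = lprod N xs * lprod N ys"
  and lprod_replicate [simp]: "lprod N (replicate k z) = lform N z ^ k"
  by (simp_all add: lprod_def prod_list_replicate)

lemma dprod_append: "dprod N x (xs @ ys) = dprod N x xs * lprod N ys + lprod N xs * dprod N x ys"
  by (induction xs) (simp_all add: algebra_simps)

lemma dprod_replicate: "dprod N x (replicate k z) = mconst (real k * dot N x z) * lform N z ^ (k - 1)"
proof (induction k)
  case (Suc k)
  have "lform N z * (mconst (real k * dot N x z) * lform N z ^ (k - 1)) = mconst (real k * dot N x z) * lform N z ^ k"
    by (cases k) (simp_all add: algebra_simps)
  moreover have "real (Suc k) * dot N x z = dot N x z + real k * dot N x z" by (simp add: algebra_simps)
  ultimately show ?case
    by (simp only: replicate_Suc dprod.simps Suc mconst_add lprod_replicate diff_Suc_1 distrib_right)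
qed simp

lemma dprod_nth:
  "dprod N x zs = (\<Sum>j<length zs. mconst (dot N x (zs ! j)) * lprod N (take j zs @ drop (Suc j) zs))"
proof (induction zs)
  case (Cons z zs)
  then show ?case
    by (simp add: sum.lessThan_Suc_shift sum_distrib_left algebra_simps del: sum.lessThan_Suc)
qed simp

lemma polys_lprod: "lprod N zs \<in> polys N"
  by (induction zs) (auto intro: polys_intros)

lemma polys_dprod: "dprod N x zs \<in> polys N"
  by (induction zs) (auto intro: polys_intros polys_lprod)

definition bvec :: "nat \<Rightarrow> nat \<Rightarrow> real" where
  "bvec i = (\<lambda>j. if j = i then 1 else 0)"

lemma dot_bvec [simp]: "i < N \<Longrightarrow> dot N x (bvec i) = x i"
  and dot_bvec' [simp]: "i < N \<Longrightarrow> dot N (bvec i) x = x i"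
  by (simp_all add: dot_def bvec_def if_distrib[where f = "\<lambda>z. _ * z"] if_distrib[where f = "\<lambda>z. z * _"] cong: if_cong)

lemma lform_bvec [simp]: "i < N \<Longrightarrow> lform N (bvec i) = mvar i"
proof -
  assume i: "i < N"
  have "lform N (bvec i) = (\<Sum>j<N. if j = i then mvar i else 0)"
    unfolding lform_def by (intro sum.cong) (auto simp: bvec_def)
  then show ?thesis using i by simp
qed

lemma lform_expand: "lform N z = (\<Sum>l<N. mconst (z l) * lform N (bvec l))"
  unfolding lform_def[of N z] by (intro sum.cong) auto

lemma dot_expand: "dot N x z = (\<Sum>l<N. z l * dot N x (bvec l))"
  unfolding dot_def[of N x z] by (intro sum.cong) auto

lemma mconst_sum: "mconst (\<Sum>i\<in>A. f i) = (\<Sum>i\<in>A. mconst (f i))"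
  by (induction A rule: infinite_finite_induct) (simp_all add: mconst_add)

lemma dprod_expand: "dprod N x (z # zs) = (\<Sum>l<N. mconst (z l) * dprod N x (bvec l # zs))"
proof -
  have "dprod N x (z # zs) = mconst (\<Sum>l<N. z l * dot N x (bvec l)) * lprod N zs
      + (\<Sum>l<N. mconst (z l) * lform N (bvec l)) * dprod N x zs"
    by (simp only: dprod.simps lform_expand[of N z, symmetric] dot_expand[of N x z, symmetric])
  also have "\<dots> = (\<Sum>l<N. mconst (z l) * dprod N x (bvec l # zs))"
    by (simp add: mconst_sum mconst_mult sum_distrib_left sum_distrib_right sum.distrib algebra_simps)
  finally show ?thesis .
qed

lemma sphere_mean_lincomb:
  assumes "\<And>l. l \<in> A \<Longrightarrow> f l \<in> polys (Suc n)"
  shows "sphere_mean n (\<Sum>l\<in>A. mconst (c l) * f l) = (\<Sum>l\<in>A. c l * sphere_mean n (f l))"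
  using assms by (subst sphere_mean_sum) (simp_all only: sphere_mean_cmult polys_mult polys_mconst)

definition mlist :: "nat list \<Rightarrow> (nat \<Rightarrow>\<^sub>0 nat)" where
  "mlist ws = (\<Sum>w\<leftarrow>ws. single w 1)"

lemma mlist_Nil [simp]: "mlist [] = 0"
  and mlist_Cons [simp]: "mlist (w # ws) = single w 1 + mlist ws"
  by (simp_all add: mlist_def)

lemma lprod_bvec:
  assumes "set ws \<subseteq> {..<N}"
  shows "lprod N (map bvec ws) = single (mlist ws) 1"
  using assms by (induction ws) (auto simp: mvar_def mult_single)

lemma mdeg_mlist: "mdeg (mlist ws) = length ws"
  by (induction ws) (auto simp: mdeg_add)

lemma keys_mlist: "keys (mlist ws) = set ws"
  by (induction ws) (auto simp: keys_add_nat)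

text \<open>The truncated subtraction \<open>m - single i 1\<close> does no harm when
  \<open>i\<close> is absent from \<open>m\<close>, because the coefficient is then 0.\<close>

lemma dprod_bvec:
  assumes "set ws \<subseteq> {..<N}" "i < N" and m: "m = mlist ws"
  shows "dprod N (bvec i) (map bvec ws) = single (m - single i 1) (real (lookup m i))"
  using assms(1) unfolding m
proof (induction ws)
  case (Cons w ws)
  let ?s = "mlist ws"
  have w: "w < N" using Cons.prems by simp
  have IH: "dprod N (bvec i) (map bvec ws) = single (?s - single i 1) (real (lookup ?s i))"
    using Cons by simp
  have eq: "dprod N (bvec i) (map bvec (w # ws)) =
     single ?s (bvec w i) + single (single w 1 + (?s - single i 1)) (real (lookup ?s i))"
    using Cons.prems assms(2) w
    by (simp add: IH lprod_bvec mconst_def mult_single mvar_def del: dot_bvec)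
  show ?case
  proof (cases "lookup ?s i = 0")
    case True
    then show ?thesis unfolding eq
      by (cases "w = i") (auto simp: bvec_def lookup_add lookup_single single_add)
  next
    case False
    have 1: "single w 1 + (?s - single i 1) = single w 1 + ?s - single i 1"
    proof (rule poly_mapping_eqI)
      fix j show "lookup (single w 1 + (?s - single i 1)) j = lookup (single w 1 + ?s - single i 1) j"
        using False by (auto simp: lookup_add lookup_minus lookup_single when_def)
    qed
    show ?thesis unfolding eq 1
      by (cases "w = i") (auto simp: bvec_def lookup_add lookup_single single_add[symmetric])
  qed
qed simp

text \<open>Integration by parts on the sphere: under the mean, multiplication by a linear form
  amounts, up to the factor \<open>n + length zs\<close>, to differentiation along its vector. Both
  sides are linear in \<open>x\<close> and in every entry of \<open>zs\<close>, so coordinate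
  vectors suffice, and for these the claim is \<open>sphere_moment_rec\<close>.\<close>

theorem wick:
  assumes n: "n \<ge> 1"
  shows "real (n + length zs) * sphere_mean n (lprod (Suc n) (x # zs)) = sphere_mean n (dprod (Suc n) x zs)"
proof -
  let ?N = "Suc n"
  let ?P = "\<lambda>x zs. real (n + length zs) * sphere_mean n (lform ?N x * lprod ?N zs) = sphere_mean n (dprod ?N x zs)"
  have base: "?P (bvec i) (map bvec ws)" if i: "i < ?N" and ws: "set ws \<subseteq> {..<?N}" for i ws
  proof -
    define m where "m = mlist ws"
    have km: "keys m \<subseteq> {..<?N}" using ws by (simp add: m_def keys_mlist)
    have len: "mdeg m = length ws" by (simp add: m_def mdeg_mlist)
    have lhs: "lform ?N (bvec i) * lprod ?N (map bvec ws) = single (single i 1 + m) 1"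
      using i ws by (simp add: lprod_bvec mvar_def mult_single m_def)
    have km': "keys (single i 1 + m) \<subseteq> {..<?N}"
      using i km by (auto simp: keys_add_nat)
    have km'': "keys (m - single i 1) \<subseteq> {..<?N}"
    proof
      fix j assume "j \<in> keys (m - single i 1)"
      then have "j \<in> keys m" by (auto simp: in_keys_iff lookup_minus)
      then show "j \<in> {..<?N}" using km by auto
    qed
    have rhs: "sphere_mean n (dprod ?N (bvec i) (map bvec ws))
        = real (lookup m i) * sphere_moment ?N (m - single i 1)"
    proof -
      have "dprod ?N (bvec i) (map bvec ws)
          = mconst (real (lookup m i)) * single (m - single i 1) 1"
        by (subst dprod_bvec[OF ws i m_def]) (simp add: mconst_def mult_single del: single_of_nat)
      then show ?thesis by (simp only: sphere_mean_cmult sphere_mean_monomial[OF km''])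
    qed
    show ?thesis
    proof (cases "lookup m i = 0")
      case True
      then have "sphere_moment ?N (single i 1 + m) = 0"
        using i by (intro sphere_moment_odd[of i]) (auto simp: lookup_add)
      then show ?thesis by (simp only: lhs rhs sphere_mean_monomial[OF km'] True)
    next
      case False
      define m' where "m' = m - single i 1"
      have m: "m = m' + single i 1" unfolding m'_def
      proof (rule poly_mapping_eqI)
        fix j show "lookup m j = lookup (m - single i 1 + single i 1) j"
          using False by (auto simp: lookup_add lookup_minus lookup_single when_def)
      qed
      have "single i 1 + m = m' + single i 2"
        unfolding m by (rule poly_mapping_eqI) (simp add: lookup_add lookup_single when_def)
      moreover have "?N + mdeg m' = n + length ws" unfolding len[symmetric] m by (simp add: mdeg_add)
      moreover have "lookup m i = lookup m' i + 1" unfolding m by (simp add: lookup_add)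
      ultimately show ?thesis
        using sphere_moment_rec[OF i km''] sphere_mean_monomial[OF km']
        by (simp only: lhs rhs m'_def[symmetric] length_map)
    qed
  qed
  have poly: "lform ?N x * lprod ?N zs \<in> polys ?N" for x zs
    by (intro polys_intros polys_lprod) auto
  \<comment> \<open>The induction carries along the coordinate vectors collected so far: each step
    expands the head of \<open>zs\<close> in the standard basis and moves it to the back, where the
    order of the factors is immaterial.\<close>
  have step1: "?P (bvec i) (zs @ map bvec ws)" if i: "i < ?N" and "set ws \<subseteq> {..<?N}" for i zs ws
    using that(2)
  proof (induction zs arbitrary: ws)
    case Nil
    then show ?case using base[OF i] by simp
  next
    case (Cons z zs)
    let ?R = "zs @ map bvec ws"
    have IH: "?P (bvec i) (bvec l # ?R)" if "l < ?N" for l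
    proof -
      have "?P (bvec i) (zs @ map bvec (l # ws))" using Cons that by (intro Cons.IH) auto
      moreover have "lprod ?N (zs @ map bvec (l # ws)) = lprod ?N (bvec l # ?R)"
        by (simp add: algebra_simps)
      moreover have "dprod ?N (bvec i) (zs @ map bvec (l # ws)) = dprod ?N (bvec i) (bvec l # ?R)"
        by (simp add: dprod_append algebra_simps del: dot_bvec dot_bvec' lform_bvec)
      ultimately show ?thesis by (simp only: length_append length_map list.size) (simp add: algebra_simps)
    qed
    have "lform ?N (bvec i) * lprod ?N (z # ?R) = (\<Sum>l<?N. mconst (z l) * (lform ?N (bvec i) * lprod ?N (bvec l # ?R)))"
      unfolding lprod_Cons by (subst lform_expand[of ?N z]) (simp add: sum_distrib_left sum_distrib_right algebra_simps)
    then have "real (n + length (z # ?R)) * sphere_mean n (lform ?N (bvec i) * lprod ?N (z # ?R))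
       = (\<Sum>l<?N. z l * (real (n + length (bvec l # ?R)) * sphere_mean n (lform ?N (bvec i) * lprod ?N (bvec l # ?R))))"
      by (simp only: sphere_mean_lincomb[OF poly] sum_distrib_left mult.left_commute list.size)
    also have "\<dots> = (\<Sum>l<?N. z l * sphere_mean n (dprod ?N (bvec i) (bvec l # ?R)))"
      by (intro sum.cong refl) (use IH in auto)
    also have "\<dots> = sphere_mean n (dprod ?N (bvec i) (z # ?R))"
      by (subst (2) dprod_expand) (simp only: sphere_mean_lincomb[OF polys_dprod])
    finally show ?case by simp
  qed
  have dx: "dprod ?N x zs = (\<Sum>l<?N. mconst (x l) * dprod ?N (bvec l) zs)"
  proof (induction zs)
    case (Cons z zs)
    have "dot ?N x z = (\<Sum>l<?N. x l * dot ?N (bvec l) z)"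
      unfolding dot_def[of ?N x z] by (intro sum.cong) auto
    then show ?case
      by (simp add: Cons mconst_sum mconst_mult sum_distrib_left sum_distrib_right sum.distrib algebra_simps del: dot_bvec' sum.lessThan_Suc)
  qed simp
  have "real (n + length zs) * sphere_mean n (lform ?N x * lprod ?N zs)
      = (\<Sum>l<?N. x l * (real (n + length zs) * sphere_mean n (lform ?N (bvec l) * lprod ?N zs)))"
    by (subst lform_expand[of ?N x])
      (simp only: sum_distrib_right mult.assoc sphere_mean_lincomb[OF poly] sum_distrib_left mult.left_commute)
  also have "\<dots> = (\<Sum>l<?N. x l * sphere_mean n (dprod ?N (bvec l) zs))"
    by (intro sum.cong refl) (use step1[where ws = "[]"] in auto)
  also have "\<dots> = sphere_mean n (dprod ?N x zs)"
    by (simp only: dx sphere_mean_lincomb[OF polys_dprod])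
  finally show ?thesis by simp
qed

section \<open>Rotation invariance\<close>

text \<open>The second clause, self-adjointness, makes a linear form composed with \<open>T\<close>
  a linear form again, with vector \<open>T z\<close>. Half-turns and minus the identity satisfy
  both clauses.\<close>

definition symmetric_isometry :: "nat \<Rightarrow> ((nat \<Rightarrow> real) \<Rightarrow> nat \<Rightarrow> real) \<Rightarrow> bool" where
  "symmetric_isometry N T \<longleftrightarrow> (\<forall>x y. dot N (T x) (T y) = dot N x y) \<and> (\<forall>x y. dot N (T x) y = dot N x (T y))"

text \<open>Wick's formula reduces the mean to means of shorter products with scalar products as
  coefficients, and these do not change under \<open>T\<close>.\<close>

lemma sphere_mean_lprod_isometry:
  assumes n: "n \<ge> 1" and T: "\<And>x y. dot (Suc n) (T x) (T y) = dot (Suc n) x y"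
  shows "sphere_mean n (lprod (Suc n) (map T zs)) = sphere_mean n (lprod (Suc n) zs)"
proof (induction zs rule: length_induct)
  case (1 zs)
  show ?case
  proof (cases zs)
    case (Cons z ys)
    have sum: "sphere_mean n (dprod (Suc n) x ws)
      = (\<Sum>j<length ws. dot (Suc n) x (ws ! j) * sphere_mean n (lprod (Suc n) (take j ws @ drop (Suc j) ws)))" for x ws
      unfolding dprod_nth
      by (rule sphere_mean_lincomb[OF polys_lprod])
    have "real (n + length ys) * sphere_mean n (lprod (Suc n) (map T zs))
        = sphere_mean n (dprod (Suc n) (T z) (map T ys))"
      using wick[OF n, of "map T ys" "T z"] by (simp add: Cons)
    also have "\<dots> = (\<Sum>j<length ys. dot (Suc n) z (ys ! j) * sphere_mean n (lprod (Suc n) (map T (take j ys @ drop (Suc j) ys))))"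
      unfolding sum by (intro sum.cong) (auto simp: T take_map drop_map)
    also have "\<dots> = (\<Sum>j<length ys. dot (Suc n) z (ys ! j) * sphere_mean n (lprod (Suc n) (take j ys @ drop (Suc j) ys)))"
    proof (intro sum.cong refl arg_cong2[where f = "(*)"])
      fix j assume "j \<in> {..<length ys}"
      then have "length (take j ys @ drop (Suc j) ys) < length zs" by (auto simp: Cons)
      then show "sphere_mean n (lprod (Suc n) (map T (take j ys @ drop (Suc j) ys)))
          = sphere_mean n (lprod (Suc n) (take j ys @ drop (Suc j) ys))"
        using 1 by blast
    qed
    also have "\<dots> = real (n + length ys) * sphere_mean n (lprod (Suc n) zs)"
      using wick[OF n, of ys z] by (simp only: sum Cons)
    finally show ?thesis using n by simp
  qed simp
qed

lemma monomial_as_list: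
  assumes "keys m \<subseteq> {..<N}"
  obtains ws where "set ws \<subseteq> {..<N}" "length ws = mdeg m" "mlist ws = m"
proof -
  have "\<exists>ws. mlist ws = m"
  proof (induction "mdeg m" arbitrary: m rule: less_induct)
    case less
    show ?case
    proof (cases "m = 0")
      case True
      then show ?thesis by (intro exI[of _ "[]"]) simp
    next
      case False
      then obtain i where i: "lookup m i \<noteq> 0" by (metis lookup_zero poly_mapping_eqI)
      define m' where "m' = m - single i 1"
      have m: "m = single i 1 + m'" unfolding m'_def
      proof (rule poly_mapping_eqI)
        fix j show "lookup m j = lookup (single i 1 + (m - single i 1)) j"
          using i by (auto simp: lookup_add lookup_minus lookup_single when_def)
      qed
      then have "mdeg m' < mdeg m" by (simp add: mdeg_add)
      then obtain ws where "mlist ws = m'" using less by blast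
      then show ?thesis using m by (intro exI[of _ "i # ws"]) simp
    qed
  qed
  then obtain ws where ws: "mlist ws = m" by blast
  show ?thesis
    by (rule that[of ws]) (use assms ws keys_mlist[of ws] mdeg_mlist[of ws] in auto)
qed

lemma peval_lprod: "peval (lprod N zs) y = (\<Prod>z\<leftarrow>zs. dot N z y)"
  by (induction zs) simp_all

lemma polys_le_lprod: "lprod N zs \<in> polys_le N (length zs)"
proof (induction zs)
  case (Cons z zs)
  then show ?case using polys_le_mult[OF polys_le_lform[of N N 1 z] Cons] by simp
qed simp

lemma sphere_mean_expand:
  assumes "p \<in> polys (Suc n)"
  shows "sphere_mean n p = (\<Sum>m\<in>keys p. lookup p m * sphere_mean n (single m 1))"
proof -
  have "p = (\<Sum>m\<in>keys p. mconst (lookup p m) * single m 1)" by (rule mpoly_expand)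
  then have "sphere_mean n p = sphere_mean n (\<Sum>m\<in>keys p. mconst (lookup p m) * single m 1)"
    by simp
  also have "\<dots> = (\<Sum>m\<in>keys p. lookup p m * sphere_mean n (single m 1))"
    using assms by (intro sphere_mean_lincomb) (simp add: polys_def)
  finally show ?thesis .
qed

text \<open>\<open>T\<close> acts on points only, so the composed polynomial has to be built: every
  coordinate form in a monomial is replaced by the form of its image under \<open>T\<close>.\<close>

theorem sphere_mean_isometry:
  assumes n: "n \<ge> 1" and T: "symmetric_isometry (Suc n) T" and p: "p \<in> polys_le (Suc n) d"
  obtains q where "q \<in> polys_le (Suc n) d" "\<And>y. peval q y = peval p (T y)" "sphere_mean n q = sphere_mean n p"
proof -
  let ?N = "Suc n"
  have keys: "m \<in> monoms ?N d" if "m \<in> keys p" for m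
    using p that by (auto simp: polys_le_iff)
  have "\<exists>W. set W \<subseteq> {..<?N} \<and> length W = mdeg m \<and> mlist W = m" if "m \<in> keys p" for m
  proof -
    have "keys m \<subseteq> {..<?N}" using keys[OF that] by (simp add: monoms_def)
    then show ?thesis by (rule monomial_as_list) blast
  qed
  then obtain W where W: "\<And>m. m \<in> keys p \<Longrightarrow> set (W m) \<subseteq> {..<?N} \<and> length (W m) = mdeg m \<and> mlist (W m) = m"
    by metis
  define q where "q = (\<Sum>m\<in>keys p. mconst (lookup p m) * lprod ?N (map T (map bvec (W m))))"
  have lp: "lprod ?N (map bvec (W m)) = single m 1" if "m \<in> keys p" for m
    using lprod_bvec[of "W m" ?N] W[OF that] by argo
  have le: "lprod ?N (map T (map bvec (W m))) \<in> polys_le ?N d" if "m \<in> keys p" for m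
  proof (rule polys_le_mono[OF polys_le_lprod order_refl])
    show "length (map T (map bvec (W m))) \<le> d" using W[OF that] keys[OF that] by (simp add: monoms_def)
  qed
  show ?thesis
  proof (rule that[of q])
    show "q \<in> polys_le ?N d" unfolding q_def by (intro polys_le_sum polys_le_cmult le)
    show "peval q y = peval p (T y)" for y
    proof -
      have "peval (lprod ?N (map T zs)) y = peval (lprod ?N zs) (T y)" for zs
        using T unfolding symmetric_isometry_def peval_lprod by (simp add: comp_def)
      then have "peval q y = (\<Sum>m\<in>keys p. lookup p m * meval m (T y))"
        unfolding q_def by (simp add: lp del: map_map)
      then show ?thesis by (simp add: peval_superset[OF finite_keys subset_refl])
    qed
    have "sphere_mean n q = (\<Sum>m\<in>keys p. lookup p m * sphere_mean n (lprod ?N (map T (map bvec (W m)))))"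
      unfolding q_def by (rule sphere_mean_lincomb[OF polys_lprod])
    also have "\<dots> = (\<Sum>m\<in>keys p. lookup p m * sphere_mean n (single m 1))"
    proof (intro sum.cong refl arg_cong2[where f = "(*)"])
      fix m assume m: "m \<in> keys p"
      have "sphere_mean n (lprod ?N (map T (map bvec (W m)))) = sphere_mean n (lprod ?N (map bvec (W m)))"
        by (rule sphere_mean_lprod_isometry[OF n]) (use T in \<open>unfold symmetric_isometry_def, blast\<close>)
      then show "sphere_mean n (lprod ?N (map T (map bvec (W m)))) = sphere_mean n (single m 1)"
        by (simp only: lp[OF m])
    qed
    also have "\<dots> = sphere_mean n p"
      using polys_le_imp_polys[OF p] by (rule sphere_mean_expand[symmetric])
    finally show "sphere_mean n q = sphere_mean n p" .
  qed
qed

section \<open>Half-turns about an axis and transitivity on the sphere\<close>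

lemma dot_add_right: "dot N x (\<lambda>i. y i + z i) = dot N x y + dot N x z"
  and dot_diff_right: "dot N x (\<lambda>i. y i - z i) = dot N x y - dot N x z"
  and dot_scale_right: "dot N x (\<lambda>i. c * y i) = c * dot N x y"
  and dot_uminus_right: "dot N x (\<lambda>i. - y i) = - dot N x y"
  by (simp_all add: dot_def algebra_simps sum.distrib sum_subtractf sum_distrib_left sum_negf)

lemma dot_add_left: "dot N (\<lambda>i. y i + z i) x = dot N y x + dot N z x"
  and dot_diff_left: "dot N (\<lambda>i. y i - z i) x = dot N y x - dot N z x"
  and dot_scale_left: "dot N (\<lambda>i. c * y i) x = c * dot N y x"
  and dot_uminus_left: "dot N (\<lambda>i. - y i) x = - dot N y x"
  by (simp_all add: dot_def algebra_simps sum.distrib sum_subtractf sum_distrib_left sum_negf)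

lemmas dot_linear = dot_add_right dot_diff_right dot_scale_right dot_uminus_right
  dot_add_left dot_diff_left dot_scale_left dot_uminus_left

text \<open>For a unit vector \<open>X\<close> this is the half-turn that fixes \<open>X\<close> and
  negates its orthogonal complement.\<close>

definition axis_reflection :: "nat \<Rightarrow> (nat \<Rightarrow> real) \<Rightarrow> (nat \<Rightarrow> real) \<Rightarrow> nat \<Rightarrow> real" where
  "axis_reflection N X y = (\<lambda>i. 2 * dot N X y * X i - y i)"

lemma symmetric_isometry_axis_reflection:
  assumes "dot N X X = 1" shows "symmetric_isometry N (axis_reflection N X)"
  unfolding symmetric_isometry_def axis_reflection_def
  by (simp only: dot_linear assms) (simp add: algebra_simps dot_commute[of N _ X])

lemma symmetric_isometry_uminus: "symmetric_isometry N (\<lambda>y i. - y i)"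
  by (simp add: symmetric_isometry_def dot_linear)

lemma dot_self_eq_0: "dot N x x = 0 \<Longrightarrow> i < N \<Longrightarrow> x i = 0"
  unfolding dot_self by (subst (asm) sum_nonneg_eq_0_iff) auto

text \<open>The half-turn about the bisector of \<open>a\<close> and \<open>b\<close> takes one to
  the other. The bisector is missing only for antipodal points, and there minus the identity
  serves.\<close>

lemma symmetric_isometry_transitive:
  assumes a: "dot N a a = 1" and b: "dot N b b = 1"
  obtains T where "symmetric_isometry N T" "\<And>i. i < N \<Longrightarrow> T a i = b i"
proof -
  define s where "s = dot N (\<lambda>i. a i + b i) (\<lambda>i. a i + b i)"
  have s: "s = 2 + 2 * dot N a b" unfolding s_def by (simp add: dot_linear a b dot_commute[of N b a])
  show ?thesis
  proof (cases "s = 0")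
    case True
    then have "a i + b i = 0" if "i < N" for i
      using dot_self_eq_0[of N "\<lambda>i. a i + b i" i] that by (simp add: s_def)
    then have "- a i = b i" if "i < N" for i using that by fastforce
    then show ?thesis using that[OF symmetric_isometry_uminus] by blast
  next
    case False
    have pos: "s > 0" using False dot_nonneg[of N "\<lambda>i. a i + b i"] by (simp add: s_def)
    define X where "X = (\<lambda>i. (1 / sqrt s) * (a i + b i))"
    have X: "dot N X X = 1"
    proof -
      have "dot N X X = (1 / sqrt s) * ((1 / sqrt s) * s)"
        unfolding X_def by (simp only: dot_scale_left dot_scale_right s_def)
      then show ?thesis using pos by simp
    qed
    have Xa: "dot N X a = (1 / sqrt s) * (s / 2)"
    proof -
      have "dot N a a + dot N b a = s / 2" by (simp add: s a dot_commute[of N b a])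
      then show ?thesis unfolding X_def by (simp only: dot_scale_left dot_add_left)
    qed
    have "axis_reflection N X a i = b i" for i
    proof -
      have "axis_reflection N X a i = (1 / sqrt s) * (1 / sqrt s) * s * (a i + b i) - a i"
        unfolding axis_reflection_def Xa by (simp add: X_def)
      also have "(1 / sqrt s) * (1 / sqrt s) * s = 1" using pos by simp
      finally show ?thesis by simp
    qed
    then show ?thesis using that[OF symmetric_isometry_axis_reflection[OF X]] by blast
  qed
qed

text \<open>For equal vectors Wick's formula relates the exponent \<open>m\<close> to
  \<open>m - 2\<close>, and its coefficients involve \<open>X\<close> only through
  \<open>dot X X\<close>.\<close>

lemma sphere_mean_linear_power:
  assumes n: "n \<ge> 1"
  obtains c where "\<And>X. dot (Suc n) X X = 1 \<Longrightarrow> sphere_mean n (lform (Suc n) X ^ m) = c"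
proof -
  have "\<exists>c. \<forall>X. dot (Suc n) X X = 1 \<longrightarrow> sphere_mean n (lform (Suc n) X ^ m) = c"
  proof (induction m rule: less_induct)
    case (less m)
    show ?case
    proof (cases m)
      case (Suc k)
      obtain c where c: "\<And>X. dot (Suc n) X X = 1 \<Longrightarrow> sphere_mean n (lform (Suc n) X ^ (k - 1)) = c"
      proof -
        have "k - 1 < m" using Suc by simp
        then show ?thesis using less that by blast
      qed
      have "sphere_mean n (lform (Suc n) X ^ m) = real k * c / real (n + k)" if X: "dot (Suc n) X X = 1" for X
      proof -
        have "real (n + k) * sphere_mean n (lform (Suc n) X ^ m) = real k * c"
          using wick[OF n, of "replicate k X" X] c[OF X]
          by (simp add: Suc dprod_replicate X sphere_mean_cmult)
        then show ?thesis using n by (simp add: field_simps)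
      qed
      then show ?thesis by blast
    qed (auto intro: exI[of _ 1])
  qed
  then show ?thesis using that by blast
qed

text \<open>Averaging against a power of \<open>dot X y\<close> does not raise the degree, because on the sphere
  the contraction \<open>dot X X\<close> is constant.\<close>

lemma sphere_mean_power_monomial:
  assumes n: "n \<ge> 1" and ws: "set ws \<subseteq> {..<n}"
  obtains p where "p \<in> polys_le n (length ws)"
    "\<And>X. dot (Suc n) X X = 1 \<Longrightarrow> sphere_mean n (lform (Suc n) X ^ k * lprod (Suc n) (map bvec ws)) = peval p X"
proof -
  let ?N = "Suc n"
  have "\<exists>p\<in>polys_le n (length ws). \<forall>X. dot ?N X X = 1 \<longrightarrow> sphere_mean n (lform ?N X ^ k * lprod ?N (map bvec ws)) = peval p X"
    using ws
  proof (induction ws arbitrary: k rule: length_induct)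
    case (1 ws)
    show ?case
    proof (cases ws)
      case Nil
      obtain c where "\<And>X. dot ?N X X = 1 \<Longrightarrow> sphere_mean n (lform ?N X ^ k) = c"
        using sphere_mean_linear_power[OF n] by blast
      then show ?thesis by (intro bexI[of _ "mconst c"]) (auto simp: Nil)
    next
      case (Cons w vs)
      have w: "w < n" and vs: "set vs \<subseteq> {..<n}" using 1 Cons by auto
      let ?del = "\<lambda>j. take j vs @ drop (Suc j) vs"
      obtain p1 where p1: "p1 \<in> polys_le n (length vs)"
        "\<And>X. dot ?N X X = 1 \<Longrightarrow> sphere_mean n (lform ?N X ^ (k - 1) * lprod ?N (map bvec vs)) = peval p1 X"
        using 1 vs Cons by (metis length_Cons lessI)
      have "\<exists>p\<in>polys_le n (length vs). \<forall>X. dot ?N X X = 1 \<longrightarrow> sphere_mean n (lform ?N X ^ k * lprod ?N (map bvec (?del j))) = peval p X"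
        if "j < length vs" for j
      proof -
        have s: "set (?del j) \<subseteq> {..<n}" using vs set_take_subset[of j vs] set_drop_subset[of "Suc j" vs] by auto
        have l: "length (?del j) < length ws" "length (?del j) \<le> length vs" using that Cons by auto
        show ?thesis using 1 s l by (meson polys_le_mono order_refl)
      qed
      then obtain p2 where p2: "\<And>j. j < length vs \<Longrightarrow> p2 j \<in> polys_le n (length vs)"
        "\<And>j X. j < length vs \<Longrightarrow> dot ?N X X = 1 \<Longrightarrow> sphere_mean n (lform ?N X ^ k * lprod ?N (map bvec (?del j))) = peval (p2 j) X"
        by metis
      \<comment> \<open>This is Wick's formula for the coordinate form \<open>w\<close>, solved for
        the mean. A derivative that hits the power of the form of \<open>X\<close> contributes the
        factor \<open>X w\<close>, which is paid for by the factor \<open>w\<close> taken out of the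
        monomial; a derivative that hits the monomial removes a second factor and adds none.\<close>
      let ?c = "real (n + k + length vs)"
      define p where "p = mconst (1 / ?c) * (mconst (real k) * mvar w * p1 +
        (\<Sum>j<length vs. mconst (dot ?N (bvec w) (bvec (vs ! j))) * p2 j))"
      have "p \<in> polys_le n (length ws)"
      proof -
        have "mconst (real k) * mvar w * p1 \<in> polys_le n (Suc (length vs))"
          using polys_le_mult[OF polys_le_cmult[OF polys_le_mvar[OF w, of 1]] p1(1)] by simp
        moreover have "mconst c * p2 j \<in> polys_le n (Suc (length vs))" if "j < length vs" for j c
          using polys_le_cmult[OF p2(1)[OF that]] by (rule polys_le_mono) auto
        ultimately show ?thesis unfolding p_def Cons length_Cons
          by (intro polys_le_cmult[of _ n "Suc (length vs)" "1 / ?c"] polys_le_add polys_le_sum) auto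
      qed
      moreover have "sphere_mean n (lform ?N X ^ k * lprod ?N (map bvec ws)) = peval p X" if X: "dot ?N X X = 1" for X
      proof -
        let ?R = "replicate k X @ map bvec vs"
        have "dprod ?N (bvec w) ?R
            = mconst (real k * X w) * (lform ?N X ^ (k - 1) * lprod ?N (map bvec vs)) +
              (\<Sum>j<length vs. mconst (dot ?N (bvec w) (bvec (vs ! j))) * (lform ?N X ^ k * lprod ?N (map bvec (?del j))))"
          using w by (simp add: dprod_append dprod_replicate dprod_nth[of _ _ "map bvec vs"] sum_distrib_left take_map drop_map
              mult.left_commute mult.assoc del: dot_bvec)
        then have "sphere_mean n (dprod ?N (bvec w) ?R) = real k * X w * peval p1 X +
            (\<Sum>j<length vs. dot ?N (bvec w) (bvec (vs ! j)) * peval (p2 j) X)"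
          using p1(2)[OF X] p2(2)[OF _ X]
          by (simp only:) (subst sphere_mean_add sphere_mean_lincomb, auto simp only: sphere_mean_cmult le_refl intro!: polys_intros polys_lprod sum.cong arg_cong2[where f = "(+)"])+
        then have "?c * sphere_mean n (lprod ?N (bvec w # ?R)) = real k * X w * peval p1 X +
            (\<Sum>j<length vs. dot ?N (bvec w) (bvec (vs ! j)) * peval (p2 j) X)"
          using wick[OF n, of ?R "bvec w"] by (simp only: length_append length_replicate length_map add.assoc)
        moreover have eq: "lprod ?N (bvec w # ?R) = lform ?N X ^ k * lprod ?N (map bvec ws)"
          by (simp only: Cons lprod_Cons lprod_append lprod_replicate list.map mult.left_commute)
        ultimately have "?c * sphere_mean n (lform ?N X ^ k * lprod ?N (map bvec ws)) = real k * X w * peval p1 X +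
            (\<Sum>j<length vs. dot ?N (bvec w) (bvec (vs ! j)) * peval (p2 j) X)" by (simp only: eq)
        moreover have "?c * peval p X = real k * X w * peval p1 X +
            (\<Sum>j<length vs. dot ?N (bvec w) (bvec (vs ! j)) * peval (p2 j) X)"
          using n by (simp add: p_def)
        moreover have "?c \<noteq> 0" using n by simp
        ultimately show ?thesis by (metis mult_left_cancel)
      qed
      ultimately show ?thesis by blast
    qed
  qed
  then show ?thesis using that by blast
qed

definition upoly :: "real poly \<Rightarrow> mpoly \<Rightarrow> mpoly" where
  "upoly q p = (\<Sum>k\<le>degree q. mconst (coeff q k) * p ^ k)"

lemma peval_upoly [simp]: "peval (upoly q p) y = poly q (peval p y)"
  by (simp add: upoly_def poly_altdef)

lemma polys_upoly: "p \<in> polys n \<Longrightarrow> upoly q p \<in> polys n"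
  unfolding upoly_def by (intro polys_intros)

text \<open>Linear extension over the powers in \<open>q\<close> and the monomials of
  \<open>f\<close>. The degree of \<open>q\<close> does not enter the bound, and the last
  coordinate, absent from \<open>f\<close>, stays absent from \<open>p\<close>.\<close>

theorem zonal_average_degree:
  assumes n: "n \<ge> 1" and f: "f \<in> polys_le n d"
  obtains p where "p \<in> polys_le n d"
    "\<And>X. dot (Suc n) X X = 1 \<Longrightarrow> sphere_mean n (upoly q (lform (Suc n) X) * f) = peval p X"
proof -
  let ?N = "Suc n"
  have "\<exists>p\<in>polys_le n d. \<forall>X. dot ?N X X = 1 \<longrightarrow> sphere_mean n (lform ?N X ^ k * single m 1) = peval p X"
    if m: "m \<in> keys f" for k m
  proof -
    have m': "keys m \<subseteq> {..<n}" "mdeg m \<le> d" using f m by (auto simp: polys_le_iff monoms_def)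
    obtain ws where ws: "set ws \<subseteq> {..<n}" "length ws = mdeg m" "mlist ws = m"
      using monomial_as_list[OF m'(1)] .
    have "lprod ?N (map bvec ws) = single m 1"
    proof -
      have "set ws \<subseteq> {..<?N}" using ws(1) by force
      then show ?thesis using lprod_bvec[of ws ?N] ws(3) by argo
    qed
    moreover obtain p where "p \<in> polys_le n (length ws)"
      "\<And>X. dot ?N X X = 1 \<Longrightarrow> sphere_mean n (lform ?N X ^ k * lprod ?N (map bvec ws)) = peval p X"
      using sphere_mean_power_monomial[OF n ws(1)] by blast
    ultimately show ?thesis using ws m'(2) by (intro bexI[of _ p]) (auto elim: polys_le_mono)
  qed
  then have "\<forall>k m. \<exists>p. m \<in> keys f \<longrightarrow> p \<in> polys_le n d \<and> (\<forall>X. dot ?N X X = 1 \<longrightarrow>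
      sphere_mean n (lform ?N X ^ k * single m 1) = peval p X)"
    by blast
  then obtain P where "\<forall>k m. m \<in> keys f \<longrightarrow> P k m \<in> polys_le n d \<and> (\<forall>X. dot ?N X X = 1 \<longrightarrow>
      sphere_mean n (lform ?N X ^ k * single m 1) = peval (P k m) X)"
    by (auto simp only: choice_iff)
  then have P: "\<And>k m. m \<in> keys f \<Longrightarrow> P k m \<in> polys_le n d"
    "\<And>k m X. m \<in> keys f \<Longrightarrow> dot ?N X X = 1 \<Longrightarrow>
       sphere_mean n (lform ?N X ^ k * single m 1) = peval (P k m) X"
    by blast+
  define p where "p = (\<Sum>k\<le>degree q. mconst (coeff q k) * (\<Sum>m\<in>keys f. mconst (lookup f m) * P k m))"
  show ?thesis
  proof (rule that[of p])
    show "p \<in> polys_le n d" unfolding p_def by (intro polys_le_sum polys_le_cmult P)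
    fix X assume X: "dot ?N X X = 1"
    have f': "f = (\<Sum>m\<in>keys f. mconst (lookup f m) * single m 1)" by (rule mpoly_expand)
    have key: "single m 1 \<in> polys ?N" if "m \<in> keys f" for m
      using f that by (intro polys_single) (force simp: polys_le_iff monoms_def)
    have "upoly q (lform ?N X) * f = (\<Sum>k\<le>degree q. mconst (coeff q k) *
        (\<Sum>m\<in>keys f. mconst (lookup f m) * (lform ?N X ^ k * single m 1)))"
      by (subst f') (simp add: upoly_def sum_distrib_left sum_distrib_right mult_ac)
    also have "sphere_mean n \<dots> = (\<Sum>k\<le>degree q. coeff q k * sphere_mean n
        (\<Sum>m\<in>keys f. mconst (lookup f m) * (lform ?N X ^ k * single m 1)))"
      by (rule sphere_mean_lincomb) (intro polys_intros key; simp)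
    also have "\<dots> = (\<Sum>k\<le>degree q. coeff q k * (\<Sum>m\<in>keys f. lookup f m * peval (P k m) X))"
      by (subst sphere_mean_lincomb) (auto simp: P(2)[OF _ X] intro!: polys_mult polys_power polys_lform key sum.cong)
    also have "\<dots> = peval p X" by (simp add: p_def)
    finally show "sphere_mean n (upoly q (lform ?N X) * f) = peval p X" .
  qed
qed

section \<open>Zonal polynomials\<close>

declare lform_bvec [simp del] dot_bvec [simp del] dot_bvec' [simp del]

text \<open>For \<open>n \<ge> 1\<close> this integrates \<open>q\<close> from -1 to 1 against the
  normalised Gegenbauer weight \<open>(1 - t^2) powr (n / 2 - 1)\<close>, the distribution of one
  coordinate on the sphere. The axis \<open>bvec 0\<close> is a mere representative.\<close>

definition zonal :: "nat \<Rightarrow> real poly \<Rightarrow> real" where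
  "zonal n q = sphere_mean n (upoly q (lform (Suc n) (bvec 0)))"

lemma dot_bvec_self: "i < N \<Longrightarrow> dot N (bvec i) (bvec i) = 1"
  by (simp add: dot_bvec) (simp add: bvec_def)

lemma sphere_mean_upoly:
  assumes p: "p \<in> polys (Suc n)"
  shows "sphere_mean n (upoly q p) = (\<Sum>k\<le>degree q. coeff q k * sphere_mean n (p ^ k))"
  unfolding upoly_def by (rule sphere_mean_lincomb) (intro polys_intros p)

lemma sphere_mean_zonal:
  assumes n: "n \<ge> 1" and X: "dot (Suc n) X X = 1"
  shows "sphere_mean n (upoly q (lform (Suc n) X)) = zonal n q"
proof -
  have "sphere_mean n (lform (Suc n) X ^ k) = sphere_mean n (lform (Suc n) (bvec 0) ^ k)" for k
    using sphere_mean_linear_power[OF n, of k] X dot_bvec_self[of 0 "Suc n"] by (metis zero_less_Suc)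
  then show ?thesis unfolding zonal_def
    by (subst (1 2) sphere_mean_upoly) (simp_all add: polys_lform)
qed

lemma polys_zonal: "upoly q (lform (Suc n) X) \<in> polys (Suc n)"
  by (intro polys_upoly polys_lform) simp

lemma sphere_dot_bound:
  assumes "dot N X X = 1" "dot N y y = 1"
  shows "\<bar>dot N X y\<bar> \<le> 1"
proof -
  have "0 \<le> dot N (\<lambda>i. X i - y i) (\<lambda>i. X i - y i)" "0 \<le> dot N (\<lambda>i. X i + y i) (\<lambda>i. X i + y i)"
    by (rule dot_nonneg)+
  then show ?thesis using assms by (simp add: dot_linear dot_commute[of N y X])
qed

lemma zonal_add: "zonal n (p + q) = zonal n p + zonal n q"
  unfolding zonal_def
  by (subst sphere_mean_add[symmetric]) (auto intro!: sphere_mean_cong polys_add polys_zonal)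

lemma zonal_smult: "zonal n (smult c p) = c * zonal n p"
  unfolding zonal_def
  by (subst sphere_mean_cmult[symmetric]) (auto intro!: sphere_mean_cong polys_mult polys_zonal)

lemma zonal_0 [simp]: "zonal n 0 = 0"
  by (simp add: zonal_def upoly_def)

lemma zonal_1: "zonal n 1 = 1"
  by (simp add: zonal_def upoly_def)

lemma zonal_sum: "zonal n (\<Sum>i\<in>A. f i) = (\<Sum>i\<in>A. zonal n (f i))"
  by (induction A rule: infinite_finite_induct) (simp_all add: zonal_add)

lemma zonal_diff: "zonal n (p - q) = zonal n p - zonal n q"
  using zonal_add[of n p "smult (- 1) q"] zonal_smult[of n "- 1" q] by simp

lemma zonal_mono:
  assumes "\<And>t. \<bar>t\<bar> \<le> 1 \<Longrightarrow> poly p t \<le> poly q t"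
  shows "zonal n p \<le> zonal n q"
  unfolding zonal_def
  by (intro sphere_mean_mono polys_zonal) (use assms sphere_dot_bound[OF dot_bvec_self] in auto)

lemma zonal_nonneg: "(\<And>t. \<bar>t\<bar> \<le> 1 \<Longrightarrow> poly p t \<ge> 0) \<Longrightarrow> zonal n p \<ge> 0"
  using zonal_mono[of 0 p n] by simp

text \<open>Passing to the antipodal axis leaves the mean unchanged and reverses the sign of
  \<open>q\<close>.\<close>

lemma zonal_odd:
  assumes n: "n \<ge> 1" and q: "\<And>t. poly q (- t) = - poly q t"
  shows "zonal n q = 0"
proof -
  let ?X = "\<lambda>i. - bvec 0 i"
  have X: "dot (Suc n) ?X ?X = 1" by (simp add: dot_linear dot_bvec_self)
  have "zonal n q = sphere_mean n (upoly q (lform (Suc n) ?X))"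
    by (rule sphere_mean_zonal[OF n X, symmetric])
  also have "\<dots> = zonal n (smult (- 1) q)" unfolding zonal_def
    by (intro sphere_mean_cong polys_zonal) (simp add: dot_linear q)
  finally show ?thesis using zonal_smult[of n "- 1" q] by linarith
qed

lemma zonal_moment_rec:
  assumes n: "n \<ge> 1"
  shows "real (n + k + 1) * zonal n (monom 1 (k + 2)) = real (k + 1) * zonal n (monom 1 k)"
proof -
  let ?l = "lform (Suc n) (bvec 0)"
  have e: "zonal n (monom 1 k) = sphere_mean n (?l ^ k)" for k
    unfolding zonal_def
    by (intro sphere_mean_cong polys_zonal polys_power polys_lform) (simp_all add: poly_monom)
  show ?thesis
    using wick[OF n, of "replicate (k + 1) (bvec 0)" "bvec 0"]
    by (simp only: e lprod_Cons lprod_replicate dprod_replicate sphere_mean_cmult length_replicate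
        dot_bvec_self[OF zero_less_Suc] add_diff_cancel_right' mult_1_right add.assoc)
      (simp add: algebra_simps)
qed

lemma poly_as_monoms: "(q :: real poly) = (\<Sum>k\<le>degree q. smult (coeff q k) (monom 1 k))"
proof -
  have "(\<Sum>k\<le>degree q. smult (coeff q k) (monom 1 k)) = (\<Sum>k\<le>degree q. monom (coeff q k) k)"
    by (intro sum.cong) (simp_all add: smult_monom)
  then show ?thesis using poly_as_sum_of_monoms[of q] by simp
qed

lemma zonal_expand: "zonal n q = (\<Sum>k\<le>degree q. coeff q k * zonal n (monom 1 k))"
  by (subst poly_as_monoms) (simp only: zonal_sum zonal_smult)

definition omt2 :: "real poly" where "omt2 = [:1, 0, -1:]"

lemma poly_omt2 [simp]: "poly omt2 t = 1 - t\<^sup>2"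
  by (simp add: omt2_def power2_eq_square)

text \<open>The Gegenbauer weight for \<open>n + 2\<close> is that for \<open>n\<close> times
  \<open>1 - t^2\<close>, and \<open>n / (n + 1)\<close> is the mean of \<open>1 - t^2\<close>. On
  moments this is a comparison of two recursions.\<close>

lemma zonal_omt2_monom:
  assumes n: "n \<ge> 1"
  shows "zonal n (omt2 * monom 1 k) = real n / real (n + 1) * zonal (n + 2) (monom 1 k)"
proof -
  have rec: "zonal n (monom 1 (k + 2)) = real (k + 1) / real (n + k + 1) * zonal n (monom 1 k)" if "n \<ge> 1" for k n
    using zonal_moment_rec[OF that, of k] by (simp add: field_simps)
  have A: "zonal (n + 2) (monom 1 k) = real (n + 1) / real (n + k + 1) * zonal n (monom 1 k)"
  proof (induction k rule: less_induct)
    case (less k)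
    consider "k = 0" | "k = 1" | j where "k = j + 2"
      by (metis One_nat_def add_2_eq_Suc' not0_implies_Suc)
    then show ?case
    proof cases
      case 1
      then show ?thesis using zonal_1 by (simp add: monom_0 pCons_one)
    next
      case 2
      then show ?thesis using zonal_odd[of n "monom 1 1"] zonal_odd[of "n + 2" "monom 1 1"] n
        by (simp add: poly_monom)
    next
      case 3
      have 1: "zonal (n + 2) (monom 1 j) = real (n + 1) / real (n + j + 1) * zonal n (monom 1 j)"
        using less 3 by simp
      have "real (j + 1) / real (n + 2 + j + 1) * (real (n + 1) / real (n + j + 1) * z)
        = real (n + 1) / real (n + (j + 2) + 1) * (real (j + 1) / real (n + j + 1) * z)" for z
        by simp
      then show ?thesis using rec[of n j] rec[of "n + 2" j] n unfolding 3 1 by simp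
    qed
  qed
  have "omt2 * monom 1 k = monom 1 k - monom 1 (k + 2)"
    by (subst poly_eq_poly_eq_iff[symmetric])
      (simp add: fun_eq_iff poly_monom power_add algebra_simps power2_eq_square)
  then have "zonal n (omt2 * monom 1 k) = zonal n (monom 1 k) - real (k + 1) / real (n + k + 1) * zonal n (monom 1 k)"
    using rec[OF n] by (simp add: zonal_diff)
  also have "\<dots> = real n / real (n + k + 1) * zonal n (monom 1 k)"
    using n by (simp add: field_simps)
  finally show ?thesis unfolding A by simp
qed

lemma zonal_omt2:
  assumes n: "n \<ge> 1"
  shows "zonal n (omt2 * q) = real n / real (n + 1) * zonal (n + 2) q"
proof -
  have "zonal n (omt2 * q) = zonal n (\<Sum>k\<le>degree q. smult (coeff q k) (omt2 * monom 1 k))"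
    by (subst poly_as_monoms[of q]) (simp add: sum_distrib_left)
  also have "\<dots> = real n / real (n + 1) * zonal (n + 2) q"
    by (simp only: zonal_sum zonal_smult zonal_omt2_monom[OF n] zonal_expand[of "n + 2" q] sum_distrib_left mult.left_commute)
  finally show ?thesis .
qed

text \<open>This carries a sign from the circle, where quadrature is available, to every odd
  dimension.\<close>

lemma zonal_odd_dim_nonneg:
  assumes "zonal 1 (omt2 ^ i * q) \<ge> 0"
  shows "zonal (2 * i + 1) q \<ge> 0"
  using assms
proof (induction i arbitrary: q)
  case (Suc i)
  have "zonal 1 (omt2 ^ i * (omt2 * q)) \<ge> 0" using Suc.prems by (simp add: mult_ac)
  then have "zonal (2 * i + 1) (omt2 * q) \<ge> 0" by (rule Suc.IH)
  then have "real (2 * i + 1) / real (2 * i + 1 + 1) * zonal (2 * i + 1 + 2) q \<ge> 0"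
    by (subst zonal_omt2[symmetric]) auto
  then show ?case by (simp add: zero_le_mult_iff zero_le_divide_iff)
qed simp

lemma AE_coordinate_neq:
  assumes "i < n"
  shows "AE x in ball_measure n. x i \<noteq> a"
proof -
  let ?A = "\<lambda>j. if j = i then {a} else UNIV :: real set"
  have "emeasure (lebn n) (Pi\<^sub>E {..<n} ?A) = (\<Prod>j<n. emeasure lborel (?A j))"
    by (rule lebesgue_product.emeasure_PiM) auto
  also have "\<dots> = 0" using assms by (intro prod_zero) auto
  finally have "Pi\<^sub>E {..<n} ?A \<in> null_sets (lebn n)"
    by (auto simp: null_sets_def intro!: sets_PiM_I_finite)
  then have "AE x in lebn n. x \<notin> Pi\<^sub>E {..<n} ?A" by (rule AE_not_in)
  then have "AE x in lebn n. x i \<noteq> a"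
    using AE_space by eventually_elim (auto simp: space_PiM PiE_iff split: if_splits)
  then show ?thesis unfolding ball_measure_def
    by (subst AE_density, measurable) (auto elim: eventually_mono)
qed

text \<open>A coordinate of the ball has no atoms, so the finitely many roots of a nonzero
  \<open>q\<close> are avoided almost everywhere.\<close>

lemma zonal_definite:
  assumes n: "n \<ge> 1" and q: "\<And>t. \<bar>t\<bar> \<le> 1 \<Longrightarrow> poly q t \<ge> 0" and z: "zonal n q = 0"
  shows "q = 0"
proof (rule ccontr)
  assume q0: "q \<noteq> 0"
  let ?p = "upoly q (lform (Suc n) (bvec 0))"
  let ?f = "\<lambda>x. (peval ?p (up n x) + peval ?p (dn n x)) / 2"
  have f: "?f x = poly q (x 0)" for x using n by (simp add: up_def dn_def dot_bvec')
  have "integrable (ball_measure n) ?f"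
    by (intro integrable_divide_zero Bochner_Integration.integrable_add integrable_peval_ball polys_zonal) auto
  then have int: "integrable (ball_measure n) (\<lambda>x. poly q (x 0))" unfolding f .
  have nn: "AE x in ball_measure n. 0 \<le> poly q (x 0)"
    using AE_ball_measure
  proof eventually_elim
    case (elim x)
    then show ?case using n by (intro q dot_le_one_coord) (auto simp: unit_ball_iff)
  qed
  have "(LINT x|ball_measure n. poly q (x 0)) = 0"
    using z unfolding zonal_def sphere_mean_def f .
  then have "AE x in ball_measure n. poly q (x 0) = 0"
    using integral_nonneg_eq_0_iff_AE[OF int nn] by simp
  moreover have "AE x in ball_measure n. \<forall>a\<in>{a. poly q a = 0}. x 0 \<noteq> a"
    using poly_roots_finite[OF q0] n by (intro AE_finite_allI AE_coordinate_neq) auto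
  ultimately have "AE x in ball_measure n. False" by eventually_elim auto
  then show False using not_AE_False_ball by blast
qed

section \<open>Quadrature on the circle\<close>

lemma sum_roots_of_unity:
  fixes m :: int and M :: nat
  assumes M: "M > 0" and m: "m \<noteq> 0" "\<bar>m\<bar> < 2 * int M"
  shows "(\<Sum>l<2 * M. cis (of_int m * (phi + real l * pi / real M))) = 0"
proof -
  define z where "z = cis (of_int m * pi / real M)"
  have z1: "z \<noteq> 1"
  proof
    assume "z = 1"
    then have "cos (of_int m * pi / real M) = 1" unfolding z_def by (metis cis.sel(1) one_complex.sel(1))
    then obtain j :: int where "of_int m * pi / real M = of_int j * 2 * pi" using cos_one_2pi_int by blast
    then have "of_int m * pi = of_int (2 * j * int M) * pi" using M by (simp add: field_simps)
    then have eq: "m = 2 * j * int M" by (metis mult_right_cancel of_int_eq_iff pi_neq_zero)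
    show False
    proof (cases "j = 0")
      case False
      then have "\<bar>m\<bar> \<ge> 2 * int M" unfolding eq abs_mult using M by simp
      then show False using m by simp
    qed (use m eq in simp)
  qed
  have "real (2 * M) * (of_int m * pi / real M) = of_int m * (2 * pi)" using M by simp
  then have "z ^ (2 * M) = cis (of_int m * (2 * pi))" by (simp only: z_def Complex.DeMoivre)
  also have "\<dots> = 1"
    using cis_multiple_2pi[of "of_int m"] by (simp add: mult_ac)
  finally have zM: "z ^ (2 * M) = 1" .
  have "cis (of_int m * (phi + real l * pi / real M)) = cis (of_int m * phi) * z ^ l" for l
    unfolding z_def Complex.DeMoivre cis_mult by (simp add: field_simps)
  then have "(\<Sum>l<2 * M. cis (of_int m * (phi + real l * pi / real M))) = cis (of_int m * phi) * (\<Sum>l<2 * M. z ^ l)"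
    by (simp add: sum_distrib_left)
  also have "(\<Sum>l<2 * M. z ^ l) = 0" using z1 zM by (simp add: geometric_sum)
  finally show ?thesis by simp
qed

lemma sum_cos_multiple:
  fixes m :: int
  assumes "M > 0" "m \<noteq> 0" "\<bar>m\<bar> < 2 * int M"
  shows "(\<Sum>l<2 * M. cos (of_int m * (phi + real l * pi / real M))) = 0"
  using arg_cong[OF sum_roots_of_unity[OF assms, of phi], of Re] by simp

text \<open>In the binomial expansion of \<open>((cis t + cis (- t)) / 2) ^ k\<close> all
  frequencies stay below \<open>2 * M\<close>, so only the constant term survives the sum over the
  nodes; for odd \<open>k\<close> there is none.\<close>

lemma sum_cos_power:
  assumes M: "M > 0" and k: "k < 2 * M"
  shows "(\<Sum>l<2 * M. cos (phi + real l * pi / real M) ^ k)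
    = (if even k then 2 * real M * (real (k choose (k div 2)) / 2 ^ k) else 0)"
proof -
  define \<theta> where "\<theta> l = phi + real l * pi / real M" for l
  have cp: "complex_of_real (cos t ^ k) = (\<Sum>j\<le>k. of_nat (k choose j) / 2 ^ k * cis (of_int (2 * int j - int k) * t))" for t
  proof -
    have "complex_of_real (cos t) = (cis t + cis (- t)) / 2"
      by (simp add: complex_eq_iff)
    then have "complex_of_real (cos t ^ k) = (cis t + cis (- t)) ^ k / 2 ^ k"
      by (simp only: of_real_power power_divide)
    also have "\<dots> = (\<Sum>j\<le>k. of_nat (k choose j) * cis t ^ j * cis (- t) ^ (k - j)) / 2 ^ k"
      by (simp add: binomial_ring)
    also have "\<dots> = (\<Sum>j\<le>k. of_nat (k choose j) / 2 ^ k * cis (of_int (2 * int j - int k) * t))"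
      unfolding sum_divide_distrib
    proof (intro sum.cong refl)
      fix j assume "j \<in> {..k}"
      then have "cis t ^ j * cis (- t) ^ (k - j) = cis (of_int (2 * int j - int k) * t)"
        by (simp add: Complex.DeMoivre cis_mult of_nat_diff algebra_simps)
      then show "of_nat (k choose j) * cis t ^ j * cis (- t) ^ (k - j) / 2 ^ k
          = of_nat (k choose j) / 2 ^ k * cis (of_int (2 * int j - int k) * t)"
        by (simp add: mult.assoc)
    qed
    finally show ?thesis .
  qed
  have "complex_of_real (\<Sum>l<2 * M. cos (\<theta> l) ^ k)
      = (\<Sum>l<2 * M. \<Sum>j\<le>k. of_nat (k choose j) / 2 ^ k * cis (of_int (2 * int j - int k) * \<theta> l))"
    by (simp only: of_real_sum cp)
  also have "\<dots> = (\<Sum>j\<le>k. of_nat (k choose j) / 2 ^ k * (\<Sum>l<2 * M. cis (of_int (2 * int j - int k) * \<theta> l)))"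
    by (subst sum.swap) (simp only: sum_distrib_left)
  also have "\<dots> = (\<Sum>j\<le>k. if 2 * j = k then of_nat (k choose j) / 2 ^ k * of_nat (2 * M) else 0)"
  proof (intro sum.cong refl)
    fix j assume "j \<in> {..k}"
    show "of_nat (k choose j) / 2 ^ k * (\<Sum>l<2 * M. cis (of_int (2 * int j - int k) * \<theta> l))
      = (if 2 * j = k then of_nat (k choose j) / 2 ^ k * of_nat (2 * M) else 0)"
    proof (cases "2 * j = k")
      case True
      then have z: "of_int (2 * int j - int k) = (0 :: real)" by simp
      show ?thesis unfolding z using True by simp
    next
      case False
      have "(\<Sum>l<2 * M. cis (of_int (2 * int j - int k) * \<theta> l)) = 0"
        unfolding \<theta>_def using False \<open>j \<in> {..k}\<close> k by (intro sum_roots_of_unity[OF M]) auto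
      then show ?thesis using False by simp
    qed
  qed
  also have "\<dots> = complex_of_real (if even k then 2 * real M * (real (k choose (k div 2)) / 2 ^ k) else 0)"
  proof (cases "even k")
    case True
    then have "(\<Sum>j\<le>k. if 2 * j = k then of_nat (k choose j) / 2 ^ k * of_nat (2 * M) else 0)
       = (\<Sum>j\<in>{k div 2}. of_nat (k choose j) / 2 ^ k * (of_nat (2 * M) :: complex))"
      by (intro sum.mono_neutral_cong_right) auto
    then show ?thesis using True by simp
  qed (auto intro!: sum.neutral)
  finally show ?thesis unfolding \<theta>_def of_real_eq_iff .
qed

text \<open>For \<open>n = 1\<close> the moment recursion is that of the central binomial
  coefficients divided by powers of 4.\<close>

lemma zonal_circle_moment:
  "zonal 1 (monom 1 k) = (if even k then real (k choose (k div 2)) / 2 ^ k else 0)"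
proof (induction k rule: less_induct)
  case (less k)
  show ?case
  proof (cases "odd k")
    case True
    then show ?thesis using zonal_odd[of 1 "monom 1 k"] by (simp add: poly_monom)
  next
    case False
    show ?thesis
    proof (cases "k = 0")
      case True
      then show ?thesis using zonal_1 by (simp add: monom_0 pCons_one)
    next
      case k0: False
      then obtain j where k: "k = 2 * j + 2" using False by (auto elim!: evenE) (metis Suc_pred add_2_eq_Suc' mult_2 mult_Suc_right add.commute)
      have "real (2 * j + 2) * zonal 1 (monom 1 (2 * j + 2)) = real (2 * j + 1) * zonal 1 (monom 1 (2 * j))"
        using zonal_moment_rec[of 1 "2 * j"] by simp
      also have "zonal 1 (monom 1 (2 * j)) = real (2 * j choose j) / 2 ^ (2 * j)"
        using less[of "2 * j"] k by simp
      finally have 1: "zonal 1 (monom 1 (2 * j + 2)) = real (2 * j + 1) / real (2 * j + 2) * (real (2 * j choose j) / 2 ^ (2 * j))"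
        by (subst times_divide_eq_left, subst eq_divide_eq) (simp only: mult.commute, simp)
      have "real (2 * j + 2 choose (j + 1)) * (real (j + 1) * real (j + 1)) = real (2 * j + 2) * real (2 * j + 1) * real (2 * j choose j)"
      proof -
        have "(j + 1) * (2 * j + 2 choose (j + 1)) = (2 * j + 2) * (2 * j + 1 choose j)"
          using Suc_times_binomial_eq[of "2 * j + 1" j] by (simp add: algebra_simps)
        moreover have "(j + 1) * (2 * j + 1 choose j) = (2 * j + 1) * (2 * j choose j)"
        proof -
          have "(2 * j + 1 choose j) = (2 * j + 1 choose (j + 1))"
            by (subst binomial_symmetric) auto
          then show ?thesis using Suc_times_binomial_eq[of "2 * j" j] by (simp add: algebra_simps)
        qed
        ultimately have "(j + 1) * ((j + 1) * (2 * j + 2 choose (j + 1))) = (2 * j + 2) * ((2 * j + 1) * (2 * j choose j))"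
          by (metis mult.left_commute)
        then have "real ((j + 1) * ((j + 1) * (2 * j + 2 choose (j + 1)))) = real ((2 * j + 2) * ((2 * j + 1) * (2 * j choose j)))"
          by (rule arg_cong)
        then show ?thesis unfolding of_nat_mult by (simp only: mult_ac)
      qed
      then have H: "real (2 * j + 2 choose (j + 1)) = real (2 * j + 2) * real (2 * j + 1) * real (2 * j choose j) / (real (j + 1) * real (j + 1))"
        by (intro iffD2[OF nonzero_eq_divide_eq]) simp_all
      have cancel: "y * z * b / (x * x) / (P * 4) = z / y * (b / P)" if "x > 0" "P > 0" "y = x * 2" for x y z b P :: real
        using that by (auto simp: field_simps)
      have P4: "2 ^ (2 * j + 2) = 2 ^ (2 * j) * (4 :: real)" by (simp add: power_add)
      have "real (2 * j + 2 choose (j + 1)) / 2 ^ (2 * j + 2) = real (2 * j + 1) / real (2 * j + 2) * (real (2 * j choose j) / 2 ^ (2 * j))"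
        unfolding H P4 by (rule cancel) auto
      then show ?thesis using 1 by (simp add: k)
    qed
  qed
qed

text \<open>Both sides agree on powers, by the two preceding computations. The offset
  \<open>phi\<close> is arbitrary; \<open>odd_dim_extremal\<close> uses this freedom to place a node
  exactly at \<open>c\<close>.\<close>

theorem circle_quadrature:
  assumes M: "M > 0" and q: "degree q < 2 * M"
  shows "(\<Sum>l<2 * M. poly q (cos (phi + real l * pi / real M))) = 2 * real M * zonal 1 q"
proof -
  have "(\<Sum>l<2 * M. poly q (cos (phi + real l * pi / real M)))
      = (\<Sum>k\<le>degree q. coeff q k * (\<Sum>l<2 * M. cos (phi + real l * pi / real M) ^ k))"
    unfolding poly_altdef by (subst sum.swap) (simp add: sum_distrib_left)
  also have "\<dots> = (\<Sum>k\<le>degree q. coeff q k * (2 * real M * zonal 1 (monom 1 k)))"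
    using q by (intro sum.cong refl arg_cong2[where f = "(*)"])
      (simp add: sum_cos_power[OF M] zonal_circle_moment del: One_nat_def)
  also have "\<dots> = 2 * real M * zonal 1 q"
    by (simp only: zonal_expand[of 1 q] sum_distrib_left mult.left_commute)
  finally show ?thesis .
qed

text \<open>The nodes with \<open>\<bar>t\<bar> < c\<close> are exactly the roots of \<open>v\<close>.\<close>

lemma odd_dim_extremal:
  fixes r g i :: nat
  assumes r: "r \<ge> 1" and g: "g = i + 1"
  defines "c \<equiv> cos (real g * pi / (2 * real (r + g)))"
  obtains v :: "real poly" where "degree v = r - 1" "v \<noteq> 0" "\<And>t. (poly v (- t))\<^sup>2 = (poly v t)\<^sup>2"
    "zonal (2 * i + 1) (v\<^sup>2 * [:- (c\<^sup>2), 0, 1:]) \<ge> 0"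
proof -
  \<comment> \<open>The test polynomial \<open>?P\<close> has degree 2 r + 2 i = 2 M - 2, which
    \<open>2 * M\<close> nodes still integrate exactly. The offset \<open>phi\<close> equals
    \<open>g\<close> half node distances, which makes the nodes symmetric:
    \<open>\<theta> (r - l)\<close> is \<open>pi - \<theta> l\<close>.\<close>
  define M where "M = r + g"
  define phi where "phi = real g * pi / (2 * real M)"
  define \<theta> where "\<theta> l = phi + real l * pi / real M" for l
  have M: "M > 0" using r by (simp add: M_def)
  have c: "c = cos phi" by (simp add: c_def phi_def M_def)
  have phi: "0 \<le> phi" "phi \<le> pi / 2"
    using M by (auto simp: phi_def M_def field_simps)
  define v where "v = (\<Prod>l=1..r - 1. [:- cos (\<theta> l), 1:])"
  have refl: "\<theta> (r - l) = pi - \<theta> l" if "l \<le> r" for l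
  proof -
    have "\<theta> (r - l) + \<theta> l = (real g + real r) * pi / real M"
      using that by (simp add: \<theta>_def phi_def of_nat_diff add_divide_distrib[symmetric] algebra_simps)
    also have "real g + real r = real M" by (simp add: M_def)
    also have "real M * pi / real M = pi" using M by simp
    finally show ?thesis by simp
  qed
  have pv: "poly v t = (\<Prod>l=1..r - 1. t - cos (\<theta> l))" for t
    by (simp add: v_def poly_prod)
  have even: "(poly v (- t))\<^sup>2 = (poly v t)\<^sup>2" for t
  proof -
    have "poly v (- t) = (\<Prod>l=1..r - 1. - t - cos (\<theta> (r - l)))"
      unfolding pv by (rule prod.reindex_bij_witness[of _ "\<lambda>l. r - l" "\<lambda>l. r - l"]) auto
    also have "\<dots> = (\<Prod>l=1..r - 1. (- 1) * (t - cos (\<theta> l)))"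
    proof (intro prod.cong HOL.refl)
      fix l assume "l \<in> {1..r - 1}"
      then have "\<theta> (r - l) = pi - \<theta> l" by (intro refl) auto
      then show "- t - cos (\<theta> (r - l)) = - 1 * (t - cos (\<theta> l))" by simp
    qed
    also have "\<dots> = (\<Prod>l=1..r - 1. (- 1)) * poly v t" unfolding pv prod.distrib ..
    finally show ?thesis by (simp add: power_mult_distrib power_mult[symmetric] mult.commute[of _ 2])
  qed
  let ?P = "omt2 ^ i * (v\<^sup>2 * [:- (c\<^sup>2), 0, 1:])"
  have nz: "v \<noteq> 0" by (auto simp: v_def)
  have deg: "degree v = r - 1"
    unfolding v_def by (subst degree_prod_eq_sum_degree) auto
  have omt: "omt2 \<noteq> 0" "degree omt2 = 2" by (auto simp: omt2_def)
  have "degree (omt2 ^ i * (v\<^sup>2 * w)) = 2 * r + 2 * i" if "w \<noteq> 0" "degree w = 2" for w :: "real poly"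
    using nz omt r that by (simp add: degree_mult_eq degree_power_eq deg)
  from this[of "[:- (c\<^sup>2), 0, 1:]"] have "degree ?P = 2 * r + 2 * i" by simp
  then have dP: "degree ?P < 2 * M" by (simp add: M_def g)
  have node: "poly ?P (cos (\<theta> l)) \<ge> 0" if l: "l < M" for l
  proof -
    have sgn: "poly ?P t = (1 - t\<^sup>2) ^ i * ((poly v t)\<^sup>2 * (t\<^sup>2 - c\<^sup>2))" for t
      by (simp add: poly_power power2_eq_square algebra_simps)
    have s: "1 - (cos x)\<^sup>2 \<ge> 0" for x :: real using sin_squared_eq[of x] by (metis zero_le_power2)
    \<comment> \<open>At l = 0 the factor \<open>t^2 - c^2\<close> vanishes and for \<open>l\<close>
      between 1 and \<open>r - 1\<close> the factor \<open>v\<close> does; the remaining angles lie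
      within \<open>phi\<close> of \<open>pi\<close>, where \<open>t^2\<close> is at least
      \<open>c^2\<close>.\<close>
    consider "l = 0" | "l \<in> {1..r - 1}" | "r \<le> l" using r by force
    then show ?thesis
    proof cases
      case 1
      then show ?thesis unfolding sgn by (simp add: \<theta>_def c)
    next
      case 2
      then have "poly v (cos (\<theta> l)) = 0" unfolding pv by (auto intro: prod_zero)
      then show ?thesis unfolding sgn by simp
    next
      case 3
      have "\<theta> r = pi - phi" using refl[of 0] r by (simp add: \<theta>_def)
      have "\<theta> l - pi = (real l - real r) * pi / real M - phi"
        using \<open>\<theta> r = pi - phi\<close> by (simp add: \<theta>_def diff_divide_distrib left_diff_distrib)
      moreover have "0 \<le> (real l - real r) * pi / real M" using 3 by simp
      moreover have "(real l - real r) * pi / real M \<le> real g * pi / real M"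
        using l 3 by (intro divide_right_mono mult_right_mono) (auto simp: M_def)
      moreover have "real g * pi / real M = 2 * phi" by (simp add: phi_def)
      ultimately have "\<bar>\<theta> l - pi\<bar> \<le> phi" by linarith
      then have "cos phi \<le> cos \<bar>\<theta> l - pi\<bar>" using phi by (intro cos_monotone_0_pi_le) auto
      then have "c \<le> - cos (\<theta> l)" by (simp add: c cos_diff)
      moreover have "c \<ge> 0" unfolding c using phi by (intro cos_ge_zero) auto
      ultimately have "c\<^sup>2 \<le> (- cos (\<theta> l))\<^sup>2" by (intro power_mono)
      then show ?thesis unfolding sgn by (intro mult_nonneg_nonneg zero_le_power[OF s] zero_le_power2) auto
    qed
  qed
  have "(\<Sum>l<2 * M. poly ?P (cos (\<theta> l))) \<ge> 0"
  proof (intro sum_nonneg)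
    fix l assume l: "l \<in> {..<2 * M}"
    show "poly ?P (cos (\<theta> l)) \<ge> 0"
    proof (cases "l < M")
      case False
      \<comment> \<open>The second half of the nodes consists of the antipodes of the first half,
        and \<open>?P\<close> is even.\<close>
      have "\<theta> l = \<theta> (l - M) + pi"
        using False M by (simp add: \<theta>_def of_nat_diff field_simps)
      then have "cos (\<theta> l) = - cos (\<theta> (l - M))" by simp
      moreover have "poly ?P (- t) = poly ?P t" for t by (simp add: poly_power even)
      moreover have "poly ?P (cos (\<theta> (l - M))) \<ge> 0" using False l by (intro node) auto
      ultimately show ?thesis by metis
    qed (rule node)
  qed
  then have "zonal 1 ?P \<ge> 0"
    using circle_quadrature[OF M dP, of phi] M by (simp add: \<theta>_def zero_le_mult_iff)
  then have "zonal (2 * i + 1) (v\<^sup>2 * [:- (c\<^sup>2), 0, 1:]) \<ge> 0" by (rule zonal_odd_dim_nonneg)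
  then show ?thesis using that deg nz even by blast
qed

section \<open>The extremal kernel\<close>

lemma zonal_omt2_power:
  assumes "n \<ge> 1"
  shows "zonal n (omt2 ^ Suc j) = real (n + 2 * j) / real (n + 2 * j + 1) * zonal n (omt2 ^ j)"
  using assms
proof (induction j arbitrary: n)
  case 0
  then show ?case using zonal_omt2[of n 1] by (simp add: zonal_1)
next
  case (Suc j)
  have "zonal n (omt2 ^ Suc (Suc j)) = real n / real (n + 1) * zonal (n + 2) (omt2 ^ Suc j)"
    using zonal_omt2[OF Suc.prems, of "omt2 ^ Suc j"] by simp
  also have "zonal (n + 2) (omt2 ^ Suc j) = real (n + 2 * Suc j) / real (n + 2 * Suc j + 1) * zonal (n + 2) (omt2 ^ j)"
    using Suc.IH[of "n + 2"] by (simp add: algebra_simps)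
  also have "real n / real (n + 1) * (real (n + 2 * Suc j) / real (n + 2 * Suc j + 1) * zonal (n + 2) (omt2 ^ j))
    = real (n + 2 * Suc j) / real (n + 2 * Suc j + 1) * (real n / real (n + 1) * zonal (n + 2) (omt2 ^ j))"
    by (rule mult.left_commute)
  also have "real n / real (n + 1) * zonal (n + 2) (omt2 ^ j) = zonal n (omt2 ^ Suc j)"
    using zonal_omt2[OF Suc.prems, of "omt2 ^ j"] by simp
  finally show ?case .
qed

text \<open>Splitting a coordinate \<open>t\<close> off the sphere leaves a sphere of radius
  \<open>sqrt (1 - t^2)\<close>, so an even moment factors. The proof compares the recursions of the
  three factors.\<close>

lemma zonal_even_moment_succ:
  assumes n: "n \<ge> 1"
  shows "zonal (n + 1) (monom 1 (2 * j)) = zonal n (monom 1 (2 * j)) * zonal (n + 1) (omt2 ^ j)"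
proof (induction j)
  case 0
  then show ?case by (simp add: monom_0 pCons_one zonal_1)
next
  case (Suc j)
  have rec: "zonal m (monom 1 (2 * Suc j)) = real (2 * j + 1) / real (m + 2 * j + 1) * zonal m (monom 1 (2 * j))" if "m \<ge> 1" for m
    using zonal_moment_rec[OF that, of "2 * j"] by (simp add: field_simps)
  have cancel: "a / b * (z * e) = a / d * z * (d / b * e)" if "d \<noteq> 0" for a b d z e :: real
    using that by simp
  have "zonal (n + 1) (monom 1 (2 * Suc j)) = real (2 * j + 1) / real (n + 1 + 2 * j + 1) * (zonal n (monom 1 (2 * j)) * zonal (n + 1) (omt2 ^ j))"
    by (simp only: rec[of "n + 1"] Suc)
  also have "\<dots> = real (2 * j + 1) / real (n + 2 * j + 1) * zonal n (monom 1 (2 * j)) *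
      (real (n + 2 * j + 1) / real (n + 1 + 2 * j + 1) * zonal (n + 1) (omt2 ^ j))"
    by (rule cancel) simp
  also have "real (n + 2 * j + 1) / real (n + 1 + 2 * j + 1) * zonal (n + 1) (omt2 ^ j) = zonal (n + 1) (omt2 ^ Suc j)"
    using zonal_omt2_power[of "n + 1" j] by (simp add: algebra_simps)
  finally show ?case by (simp only: rec[OF n])
qed

lemma poly_le_closed_interval:
  fixes p :: "real poly"
  assumes "\<And>t. \<bar>t\<bar> < 1 \<Longrightarrow> poly p t \<le> 0" "\<bar>t\<bar> \<le> 1"
  shows "poly p t \<le> 0"
proof -
  have "closure {- 1<..<1 :: real} = {- 1..1}" by simp
  then show ?thesis
    using continuous_le_on_closure[of "{- 1<..<1}" "poly p" t 0] assms
      continuous_at_imp_continuous_on[of "{- 1..1}" "poly p"]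
    by (auto simp: abs_le_iff abs_less_iff)
qed

text \<open>A coordinate in dimension \<open>n + 1\<close> is a coordinate in dimension \<open>n\<close> shrunk by the random
  factor \<open>sqrt (1 - t\<^sup>2)\<close>.\<close>

lemma zonal_slice:
  assumes n: "n \<ge> 1" and even: "\<And>t. poly h (- t) = poly h t" and h: "zonal (n + 1) h \<ge> 0"
  obtains \<rho> where "0 < \<rho>" "\<rho> \<le> 1" "zonal n (pcompose h [:0, \<rho>:]) \<ge> 0"
proof (rule ccontr)
  assume "\<not> thesis"
  then have neg: "zonal n (pcompose h [:0, \<rho>:]) < 0" if "0 < \<rho>" "\<rho> \<le> 1" for \<rho>
    using that \<open>\<And>\<rho>. _ \<Longrightarrow> _ \<Longrightarrow> _ \<Longrightarrow> thesis\<close> by force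
  have odd: "coeff h k = 0" if "odd k" for k
  proof -
    have "pcompose h [:0, -1:] = h"
      by (subst poly_eq_poly_eq_iff[symmetric]) (simp add: fun_eq_iff poly_pcompose even)
    then have "(-1) ^ k * coeff h k = coeff h k" by (metis coeff_pcompose_linear)
    then show ?thesis using that by simp
  qed
  \<comment> \<open>\<open>W t\<close> is the mean of \<open>h\<close> over the slice at height
    \<open>t\<close>, that is, of \<open>h\<close> with its argument scaled by
    \<open>\<rho> = sqrt (1 - t^2)\<close>. It is a polynomial in \<open>t\<close> because the odd
    coefficients of \<open>h\<close> vanish.\<close>
  define W where "W = (\<Sum>k\<le>degree h. smult (coeff h k * zonal n (monom 1 k)) (omt2 ^ (k div 2)))"
  have "zonal (n + 1) h = zonal (n + 1) W"
    unfolding W_def zonal_sum zonal_smult zonal_expand[of "n + 1" h]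
  proof (intro sum.cong refl)
    fix k
    show "coeff h k * zonal (n + 1) (monom 1 k) = coeff h k * zonal n (monom 1 k) * zonal (n + 1) (omt2 ^ (k div 2))"
      using odd[of k] zonal_even_moment_succ[OF n, of "k div 2"] by (cases "even k") auto
  qed
  with h have zW: "zonal (n + 1) W \<ge> 0" by simp
  have W: "poly W t < 0" if t: "\<bar>t\<bar> < 1" for t
  proof -
    define \<rho> where "\<rho> = sqrt (1 - t\<^sup>2)"
    have t2: "t\<^sup>2 < 1" using t by (simp add: abs_square_less_1)
    then have r: "0 < \<rho>" "\<rho> \<le> 1" "\<rho>\<^sup>2 = 1 - t\<^sup>2" by (auto simp: \<rho>_def)
    have "pcompose h [:0, \<rho>:] = (\<Sum>k\<le>degree h. smult (coeff h k * \<rho> ^ k) (monom 1 k))"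
      by (subst poly_eq_poly_eq_iff[symmetric])
        (auto simp: fun_eq_iff poly_pcompose poly_sum poly_monom poly_altdef[of h] power_mult_distrib mult_ac intro!: sum.cong)
    then have "zonal n (pcompose h [:0, \<rho>:]) = (\<Sum>k\<le>degree h. coeff h k * \<rho> ^ k * zonal n (monom 1 k))"
      by (simp only: zonal_sum zonal_smult)
    also have "\<dots> = poly W t" unfolding W_def poly_sum poly_smult
    proof (intro sum.cong refl)
      fix k
      show "coeff h k * \<rho> ^ k * zonal n (monom 1 k) = coeff h k * zonal n (monom 1 k) * poly (omt2 ^ (k div 2)) t"
      proof (cases "even k")
        case True
        then have "\<rho> ^ k = (\<rho>\<^sup>2) ^ (k div 2)" by (simp add: power_mult[symmetric])
        then show ?thesis by (simp add: r poly_power)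
      qed (use odd[of k] in simp)
    qed
    finally show ?thesis using neg[OF r(1,2)] by simp
  qed
  \<comment> \<open>At the ends of the interval \<open>\<rho>\<close> would be 0, so strict
    negativity reaches them only as \<open>\<le>\<close>. That still gives \<open>W\<close> mean 0,
    and \<open>zonal_definite\<close> makes \<open>W\<close> zero, against
    \<open>W 0 < 0\<close>.\<close>
  have W': "poly W t \<le> 0" if "\<bar>t\<bar> \<le> 1" for t
    by (rule poly_le_closed_interval[OF _ that]) (use W in force)
  have "zonal (n + 1) W = 0"
    using zW zonal_mono[of W 0 "n + 1"] W' by simp
  then have "zonal (n + 1) (- W) = 0" using zonal_smult[of "n + 1" "- 1" W] by simp
  then have "- W = 0" by (intro zonal_definite[of "n + 1"]) (use W' in auto)
  then show False using W[of 0] by simp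
qed

lemma one_minus_cos_le: "1 - cos x \<le> x\<^sup>2 / 2" for x :: real
proof -
  have "(sin (x / 2))\<^sup>2 \<le> (x / 2)\<^sup>2" using abs_sin_x_le_abs_x[of "x / 2"] abs_le_square_iff by blast
  moreover have "cos x = 1 - 2 * (sin (x / 2))\<^sup>2" using cos_double_sin[of "x / 2"] by simp
  ultimately show ?thesis by (simp add: power_divide)
qed

text \<open>A sign condition on \<open>t^2 - c^2\<close> becomes one on \<open>t - c\<close>: with
  \<open>u = (t + c) * w\<close>, the product \<open>u^2 * (t - c)\<close> equals
  \<open>(c + t) * A\<close>, where \<open>A\<close> is even. Its odd part has mean 0, so the mean
  of \<open>t\<close> under the density \<open>u^2\<close> is at least \<open>c\<close>.\<close>

theorem extremal_kernel:
  assumes n: "n \<ge> 1" and r: "r \<ge> 1"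
  obtains u :: "real poly" where "degree u \<le> r" "zonal n (u\<^sup>2) = 1"
    "zonal n (u\<^sup>2 * [:1, -1:]) \<le> (real n)\<^sup>2 * pi\<^sup>2 / (8 * (real r)\<^sup>2)"
proof -
  \<comment> \<open>Whichever of \<open>n\<close> and \<open>n + 1\<close> is odd equals
    \<open>2 * i + 1\<close>. The bound \<open>g \<le> n\<close> then turns the angle in
    \<open>c\<close> into at most \<open>n * pi / (2 * r)\<close>.\<close>
  define i where "i = n div 2"
  define g where "g = i + 1"
  define c where "c = cos (real g * pi / (2 * real (r + g)))"
  have gn: "g \<le> n" using n by (auto simp: g_def i_def)
  have x: "real g * pi / (2 * real (r + g)) < pi / 2" "0 \<le> real g * pi / (2 * real (r + g))"
    using r by (auto simp: field_simps)
  have cpos: "c > 0" unfolding c_def using x by (intro cos_gt_zero_pi) (use x pi_gt_zero in linarith)+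
  obtain v :: "real poly" where v: "degree v = r - 1" "v \<noteq> 0" "\<And>t. (poly v (- t))\<^sup>2 = (poly v t)\<^sup>2"
    "zonal (2 * i + 1) (v\<^sup>2 * [:- (c\<^sup>2), 0, 1:]) \<ge> 0"
    using odd_dim_extremal[OF r g_def] unfolding c_def by blast
  let ?h = "v\<^sup>2 * [:- (c\<^sup>2), 0, 1:]"
  have ph: "poly ?h t = (poly v t)\<^sup>2 * (t\<^sup>2 - c\<^sup>2)" for t
    by (simp add: poly_power power2_eq_square algebra_simps)
  obtain \<rho> where \<rho>: "0 < \<rho>" "\<rho> \<le> 1" "zonal n (pcompose ?h [:0, \<rho>:]) \<ge> 0"
  proof (cases "even n")
    case True
    then have "2 * i + 1 = n + 1" by (simp add: i_def)
    then show ?thesis using zonal_slice[OF n, of ?h] v(3,4) that unfolding ph by (metis power2_minus)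
  next
    case False
    then have "2 * i + 1 = n" by (simp add: i_def)
    moreover have "pcompose ?h [:0, 1:] = ?h" by (rule pcompose_idR)
    ultimately show ?thesis using v(4) by (intro that[of 1]) simp_all
  qed
  define w where "w = pcompose v [:0, \<rho>:]"
  have w0: "w \<noteq> 0" using v(2) \<rho>(1) by (simp add: w_def pcompose_eq_0_iff)
  have pw: "poly w t = poly v (\<rho> * t)" for t by (simp add: w_def poly_pcompose mult.commute)
  have weven: "(poly w (- t))\<^sup>2 = (poly w t)\<^sup>2" for t using v(3)[of "\<rho> * t"] by (simp add: pw)
  define A where "A = w\<^sup>2 * [:- (c\<^sup>2), 0, 1:]"
  have pA: "poly A t = (poly w t)\<^sup>2 * (t\<^sup>2 - c\<^sup>2)" for t
    by (simp add: A_def poly_power power2_eq_square algebra_simps)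
  \<comment> \<open>Undoing the dilation by \<open>\<rho> \<le> 1\<close> in the factor
    \<open>t^2 - c^2\<close> only enlarges it, so the sign survives with the original
    \<open>c\<close>, although \<open>w\<close> remains dilated.\<close>
  have "zonal n A \<ge> zonal n (pcompose ?h [:0, \<rho>:])"
  proof (rule zonal_mono)
    fix t :: real
    have "(\<rho> * t)\<^sup>2 \<le> t\<^sup>2" unfolding power_mult_distrib using \<rho>
      by (simp add: mult_left_le_one_le power_le_one)
    then show "poly (pcompose ?h [:0, \<rho>:]) t \<le> poly A t"
      unfolding poly_pcompose ph pA pw by (simp add: mult.commute mult_left_mono)
  qed
  with \<rho>(3) have A: "zonal n A \<ge> 0" by simp
  define u where "u = [:c, 1:] * w"
  have pu: "poly u t = (t + c) * poly w t" for t by (simp add: u_def algebra_simps)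
  have "u\<^sup>2 * [:- c, 1:] = smult c A + [:0, 1:] * A"
    by (subst poly_eq_poly_eq_iff[symmetric])
      (simp add: fun_eq_iff poly_power pA pu power2_eq_square algebra_simps)
  moreover have "zonal n ([:0, 1:] * A) = 0"
    by (rule zonal_odd[OF n]) (simp add: pA weven)
  ultimately have "zonal n (u\<^sup>2 * [:- c, 1:]) \<ge> 0"
    using A cpos by (simp only: zonal_add zonal_smult) simp
  moreover have "u\<^sup>2 * [:1, -1:] = smult (1 - c) (u\<^sup>2) - u\<^sup>2 * [:- c, 1:]"
    by (subst poly_eq_poly_eq_iff[symmetric])
      (simp add: fun_eq_iff poly_power algebra_simps)
  ultimately have ub: "zonal n (u\<^sup>2 * [:1, -1:]) \<le> (1 - c) * zonal n (u\<^sup>2)"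
    by (simp only: zonal_diff zonal_smult)
  define S where "S = zonal n (u\<^sup>2)"
  have "u \<noteq> 0" unfolding u_def mult_eq_0_iff using w0 by simp
  then have "S \<noteq> 0" using zonal_definite[OF n, of "u\<^sup>2"] by (auto simp: S_def poly_power)
  moreover have "S \<ge> 0" unfolding S_def by (intro zonal_nonneg) (simp add: poly_power)
  ultimately have S: "S > 0" by simp
  have sq: "(smult (1 / sqrt S) u)\<^sup>2 = smult (1 / S) (u\<^sup>2)"
    using S by (simp add: power2_eq_square)
  show ?thesis
  proof (rule that[of "smult (1 / sqrt S) u"])
    have "degree u \<le> 1 + (r - 1)"
      unfolding u_def by (rule order_trans[OF degree_mult_le]) (auto simp: w_def v degree_pcompose)
    then show "degree (smult (1 / sqrt S) u) \<le> r" using r by (auto intro: order_trans[OF degree_smult_le])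
    show "zonal n ((smult (1 / sqrt S) u)\<^sup>2) = 1"
      unfolding sq zonal_smult using S by (simp add: S_def)
    have "1 - c \<le> (real g * pi / (2 * real (r + g)))\<^sup>2 / 2" unfolding c_def by (rule one_minus_cos_le)
    also have "\<dots> \<le> (real n * pi / (2 * real r))\<^sup>2 / 2"
      using gn r by (intro divide_right_mono power_mono frac_le mult_right_mono) auto
    also have "\<dots> = (real n)\<^sup>2 * pi\<^sup>2 / (8 * (real r)\<^sup>2)"
      by (simp add: power_divide power_mult_distrib)
    finally have c: "1 - c \<le> (real n)\<^sup>2 * pi\<^sup>2 / (8 * (real r)\<^sup>2)" .
    have "zonal n ((smult (1 / sqrt S) u)\<^sup>2 * [:1, -1:]) = 1 / S * zonal n (u\<^sup>2 * [:1, -1:])"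
      unfolding sq mult_smult_left zonal_smult ..
    also have "\<dots> \<le> 1 / S * ((1 - c) * S)"
      using ub S by (intro mult_left_mono) (auto simp: S_def)
    also have "\<dots> = 1 - c" using S by simp
    finally show "zonal n ((smult (1 / sqrt S) u)\<^sup>2 * [:1, -1:]) \<le> (real n)\<^sup>2 * pi\<^sup>2 / (8 * (real r)\<^sup>2)"
      using c by simp
  qed
qed

section \<open>Deviation along great circles\<close>

lemma poly_cos_expansion:
  fixes p :: "real poly"
  assumes "degree p \<le> d"
  obtains a where "\<And>\<theta>. poly p (cos \<theta>) = (\<Sum>k\<le>d. a k * cos (real k * \<theta>))"
proof -
  define T :: "nat \<Rightarrow> (real \<Rightarrow> real) \<Rightarrow> bool" where
    "T d f \<longleftrightarrow> (\<exists>a. \<forall>\<theta>. f \<theta> = (\<Sum>k\<le>d. a k * cos (real k * \<theta>)))" for d f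
  have add: "T d (\<lambda>\<theta>. f \<theta> + g \<theta>)" if "T d f" "T d g" for d f g
  proof -
    from that obtain a b where "\<forall>\<theta>. f \<theta> = (\<Sum>k\<le>d. a k * cos (real k * \<theta>))" "\<forall>\<theta>. g \<theta> = (\<Sum>k\<le>d. b k * cos (real k * \<theta>))"
      unfolding T_def by blast
    then show ?thesis unfolding T_def by (intro exI[of _ "\<lambda>k. a k + b k"]) (simp add: sum.distrib distrib_right)
  qed
  have scale: "T d (\<lambda>\<theta>. c * f \<theta>)" if "T d f" for d f c
  proof -
    from that obtain a where "\<forall>\<theta>. f \<theta> = (\<Sum>k\<le>d. a k * cos (real k * \<theta>))" unfolding T_def by blast
    then show ?thesis unfolding T_def by (intro exI[of _ "\<lambda>k. c * a k"]) (simp add: sum_distrib_left mult.assoc)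
  qed
  have basis: "T d (\<lambda>\<theta>. cos (real j * \<theta>))" if "j \<le> d" for d j
    unfolding T_def using that
    by (intro exI[of _ "\<lambda>k. if k = j then 1 else 0"]) (auto simp: if_distrib[where f = "\<lambda>z. z * _"] cong: if_cong)
  have sum: "T d (\<lambda>\<theta>. \<Sum>k\<in>A. f k \<theta>)" if "finite A" "\<And>k. k \<in> A \<Longrightarrow> T d (f k)" for d f and A :: "nat set"
    using that
  proof (induction A)
    case empty
    show ?case using scale[OF basis[of 0 d], of 0] by simp
  qed (simp add: add)
  have step: "T (Suc d) (\<lambda>\<theta>. cos \<theta> * f \<theta>)" if f: "T d f" for d f
  proof -
    from f obtain a where a: "\<forall>\<theta>. f \<theta> = (\<Sum>k\<le>d. a k * cos (real k * \<theta>))" unfolding T_def by blast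
    have summand: "T (Suc d) (\<lambda>\<theta>. a k * (cos \<theta> * cos (real k * \<theta>)))" if "k \<le> d" for k
    proof (intro scale)
      show "T (Suc d) (\<lambda>\<theta>. cos \<theta> * cos (real k * \<theta>))"
      proof (cases k)
        case 0
        then show ?thesis using basis[of 1 "Suc d"] by simp
      next
        case (Suc j)
        have "cos \<theta> * cos (real k * \<theta>) = 1 / 2 * cos (real (Suc k) * \<theta>) + 1 / 2 * cos (real j * \<theta>)" for \<theta>
        proof -
          have "real (Suc k) * \<theta> = real k * \<theta> + \<theta>" "real j * \<theta> = real k * \<theta> - \<theta>"
            by (simp_all add: Suc algebra_simps)
          then show ?thesis by (simp only: cos_add cos_diff) (simp add: field_simps)
        qed
        then show ?thesis using that Suc by (simp only:) (intro add scale basis; simp)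
      qed
    qed
    have "(\<lambda>\<theta>. cos \<theta> * f \<theta>) = (\<lambda>\<theta>. \<Sum>k\<le>d. a k * (cos \<theta> * cos (real k * \<theta>)))"
      using a by (auto simp: sum_distrib_left mult.left_commute)
    then show ?thesis using sum[OF _ summand, of "{..d}"] by simp
  qed
  have "T d (\<lambda>\<theta>. poly p (cos \<theta>))" if "degree p \<le> d" for p d
    using that
  proof (induction d arbitrary: p)
    case 0
    then obtain c where "p = [:c:]" using degree_eq_zeroE by blast
    then show ?case using scale[OF basis[of 0 0], of c] by simp
  next
    case (Suc d)
    obtain b q where p: "p = pCons b q" by (cases p)
    have "degree q \<le> d" using Suc.prems p by (auto split: if_splits)
    then have "T (Suc d) (\<lambda>\<theta>. cos \<theta> * poly q (cos \<theta>))" by (intro step Suc.IH)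
    moreover have "T (Suc d) (\<lambda>\<theta>. b * cos (real 0 * \<theta>))" by (intro scale basis) simp
    ultimately show ?case using add[of "Suc d" "\<lambda>\<theta>. b * cos (real 0 * \<theta>)"] by (simp add: p)
  qed
  with assms show ?thesis using that unfolding T_def by blast
qed

lemma cos_orthogonality:
  assumes k: "1 \<le> k" "k < M" and j: "j < M"
  defines "\<theta> \<equiv> \<lambda>l. real l * pi / real M"
  shows "(\<Sum>l<2 * M. cos (real j * \<theta> l) * cos (real k * \<theta> l)) = (if j = k then real M else 0)"
proof -
  have M: "M > 0" using k by simp
  have vanish: "(\<Sum>l<2 * M. cos (of_int m * \<theta> l)) = 0" if "m \<noteq> 0" "\<bar>m\<bar> < 2 * int M" for m
    using sum_cos_multiple[OF M that, of 0] by (simp add: \<theta>_def)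
  have "cos (real j * \<theta> l) * cos (real k * \<theta> l) =
      1 / 2 * cos (of_int (int j + int k) * \<theta> l) + 1 / 2 * cos (of_int (int j - int k) * \<theta> l)" for l
  proof -
    have "of_int (int j + int k) * \<theta> l = real j * \<theta> l + real k * \<theta> l"
      "of_int (int j - int k) * \<theta> l = real j * \<theta> l - real k * \<theta> l"
      by (simp_all add: algebra_simps)
    then show ?thesis by (simp only: cos_add cos_diff) (simp add: field_simps)
  qed
  then have "(\<Sum>l<2 * M. cos (real j * \<theta> l) * cos (real k * \<theta> l)) =
      1 / 2 * (\<Sum>l<2 * M. cos (of_int (int j + int k) * \<theta> l)) + 1 / 2 * (\<Sum>l<2 * M. cos (of_int (int j - int k) * \<theta> l))"
    by (simp only: sum.distrib sum_distrib_left)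
  also have "(\<Sum>l<2 * M. cos (of_int (int j + int k) * \<theta> l)) = 0"
    using k j by (intro vanish) auto
  also have "(\<Sum>l<2 * M. cos (of_int (int j - int k) * \<theta> l)) = (if j = k then 2 * real M else 0)"
  proof (cases "j = k")
    case False
    then show ?thesis using k j vanish[of "int j - int k"] by simp
  qed simp
  finally show ?thesis by (cases "j = k") simp_all
qed

text \<open>Bessel's inequality for the single frequency \<open>k\<close> on \<open>2 * M\<close>
  equidistant nodes. The squared norm of that cosine is \<open>M\<close>, half the number of nodes;
  hence the \<open>sqrt 2\<close>.\<close>

lemma cos_coefficient_bound:
  assumes F: "\<And>\<theta>. \<bar>\<Sum>k\<le>d. a k * cos (real k * \<theta>)\<bar> \<le> F" and k: "1 \<le> k" "k \<le> d"
  shows "\<bar>a k\<bar> \<le> sqrt 2 * F"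
proof -
  define M where "M = Suc d"
  define \<theta> where "\<theta> l = real l * pi / real M" for l
  define C where "C l = (\<Sum>k\<le>d. a k * cos (real k * \<theta> l))" for l
  have kM: "k < M" using k by (simp add: M_def)
  have CC: "(\<Sum>l<2 * M. C l * cos (real k * \<theta> l)) = real M * a k"
  proof -
    have "(\<Sum>l<2 * M. C l * cos (real k * \<theta> l)) = (\<Sum>j\<le>d. a j * (\<Sum>l<2 * M. cos (real j * \<theta> l) * cos (real k * \<theta> l)))"
      unfolding C_def sum_distrib_right sum_distrib_left by (subst sum.swap) (simp add: mult.assoc)
    also have "\<dots> = (\<Sum>j\<le>d. if j = k then a j * real M else 0)"
      unfolding \<theta>_def using k by (intro sum.cong refl) (subst cos_orthogonality[OF k(1) kM], auto simp: M_def)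
    also have "\<dots> = real M * a k" using k by simp
    finally show ?thesis .
  qed
  have cc: "(\<Sum>l<2 * M. cos (real k * \<theta> l) * cos (real k * \<theta> l)) = real M"
    using cos_orthogonality[OF k(1) kM kM] by (simp add: \<theta>_def)
  have F0: "F \<ge> 0" using F[of 0] by (meson abs_ge_zero order_trans)
  have "0 \<le> (\<Sum>l<2 * M. (C l - a k * cos (real k * \<theta> l))\<^sup>2)" by (intro sum_nonneg) simp
  also have "\<dots> = (\<Sum>l<2 * M. (C l)\<^sup>2) - 2 * a k * (\<Sum>l<2 * M. C l * cos (real k * \<theta> l))
      + (a k)\<^sup>2 * (\<Sum>l<2 * M. cos (real k * \<theta> l) * cos (real k * \<theta> l))"
    by (simp add: power2_diff sum.distrib sum_subtractf sum_distrib_left power2_eq_square algebra_simps)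
  also have "\<dots> = (\<Sum>l<2 * M. (C l)\<^sup>2) - real M * (a k)\<^sup>2"
    unfolding CC cc by (simp add: power2_eq_square algebra_simps)
  finally have "real M * (a k)\<^sup>2 \<le> (\<Sum>l<2 * M. (C l)\<^sup>2)" by simp
  also have "\<dots> \<le> (\<Sum>l<2 * M. F\<^sup>2)"
  proof (intro sum_mono)
    fix l show "(C l)\<^sup>2 \<le> F\<^sup>2" using F[of "\<theta> l"] F0 by (simp add: C_def abs_le_square_iff[symmetric])
  qed
  also have "\<dots> = real M * (2 * F\<^sup>2)" by simp
  finally have "(a k)\<^sup>2 \<le> 2 * F\<^sup>2" by (simp add: M_def)
  also have "\<dots> = (sqrt 2 * F)\<^sup>2" by (simp add: power_mult_distrib)
  finally show ?thesis using F0 by (simp add: abs_le_square_iff[symmetric])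
qed

lemma abs_sin_multiple: "\<bar>sin (real k * x)\<bar> \<le> real k * \<bar>sin x\<bar>"
proof (induction k)
  case (Suc k)
  have "\<bar>sin (real (Suc k) * x)\<bar> \<le> \<bar>sin (real k * x)\<bar> * \<bar>cos x\<bar> + \<bar>cos (real k * x)\<bar> * \<bar>sin x\<bar>"
    unfolding abs_mult[symmetric] using abs_triangle_ineq[of "sin (real k * x) * cos x" "cos (real k * x) * sin x"]
    by (simp add: distrib_right sin_add algebra_simps)
  also have "\<dots> \<le> \<bar>sin (real k * x)\<bar> * 1 + 1 * \<bar>sin x\<bar>"
    by (intro add_mono mult_left_mono mult_right_mono) auto
  finally show ?case using Suc by (simp add: distrib_right)
qed simp

lemma one_minus_cos_multiple: "1 - cos (real k * \<theta>) \<le> (real k)\<^sup>2 * (1 - cos \<theta>)"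
proof -
  have half: "1 - cos x = 2 * (sin (x / 2))\<^sup>2" for x :: real using cos_double_sin[of "x / 2"] by simp
  have "\<bar>sin (real k * (\<theta> / 2))\<bar>\<^sup>2 \<le> (real k * \<bar>sin (\<theta> / 2)\<bar>)\<^sup>2"
    by (intro power_mono abs_sin_multiple) simp
  then show ?thesis unfolding half[of \<theta>] half[of "real k * \<theta>"] by (simp add: power_mult_distrib)
qed

text \<open>The constant collects the coefficient bound \<open>sqrt 2 * F\<close>, the factor
  \<open>k^2 \<le> d^2\<close> from \<open>one_minus_cos_multiple\<close>, and the number
  \<open>d\<close> of nonconstant frequencies.\<close>

lemma endpoint_deviation:
  fixes p :: "real poly"
  assumes p: "degree p \<le> d" and F: "\<And>t. \<bar>t\<bar> \<le> 1 \<Longrightarrow> \<bar>poly p t\<bar> \<le> F" and t: "\<bar>t\<bar> \<le> 1"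
  shows "\<bar>poly p t - poly p 1\<bar> \<le> sqrt 2 * real d ^ 3 * (1 - t) * F"
proof -
  obtain a where a: "\<And>\<theta>. poly p (cos \<theta>) = (\<Sum>k\<le>d. a k * cos (real k * \<theta>))"
    using poly_cos_expansion[OF p] by blast
  define \<theta> where "\<theta> = arccos t"
  have ct: "cos \<theta> = t" using t by (simp add: \<theta>_def abs_le_iff)
  have "\<bar>poly p 0\<bar> \<le> F" by (rule F) simp
  then have F0: "F \<ge> 0" by linarith
  have bound: "\<bar>a k\<bar> \<le> sqrt 2 * F" if "1 \<le> k" "k \<le> d" for k
    using F by (intro cos_coefficient_bound[OF _ that, of a]) (simp add: a[symmetric])
  have "poly p 1 - poly p t = (\<Sum>k\<le>d. a k * (1 - cos (real k * \<theta>)))"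
    using a[of 0] a[of \<theta>] ct by (simp add: sum_subtractf right_diff_distrib)
  also have "\<bar>\<dots>\<bar> \<le> (\<Sum>k\<le>d. \<bar>a k * (1 - cos (real k * \<theta>))\<bar>)" by (rule sum_abs)
  also have "\<dots> \<le> (\<Sum>k\<le>d. if k = 0 then 0 else sqrt 2 * F * ((real d)\<^sup>2 * (1 - t)))"
  proof (intro sum_mono)
    fix k assume k: "k \<in> {..d}"
    show "\<bar>a k * (1 - cos (real k * \<theta>))\<bar> \<le> (if k = 0 then 0 else sqrt 2 * F * ((real d)\<^sup>2 * (1 - t)))"
    proof (cases "k = 0")
      case False
      have "1 - cos (real k * \<theta>) \<le> (real k)\<^sup>2 * (1 - t)" using one_minus_cos_multiple[of k \<theta>] ct by simp
      also have "\<dots> \<le> (real d)\<^sup>2 * (1 - t)" using k t by (intro mult_right_mono power_mono) auto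
      finally have "\<bar>1 - cos (real k * \<theta>)\<bar> \<le> (real d)\<^sup>2 * (1 - t)" by simp
      then show ?thesis unfolding abs_mult using False k F0 by (simp, intro mult_mono bound) auto
    qed simp
  qed
  also have "\<dots> = real d * (sqrt 2 * F * ((real d)\<^sup>2 * (1 - t)))"
    by (simp add: sum.atMost_shift)
  also have "\<dots> = sqrt 2 * real d ^ 3 * (1 - t) * F" by (simp add: power2_eq_square power3_eq_cube)
  finally show ?thesis by (simp add: abs_minus_commute)
qed

text \<open>Reducing by \<open>s^2 = 1 - c^2\<close> leaves at most one factor \<open>s\<close>;
  \<open>P\<close> is the part that is even in the angle.\<close>

lemma peval_great_circle:
  assumes f: "f \<in> polys_le N d"
  obtains P Q :: "real poly" where "degree P \<le> d"
    "\<And>c s. c\<^sup>2 + s\<^sup>2 = 1 \<Longrightarrow> peval f (\<lambda>i. c * X i + s * Z i) = poly P c + s * poly Q c"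
proof -
  \<comment> \<open>Bounding \<open>degree (pCons 0 Q)\<close> says that the degree of
    \<open>Q\<close> is one less, and still admits \<open>Q = 0\<close> for the empty list.\<close>
  have lists: "\<exists>P Q :: real poly. degree P \<le> length zs \<and> degree (pCons 0 Q) \<le> length zs \<and>
      (\<forall>c s. c\<^sup>2 + s\<^sup>2 = 1 \<longrightarrow> peval (lprod N zs) (\<lambda>i. c * X i + s * Z i) = poly P c + s * poly Q c)" for zs
  proof (induction zs)
    case Nil
    show ?case by (intro exI[of _ 1] exI[of _ 0]) simp
  next
    case (Cons z zs)
    then obtain P Q :: "real poly" where PQ: "degree P \<le> length zs" "degree (pCons 0 Q) \<le> length zs"
      "\<And>c s. c\<^sup>2 + s\<^sup>2 = 1 \<Longrightarrow> peval (lprod N zs) (\<lambda>i. c * X i + s * Z i) = poly P c + s * poly Q c"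
      by blast
    define \<alpha> \<beta> where "\<alpha> = dot N z X" and "\<beta> = dot N z Z"
    have xs: "degree (pCons 0 P) \<le> Suc (length zs)" using PQ(1) by (auto simp: degree_pCons_eq_if)
    have xq: "degree (pCons 0 (pCons 0 Q)) \<le> Suc (length zs)"
      using PQ(2) by (auto simp: degree_pCons_eq_if split: if_splits)
    have q: "degree Q \<le> Suc (length zs)" using PQ(2) by (auto simp: degree_pCons_eq_if split: if_splits)
    let ?P = "smult \<alpha> (pCons 0 P) + smult \<beta> (Q - pCons 0 (pCons 0 Q))"
    let ?Q = "smult \<alpha> (pCons 0 Q) + smult \<beta> P"
    have "degree ?P \<le> length (z # zs)"
      using xs xq q by (auto intro!: degree_add_le degree_diff_le order_trans[OF degree_smult_le] simp del: smult_pCons)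
    moreover have "degree (pCons 0 ?Q) \<le> length (z # zs)"
    proof -
      have "degree ?Q \<le> length zs"
        using PQ(1,2) by (auto intro!: degree_add_le order_trans[OF degree_smult_le] simp del: smult_pCons)
      then show ?thesis by (auto simp: degree_pCons_eq_if)
    qed
    moreover have "peval (lprod N (z # zs)) (\<lambda>i. c * X i + s * Z i) = poly ?P c + s * poly ?Q c" if cs: "c\<^sup>2 + s\<^sup>2 = 1" for c s
    proof -
      have s2: "s * s = 1 - c * c" using cs by (simp add: power2_eq_square algebra_simps)
      have "dot N z (\<lambda>i. c * X i + s * Z i) = c * \<alpha> + s * \<beta>"
        by (simp only: dot_add_right dot_scale_right \<alpha>_def \<beta>_def)
      then have "peval (lprod N (z # zs)) (\<lambda>i. c * X i + s * Z i) = (c * \<alpha> + s * \<beta>) * (poly P c + s * poly Q c)"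
        by (simp add: PQ(3)[OF cs])
      also have "\<dots> = \<alpha> * c * poly P c + (s * s) * (\<beta> * poly Q c) + s * (\<alpha> * c * poly Q c + \<beta> * poly P c)"
        by (simp add: algebra_simps)
      also have "\<dots> = poly ?P c + s * poly ?Q c" unfolding s2 by (simp add: algebra_simps)
      finally show ?thesis .
    qed
    ultimately show ?case by blast
  qed
  have "\<exists>P. degree (fst P) \<le> d \<and>
      (\<forall>c s. c\<^sup>2 + s\<^sup>2 = 1 \<longrightarrow> meval m (\<lambda>i. c * X i + s * Z i) = poly (fst P) c + s * poly (snd P) c)"
    if m: "m \<in> keys f" for m
  proof -
    have m': "keys m \<subseteq> {..<N}" "mdeg m \<le> d" using f m by (auto simp: polys_le_iff monoms_def)
    obtain ws where ws: "set ws \<subseteq> {..<N}" "length ws = mdeg m" "mlist ws = m"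
      using monomial_as_list[OF m'(1)] .
    have ev: "peval (lprod N (map bvec ws)) y = meval m y" for y
      unfolding lprod_bvec[OF ws(1)] ws(3) by simp
    obtain P Q :: "real poly" where "degree P \<le> length (map bvec ws)"
      "\<forall>c s. c\<^sup>2 + s\<^sup>2 = 1 \<longrightarrow> peval (lprod N (map bvec ws)) (\<lambda>i. c * X i + s * Z i) = poly P c + s * poly Q c"
      using lists by blast
    then show ?thesis using ws(2) m'(2) by (intro exI[of _ "(P, Q)"]) (simp add: ev)
  qed
  then have "\<forall>m\<in>keys f. \<exists>P. degree (fst P) \<le> d \<and>
      (\<forall>c s. c\<^sup>2 + s\<^sup>2 = 1 \<longrightarrow> meval m (\<lambda>i. c * X i + s * Z i) = poly (fst P) c + s * poly (snd P) c)" by blast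
  from bchoice[OF this] obtain R where R: "\<forall>m\<in>keys f. degree (fst (R m)) \<le> d \<and>
      (\<forall>c s. c\<^sup>2 + s\<^sup>2 = 1 \<longrightarrow> meval m (\<lambda>i. c * X i + s * Z i) = poly (fst (R m)) c + s * poly (snd (R m)) c)"
    by blast
  define P Q where "P m = fst (R m)" and "Q m = snd (R m)" for m
  have PQ: "degree (P m) \<le> d" "\<And>c s. c\<^sup>2 + s\<^sup>2 = 1 \<Longrightarrow> meval m (\<lambda>i. c * X i + s * Z i) = poly (P m) c + s * poly (Q m) c"
    if "m \<in> keys f" for m
    using R that unfolding P_def Q_def by blast+
  show ?thesis
  proof (rule that[of "\<Sum>m\<in>keys f. smult (lookup f m) (P m)" "\<Sum>m\<in>keys f. smult (lookup f m) (Q m)"])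
    show "degree (\<Sum>m\<in>keys f. smult (lookup f m) (P m)) \<le> d"
      using PQ by (intro degree_sum_le) (auto intro: order_trans[OF degree_smult_le])
    fix c s :: real assume "c\<^sup>2 + s\<^sup>2 = 1"
    then show "peval f (\<lambda>i. c * X i + s * Z i) = poly (\<Sum>m\<in>keys f. smult (lookup f m) (P m)) c
        + s * poly (\<Sum>m\<in>keys f. smult (lookup f m) (Q m)) c"
      using PQ unfolding peval_superset[OF finite_keys subset_refl]
      by (simp add: poly_sum sum_distrib_left sum.distrib[symmetric] algebra_simps)
  qed
qed

text \<open>The average over a point and its mirror image is an even trigonometric polynomial in the
  angle to the pole \<open>X\<close>, so it deviates from \<open>f X\<close> only to second order in that angle.\<close>

theorem symmetrized_deviation:
  assumes f: "f \<in> polys_le N d" and d: "d \<ge> 1" and F: "\<And>z. dot N z z = 1 \<Longrightarrow> \<bar>peval f z\<bar> \<le> F"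
    and X: "dot N X X = 1" and y: "dot N y y = 1"
  shows "\<bar>(peval f y + peval f (axis_reflection N X y)) / 2 - peval f X\<bar> \<le> sqrt 2 * real d ^ 3 * (1 - dot N X y) * F"
proof -
  have fp: "f \<in> polys N" using f by (rule polys_le_imp_polys)
  let ?R = "axis_reflection N X"
  define t where "t = dot N X y"
  have t1: "\<bar>t\<bar> \<le> 1" unfolding t_def by (rule sphere_dot_bound[OF X y])
  have F0: "F \<ge> 0" using F[OF X] by (meson abs_ge_zero order_trans)
  define W where "W = (\<lambda>i. y i - t * X i)"
  have WW: "dot N W W = 1 - t\<^sup>2"
    unfolding W_def by (simp only: dot_linear X y) (simp add: t_def dot_commute[of N y X] power2_eq_square algebra_simps)
  have XW: "dot N X W = 0" unfolding W_def by (simp only: dot_linear X) (simp add: t_def)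
  \<comment> \<open>At the poles \<open>y\<close> determines no tangent direction. At the antipode
    the crude bound \<open>2 * F\<close> fits already, since \<open>1 - t\<close> is 2.\<close>
  consider "t = 1" | "t = - 1" | "\<bar>t\<bar> < 1" using t1 by linarith
  then show ?thesis
  proof cases
    case 1
    have yX: "y i = X i" if "i < N" for i
      using dot_self_eq_0[of N W i] WW 1 that by (simp add: W_def)
    have "peval f y = peval f X" by (rule peval_cong[OF fp yX])
    moreover have "peval f (?R y) = peval f X"
      by (rule peval_cong[OF fp]) (use 1 yX in \<open>simp add: axis_reflection_def t_def\<close>)
    ultimately show ?thesis using 1 by (simp add: t_def)
  next
    case 2
    have R: "dot N (?R y) (?R y) = 1"
      using symmetric_isometry_axis_reflection[OF X] y unfolding symmetric_isometry_def by metis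
    have "\<bar>(peval f y + peval f (?R y)) / 2 - peval f X\<bar> \<le> 2 * F"
      using F[OF X] F[OF y] F[OF R] unfolding abs_le_iff by (auto simp: field_simps)
    also have "2 * F = 1 * 1 * 2 * F" by simp
    also have "\<dots> \<le> sqrt 2 * real d ^ 3 * 2 * F"
      using d F0 by (intro mult_right_mono mult_mono) (auto intro: one_le_power)
    finally show ?thesis using 2 by (simp add: t_def)
  next
    case 3
    define s0 where "s0 = sqrt (1 - t\<^sup>2)"
    have t2: "t\<^sup>2 < 1" using 3 by (simp add: abs_square_less_1)
    then have s0: "s0 > 0" "s0\<^sup>2 = 1 - t\<^sup>2" by (simp_all add: s0_def)
    \<comment> \<open>\<open>Z\<close> is the unit tangent at \<open>X\<close> towards
      \<open>y\<close>. In the plane of \<open>X\<close> and \<open>Z\<close> the point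
      \<open>y\<close> has coordinates \<open>t\<close> and \<open>s0\<close>, its mirror image
      \<open>t\<close> and \<open>- s0\<close>.\<close>
    define Z where "Z = (\<lambda>i. (1 / s0) * W i)"
    have ZZ: "dot N Z Z = 1" unfolding Z_def dot_scale_left dot_scale_right WW s0(2)[symmetric]
      using s0(1) by (simp add: power2_eq_square)
    have XZ: "dot N X Z = 0" unfolding Z_def dot_scale_right XW by simp
    have sphere: "dot N (\<lambda>i. c * X i + s * Z i) (\<lambda>i. c * X i + s * Z i) = 1" if "c\<^sup>2 + s\<^sup>2 = 1" for c s
      using that by (simp only: dot_linear X ZZ XZ dot_commute[of N Z X]) (simp add: power2_eq_square)
    obtain P Q :: "real poly" where P: "degree P \<le> d"
      and PQ: "\<And>c s. c\<^sup>2 + s\<^sup>2 = 1 \<Longrightarrow> peval f (\<lambda>i. c * X i + s * Z i) = poly P c + s * poly Q c"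
      using peval_great_circle[OF f] by blast
    have avg: "poly P c = (peval f (\<lambda>i. c * X i + s * Z i) + peval f (\<lambda>i. c * X i + (- s) * Z i)) / 2" if "c\<^sup>2 + s\<^sup>2 = 1" for c s
      using PQ[OF that] PQ[of c "- s"] that by simp
    have bound: "\<bar>poly P c\<bar> \<le> F" if "\<bar>c\<bar> \<le> 1" for c
    proof -
      have "c\<^sup>2 \<le> 1" using that by (simp add: abs_square_le_1)
      then have s: "c\<^sup>2 + (sqrt (1 - c\<^sup>2))\<^sup>2 = 1" by simp
      then have s': "c\<^sup>2 + (- sqrt (1 - c\<^sup>2))\<^sup>2 = 1" by simp
      show ?thesis using avg[OF s] F[OF sphere[OF s]] F[OF sphere[OF s']] unfolding abs_le_iff by (auto simp: field_simps)
    qed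
    have "poly P 1 = peval f X" using PQ[of 1 0] by simp
    moreover have "poly P t = (peval f y + peval f (?R y)) / 2"
    proof -
      have "peval f (\<lambda>i. t * X i + s0 * Z i) = peval f y"
        using s0 by (intro arg_cong[where f = "peval f"]) (simp add: fun_eq_iff Z_def W_def)
      moreover have "peval f (\<lambda>i. t * X i + (- s0) * Z i) = peval f (?R y)"
        using s0 by (intro arg_cong[where f = "peval f"]) (simp add: fun_eq_iff Z_def W_def axis_reflection_def t_def algebra_simps)
      ultimately show ?thesis using avg[of t s0] s0 by simp
    qed
    moreover have "\<bar>poly P t - poly P 1\<bar> \<le> sqrt 2 * real d ^ 3 * (1 - t) * F"
      by (rule endpoint_deviation[OF P bound t1])
    ultimately show ?thesis by (simp only: t_def)
  qed
qed

section \<open>The kernel operator\<close>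

lemma ball_sphere_up: "x \<in> unit_ball n \<Longrightarrow> dot (Suc n) (up n x) (up n x) = 1"
  by (simp add: unit_ball_iff)

lemma peval_up: "p \<in> polys n \<Longrightarrow> peval p (up n x) = peval p x"
  by (rule peval_cong) (auto simp: up_def)

lemma sphere_restrict_ball:
  assumes "dot (Suc n) y y = 1"
  shows "restrict y {..<n} \<in> unit_ball n"
proof -
  have "dot n (restrict y {..<n}) (restrict y {..<n}) = dot n y y" by (intro dot_cong) auto
  also have "\<dots> \<le> 1" using assms by (simp add: dot_Suc) (metis add_increasing2 le_add_same_cancel1 zero_le_square order_refl)
  finally show ?thesis by (simp add: unit_ball_iff)
qed

lemma peval_restrict: "p \<in> polys n \<Longrightarrow> peval p (restrict y {..<n}) = peval p y"
  by (rule peval_cong) auto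

lemma ball_nonempty: "unit_ball n \<noteq> {}"
proof -
  have "restrict (\<lambda>_. 0) {..<n} \<in> unit_ball n" by (simp add: unit_ball_iff dot_def)
  then show ?thesis by blast
qed

lemma ball_peval_bounded:
  assumes "p \<in> polys n" "x \<in> unit_ball n"
  shows "\<bar>peval p x\<bar> \<le> (\<Sum>m\<in>keys p. \<bar>lookup p m\<bar>)"
  using assms by (intro peval_bounded dot_le_one_coord) (auto simp: unit_ball_iff)

lemma sup_norm_upper: "p \<in> polys n \<Longrightarrow> x \<in> unit_ball n \<Longrightarrow> \<bar>peval p x\<bar> \<le> sup_norm n p"
  unfolding sup_norm_def
  by (rule cSUP_upper) (auto intro!: bdd_aboveI2 ball_peval_bounded)

lemma sup_norm_least: "(\<And>x. x \<in> unit_ball n \<Longrightarrow> \<bar>peval p x\<bar> \<le> B) \<Longrightarrow> sup_norm n p \<le> B"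
  unfolding sup_norm_def by (rule cSUP_least[OF ball_nonempty])

lemma sup_norm_nonneg: "p \<in> polys n \<Longrightarrow> sup_norm n p \<ge> 0"
  using sup_norm_upper ball_nonempty by (meson abs_ge_zero equals0I order_trans)

lemma sup_norm_sphere:
  assumes "p \<in> polys n" "dot (Suc n) y y = 1"
  shows "\<bar>peval p y\<bar> \<le> sup_norm n p"
  using sup_norm_upper[OF assms(1) sphere_restrict_ball[OF assms(2)]] by (simp add: peval_restrict assms)

lemma sup_norm_eq_0: "p \<in> polys n \<Longrightarrow> sup_norm n p \<le> 0 \<Longrightarrow> p = 0"
  using sup_norm_upper by (intro polys_zero_on_ball[of p n]) force+

lemma sup_norm_triangle:
  assumes "p \<in> polys n" "q \<in> polys n"
  shows "sup_norm n p \<le> sup_norm n q + sup_norm n (p - q)"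
proof (rule sup_norm_least)
  fix x assume x: "x \<in> unit_ball n"
  show "\<bar>peval p x\<bar> \<le> sup_norm n q + sup_norm n (p - q)"
    using sup_norm_upper[OF assms(2) x] sup_norm_upper[OF polys_diff[OF assms] x] by simp
qed

lemma fmin_le: "p \<in> polys n \<Longrightarrow> x \<in> unit_ball n \<Longrightarrow> fmin n p \<le> peval p x"
  unfolding fmin_def
  by (rule cINF_lower) (auto intro!: bdd_belowI2[where m = "- (\<Sum>m\<in>keys p. \<bar>lookup p m\<bar>)"] dest: ball_peval_bounded)

lemma fmax_ge: "p \<in> polys n \<Longrightarrow> x \<in> unit_ball n \<Longrightarrow> peval p x \<le> fmax n p"
  unfolding fmax_def
  by (rule cSUP_upper) (auto intro!: bdd_aboveI2[where M = "\<Sum>m\<in>keys p. \<bar>lookup p m\<bar>"] dest: ball_peval_bounded)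

section \<open>Linear algebra on polynomials of bounded degree\<close>

interpretation mpoly_vs: vector_space "\<lambda>c (p :: mpoly). mconst c * p"
  by unfold_locales (simp_all add: mconst_add mconst_mult algebra_simps)

lemma finite_monoms: "finite (monoms n k)"
proof -
  have "monoms n k \<subseteq> mlist ` {ws. set ws \<subseteq> {..<n} \<and> length ws \<le> k}"
  proof
    fix m assume "m \<in> monoms n k"
    then have m: "keys m \<subseteq> {..<n}" "mdeg m \<le> k" by (auto simp: monoms_def)
    obtain ws where "set ws \<subseteq> {..<n}" "length ws = mdeg m" "mlist ws = m"
      using monomial_as_list[OF m(1)] .
    then show "m \<in> mlist ` {ws. set ws \<subseteq> {..<n} \<and> length ws \<le> k}" using m(2) by auto
  qed
  then show ?thesis by (rule finite_subset) (intro finite_imageI finite_lists_length_le finite_lessThan)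
qed

text \<open>An injective endomorphism of a finite-dimensional space is onto. Linearity of
  \<open>K\<close> is given on the subspace \<open>polys_le n d\<close> only, so the count is made
  with a basis \<open>B\<close> and its image.\<close>

lemma polys_le_surj:
  assumes lin: "\<And>p q. p \<in> polys_le n d \<Longrightarrow> q \<in> polys_le n d \<Longrightarrow> K (p + q) = K p + K q"
    "\<And>c p. p \<in> polys_le n d \<Longrightarrow> K (mconst c * p) = mconst c * K p"
    and maps: "\<And>p. p \<in> polys_le n d \<Longrightarrow> K p \<in> polys_le n d"
    and inj: "\<And>p. p \<in> polys_le n d \<Longrightarrow> K p = 0 \<Longrightarrow> p = 0"
    and f: "f \<in> polys_le n d"
  obtains p where "p \<in> polys_le n d" "K p = f"
proof -
  define V where "V = polys_le n d"
  define E where "E = (\<lambda>m. single m (1 :: real)) ` monoms n d"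
  have E: "finite E" "V \<subseteq> mpoly_vs.span E"
  proof -
    show "finite E" unfolding E_def by (intro finite_imageI finite_monoms)
    show "V \<subseteq> mpoly_vs.span E"
    proof
      fix p assume "p \<in> V"
      then have "keys p \<subseteq> monoms n d" by (simp add: V_def polys_le_iff)
      then have "(\<Sum>m\<in>keys p. mconst (lookup p m) * single m 1) \<in> mpoly_vs.span E"
        by (intro mpoly_vs.span_sum mpoly_vs.span_scale mpoly_vs.span_base) (auto simp: E_def)
      moreover have "p = (\<Sum>m\<in>keys p. mconst (lookup p m) * single m 1)" by (rule mpoly_expand)
      ultimately show "p \<in> mpoly_vs.span E" by (simp only:)
    qed
  qed
  have sub: "mpoly_vs.subspace V"
    unfolding mpoly_vs.subspace_def V_def by (auto intro: polys_le_add polys_le_cmult)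
  obtain B where B: "B \<subseteq> V" "mpoly_vs.independent B" "V \<subseteq> mpoly_vs.span B"
    by (rule mpoly_vs.basis_exists[of V])
  have spanB: "mpoly_vs.span B = V"
    using mpoly_vs.span_minimal[OF B(1) sub] B(3) by (rule subset_antisym)
  have finB: "finite B"
    using mpoly_vs.independent_span_bound[OF E(1) B(2)] B(1) E(2) by blast
  have K0: "K 0 = 0" using lin(2)[of 0 0] by simp
  have Ksum: "K (\<Sum>b\<in>A. mconst (c b) * b) = (\<Sum>b\<in>A. mconst (c b) * K b)" if "finite A" "A \<subseteq> V" for A c
    using that
  proof (induction A)
    case (insert a A)
    have "mconst (c a) * a \<in> V" using insert.prems by (simp add: V_def polys_le_cmult)
    moreover have "(\<Sum>b\<in>A. mconst (c b) * b) \<in> V"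
      unfolding V_def using insert.prems by (intro polys_le_sum polys_le_cmult) (auto simp: V_def)
    ultimately show ?case using insert lin by (simp add: V_def)
  qed (simp add: K0)
  have injB: "inj_on K B"
  proof (rule inj_onI)
    fix a b assume ab: "a \<in> B" "b \<in> B" "K a = K b"
    have V: "a \<in> V" "b \<in> V" using ab B(1) by auto
    then have V': "mconst (- 1) * b \<in> V" unfolding V_def by (intro polys_le_cmult)
    have "K (a + mconst (- 1) * b) = K a + mconst (- 1) * K b"
      using V V' by (simp only: V_def lin)
    then have "K (a + mconst (- 1) * b) = 0"
      by (simp only: ab(3) mconst_uminus mconst_1) simp
    moreover have "a + mconst (- 1) * b \<in> polys_le n d"
      using V(1) V' unfolding V_def by (rule polys_le_add)
    ultimately have "a + mconst (- 1) * b = 0" by (rule inj[rotated])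
    then show "a = b" by (simp add: mconst_uminus)
  qed
  have KB: "K ` B \<subseteq> V" using B(1) maps by (auto simp: V_def)
  have indep: "mpoly_vs.independent (K ` B)"
  proof (rule mpoly_vs.independent_if_scalars_zero)
    show "finite (K ` B)" using finB by simp
    fix c y assume s: "(\<Sum>x\<in>K ` B. mconst (c x) * x) = 0" and y: "y \<in> K ` B"
    have "K (\<Sum>b\<in>B. mconst (c (K b)) * b) = 0"
      using s by (simp add: Ksum[OF finB B(1)] sum.reindex[OF injB])
    moreover have "(\<Sum>b\<in>B. mconst (c (K b)) * b) \<in> polys_le n d"
      using B(1) by (intro polys_le_sum polys_le_cmult) (auto simp: V_def)
    ultimately have z: "(\<Sum>b\<in>B. mconst (c (K b)) * b) = 0" by (rule inj[rotated])
    have ex: "\<forall>v\<in>B. u v = 0" if "(\<Sum>v\<in>B. mconst (u v) * v) = 0" for u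
      using B(2) finB that unfolding mpoly_vs.independent_explicit_finite_subsets by blast
    have "\<forall>b\<in>B. c (K b) = 0" by (rule ex) (rule z)
    then show "c y = 0" using y by auto
  qed
  have "f \<in> mpoly_vs.span (K ` B)"
  proof (rule ccontr)
    assume nf: "f \<notin> mpoly_vs.span (K ` B)"
    then have "mpoly_vs.independent (insert f (K ` B))" using indep mpoly_vs.independent_insert by metis
    moreover have "insert f (K ` B) \<subseteq> mpoly_vs.span B" using KB f spanB by (auto simp: V_def)
    ultimately have "card (insert f (K ` B)) \<le> card B"
      using mpoly_vs.independent_span_bound[OF finB] by blast
    moreover have "f \<notin> K ` B" using nf mpoly_vs.span_base by blast
    ultimately show False using finB by (simp add: card_image[OF injB])
  qed
  then obtain c where "f = (\<Sum>x\<in>K ` B. mconst (c x) * x)"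
    using mpoly_vs.span_finite[of "K ` B"] finB by auto
  also have "\<dots> = K (\<Sum>b\<in>B. mconst (c (K b)) * b)"
    by (simp add: Ksum[OF finB B(1)] sum.reindex[OF injB])
  finally have "K (\<Sum>b\<in>B. mconst (c (K b)) * b) = f" ..
  moreover have "(\<Sum>b\<in>B. mconst (c (K b)) * b) \<in> polys_le n d"
    using B(1) by (intro polys_le_sum polys_le_cmult) (auto simp: V_def)
  ultimately show ?thesis using that by blast
qed

text \<open>The half-turn about \<open>X\<close> leaves \<open>dot X y\<close> and with it the
  kernel unchanged, so \<open>f\<close> may be replaced by its average over \<open>y\<close> and the
  mirror image of \<open>y\<close>. The pointwise bound of \<open>symmetrized_deviation\<close> is
  then averaged against the kernel.\<close>

lemma kernel_deviation:
  assumes n: "n \<ge> 1" and d: "d \<ge> 1" and f: "f \<in> polys_le n d" and X: "dot (Suc n) X X = 1"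
    and q: "\<And>t. poly q t \<ge> 0" "zonal n q = 1" "zonal n (q * [:1, -1:]) \<le> \<delta>"
  shows "\<bar>sphere_mean n (upoly q (lform (Suc n) X) * f) - peval f X\<bar> \<le> sqrt 2 * real d ^ 3 * \<delta> * sup_norm n f"
proof -
  let ?N = "Suc n" and ?q = "upoly q (lform (Suc n) X)"
  let ?R = "axis_reflection ?N X"
  define F where "F = sup_norm n f"
  have fn: "f \<in> polys n" using f by (rule polys_le_imp_polys)
  have fN: "f \<in> polys_le ?N d" using f by (rule polys_le_mono) auto
  have fN': "f \<in> polys ?N" using fN by (rule polys_le_imp_polys)
  have F0: "F \<ge> 0" unfolding F_def by (rule sup_norm_nonneg[OF fn])
  have qN: "?q \<in> polys ?N" by (rule polys_zonal)
  have "?q * f \<in> polys_le ?N (total_degree (?q * f))"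
    by (intro polys_in_polys_le polys_mult qN fN')
  from sphere_mean_isometry[OF n symmetric_isometry_axis_reflection[OF X] this]
  obtain g where g: "g \<in> polys_le ?N (total_degree (?q * f))" "\<And>y. peval g y = peval (?q * f) (?R y)"
    "sphere_mean n g = sphere_mean n (?q * f)" by blast
  have gN: "g \<in> polys ?N" using g(1) by (rule polys_le_imp_polys)
  have XR: "dot ?N X (?R y) = dot ?N X y" for y
    unfolding axis_reflection_def by (simp add: dot_diff_right dot_scale_right X)
  define h where "h = mconst (1 / 2) * (?q * f + g) - mconst (peval f X) * ?q"
  have hN: "h \<in> polys ?N" unfolding h_def by (intro polys_intros qN fN' gN)
  have "sphere_mean n h = sphere_mean n (mconst (1 / 2) * (?q * f + g)) - peval f X * sphere_mean n ?q"
    unfolding h_def by (subst sphere_mean_diff) (auto intro: polys_intros qN fN' gN simp: sphere_mean_cmult)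
  also have "\<dots> = sphere_mean n (?q * f) - peval f X"
    using g(3) by (simp add: sphere_mean_cmult sphere_mean_add[OF polys_mult[OF qN fN'] gN] sphere_mean_zonal[OF n X] q)
  finally have h: "sphere_mean n h = sphere_mean n (?q * f) - peval f X" .
  define b where "b = upoly (smult (sqrt 2 * real d ^ 3 * F) (q * [:1, -1:])) (lform ?N X)"
  have bN: "b \<in> polys ?N" unfolding b_def by (rule polys_zonal)
  have hb: "\<bar>peval h y\<bar> \<le> peval b y" if y: "dot ?N y y = 1" for y
  proof -
    let ?t = "dot ?N X y"
    have ph: "peval h y = poly q ?t * ((peval f y + peval f (?R y)) / 2 - peval f X)"
      unfolding h_def by (simp add: g(2) XR algebra_simps)
    have "\<bar>peval h y\<bar> \<le> poly q ?t * (sqrt 2 * real d ^ 3 * (1 - ?t) * F)"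
      unfolding ph abs_mult abs_of_nonneg[OF q(1)]
      using symmetrized_deviation[OF fN d _ X y, of F] sup_norm_sphere[OF fn] q(1)
      by (intro mult_left_mono) (auto simp: F_def)
    also have "\<dots> = peval b y" unfolding b_def by (simp add: algebra_simps)
    finally show ?thesis .
  qed
  have "sphere_mean n b = sqrt 2 * real d ^ 3 * F * zonal n (q * [:1, -1:])"
    unfolding b_def sphere_mean_zonal[OF n X] zonal_smult ..
  also have "\<dots> \<le> sqrt 2 * real d ^ 3 * F * \<delta>" using F0 q(3) by (intro mult_left_mono) auto
  finally have b: "sphere_mean n b \<le> sqrt 2 * real d ^ 3 * \<delta> * F" by (simp add: mult_ac)
  have "sphere_mean n h \<le> sphere_mean n b" by (intro sphere_mean_mono hN bN) (use hb in force)
  moreover have "- sphere_mean n h \<le> sphere_mean n b"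
  proof -
    have "sphere_mean n (0 - h) \<le> sphere_mean n b"
      by (intro sphere_mean_mono polys_intros hN bN) (use hb in force)
    then show ?thesis using hN by (simp add: sphere_mean_diff del: diff_0)
  qed
  ultimately show ?thesis using b h by (simp add: F_def abs_le_iff)
qed

text \<open>Closeness to the identity bounds \<open>sup_norm n (K p)\<close> below by
  \<open>(1 - \<eta>) * sup_norm n p\<close>. So \<open>K\<close> is injective, hence onto, and its
  inverse has norm at most \<open>1 / (1 - \<eta>)\<close>. With \<open>K g = f\<close>, the
  difference \<open>g - f\<close> is the deviation of \<open>K\<close> at \<open>g\<close>.\<close>

theorem kernel_inverse:
  assumes n: "n \<ge> 1" and d: "d \<ge> 1" and f: "f \<in> polys_le n d"
    and q: "\<And>t. poly q t \<ge> 0" "zonal n q = 1" "zonal n (q * [:1, -1:]) \<le> \<delta>"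
    and \<eta>: "\<eta> = sqrt 2 * real d ^ 3 * \<delta>" "\<eta> < 1"
  obtains g where "g \<in> polys_le n d" "sup_norm n (g - f) \<le> \<eta> / (1 - \<eta>) * sup_norm n f"
    "\<And>X. dot (Suc n) X X = 1 \<Longrightarrow> sphere_mean n (upoly q (lform (Suc n) X) * g) = peval f X"
proof -
  let ?N = "Suc n"
  have "\<forall>p\<in>polys_le n d. \<exists>p'. p' \<in> polys_le n d \<and>
    (\<forall>X. dot ?N X X = 1 \<longrightarrow> sphere_mean n (upoly q (lform ?N X) * p) = peval p' X)"
    using zonal_average_degree[OF n] by metis
  from bchoice[OF this] obtain K where K: "\<And>p. p \<in> polys_le n d \<Longrightarrow> K p \<in> polys_le n d"
    "\<And>p X. p \<in> polys_le n d \<Longrightarrow> dot ?N X X = 1 \<Longrightarrow> sphere_mean n (upoly q (lform ?N X) * p) = peval (K p) X"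
    by blast
  have pn: "p \<in> polys n" if "p \<in> polys_le n d" for p using that by (rule polys_le_imp_polys)
  have pN: "p \<in> polys ?N" if "p \<in> polys_le n d" for p using polys_mono[OF pn[OF that]] by simp
  \<comment> \<open>\<open>K\<close> arises from a choice of polynomials, so even its linearity has
    to be read off from values on the sphere, which determine a polynomial in the first
    \<open>n\<close> variables.\<close>
  have uniq: "p = p'" if "p \<in> polys_le n d" "p' \<in> polys_le n d" "\<And>X. dot ?N X X = 1 \<Longrightarrow> peval p X = peval p' X" for p p'
  proof -
    have "p - p' = 0"
    proof (rule polys_zero_on_ball[of _ n])
      show "p - p' \<in> polys n" using that by (intro polys_diff pn)
      fix x assume "x \<in> unit_ball n"
      then show "peval (p - p') x = 0"
        using that(3)[OF ball_sphere_up] that(1,2) by (simp add: peval_up pn)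
    qed
    then show ?thesis by simp
  qed
  have dev: "sup_norm n (K p - p) \<le> \<eta> * sup_norm n p" if p: "p \<in> polys_le n d" for p
  proof (rule sup_norm_least)
    fix x assume x: "x \<in> unit_ball n"
    have "\<bar>peval (K p) (up n x) - peval p (up n x)\<bar> \<le> \<eta> * sup_norm n p"
      using kernel_deviation[OF n d p ball_sphere_up[OF x] q] K(2)[OF p ball_sphere_up[OF x]] by (simp add: \<eta>)
    then show "\<bar>peval (K p - p) x\<bar> \<le> \<eta> * sup_norm n p"
      using p K(1)[OF p] by (simp add: peval_up pn)
  qed
  have lower: "(1 - \<eta>) * sup_norm n p \<le> sup_norm n (K p)" if p: "p \<in> polys_le n d" for p
  proof -
    have "sup_norm n (p - K p) = sup_norm n (K p - p)"
      unfolding sup_norm_def by (simp add: abs_minus_commute)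
    then show ?thesis
      using sup_norm_triangle[OF pn[OF p] pn[OF K(1)[OF p]]] dev[OF p] by (simp add: algebra_simps)
  qed
  obtain g where g: "g \<in> polys_le n d" "K g = f"
  proof (rule polys_le_surj[of n d K f])
    fix p r assume pr: "p \<in> polys_le n d" "r \<in> polys_le n d"
    show "K (p + r) = K p + K r"
    proof (rule uniq)
      show "K (p + r) \<in> polys_le n d" "K p + K r \<in> polys_le n d" using pr by (auto intro: K polys_le_add)
      fix X assume X: "dot ?N X X = 1"
      have "peval (K (p + r)) X = sphere_mean n (upoly q (lform ?N X) * p + upoly q (lform ?N X) * r)"
        using K(2)[OF polys_le_add[OF pr] X] by (simp add: algebra_simps)
      also have "\<dots> = peval (K p + K r) X"
        using pr X by (subst sphere_mean_add) (auto intro: polys_mult polys_zonal pN simp: K)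
      finally show "peval (K (p + r)) X = peval (K p + K r) X" .
    qed
  next
    fix c p assume p: "p \<in> polys_le n d"
    show "K (mconst c * p) = mconst c * K p"
    proof (rule uniq)
      show "K (mconst c * p) \<in> polys_le n d" "mconst c * K p \<in> polys_le n d" using p by (auto intro: K polys_le_cmult)
      fix X assume X: "dot ?N X X = 1"
      have "peval (K (mconst c * p)) X = sphere_mean n (mconst c * (upoly q (lform ?N X) * p))"
        using K(2)[OF polys_le_cmult[OF p] X] by (simp add: algebra_simps)
      then show "peval (K (mconst c * p)) X = peval (mconst c * K p) X"
        by (simp add: sphere_mean_cmult K(2)[OF p X])
    qed
  next
    fix p assume p: "p \<in> polys_le n d" "K p = 0"
    have "sup_norm n 0 = 0" using ball_nonempty by (simp add: sup_norm_def)
    then have "(1 - \<eta>) * sup_norm n p \<le> 0" using lower[OF p(1)] p(2) by simp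
    then have "sup_norm n p \<le> 0" using \<eta>(2) by (simp add: mult_le_0_iff)
    then show "p = 0" by (intro sup_norm_eq_0[OF pn[OF p(1)]])
  qed (use K(1) f in auto)
  show ?thesis
  proof (rule that[OF g(1)])
    show "sphere_mean n (upoly q (lform ?N X) * g) = peval f X" if "dot ?N X X = 1" for X
      using K(2)[OF g(1) that] g(2) by simp
    have "sup_norm n (g - f) = sup_norm n (K g - g)"
      unfolding g(2) sup_norm_def by (simp add: abs_minus_commute)
    also have "\<dots> \<le> \<eta> * sup_norm n g" by (rule dev[OF g(1)])
    also have "\<dots> \<le> \<eta> * (sup_norm n f / (1 - \<eta>))"
    proof (rule mult_left_mono)
      show "sup_norm n g \<le> sup_norm n f / (1 - \<eta>)" using lower[OF g(1)] g(2) \<eta>(2) by (simp add: field_simps)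
      have "zonal n (q * [:1, -1:]) \<ge> 0"
      proof (rule zonal_nonneg)
        fix t :: real assume "\<bar>t\<bar> \<le> 1"
        then show "poly (q * [:1, -1:]) t \<ge> 0"
          using mult_nonneg_nonneg[OF q(1)[of t], of "1 - t"] by (simp add: algebra_simps)
      qed
      then show "0 \<le> \<eta>" unfolding \<eta>(1) using q(3) by simp
    qed
    finally show "sup_norm n (g - f) \<le> \<eta> / (1 - \<eta>) * sup_norm n f" by simp
  qed
qed

section \<open>Sums of squares\<close>

text \<open>Only semidefinite: multiples of the equation of the sphere are null vectors. Hence
  residuals are shown to be null and not to be zero. The form occurs with a nonnegative weight
  \<open>g\<close> for sums of squares and with weight 1 for \<open>gamma\<close>.\<close>

locale psd_form =
  fixes N :: nat and B :: "mpoly \<Rightarrow> mpoly \<Rightarrow> real"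
  assumes sym: "B p q = B q p"
    and add: "p \<in> polys N \<Longrightarrow> q \<in> polys N \<Longrightarrow> r \<in> polys N \<Longrightarrow> B (p + q) r = B p r + B q r"
    and scale: "B (mconst c * p) q = c * B p q"
    and psd: "p \<in> polys N \<Longrightarrow> B p p \<ge> 0"
begin

lemma add_right: "p \<in> polys N \<Longrightarrow> q \<in> polys N \<Longrightarrow> r \<in> polys N \<Longrightarrow> B r (p + q) = B r p + B r q"
  by (subst (1 2 3) sym) (rule add)

lemma scale_right: "B q (mconst c * p) = c * B q p"
  by (subst (1 2) sym) (rule scale)

lemma zero: "B 0 q = 0"
  using scale[of 0 0 q] by simp

lemma sum_left:
  assumes "\<And>i. i \<in> A \<Longrightarrow> f i \<in> polys N" "q \<in> polys N"
  shows "B (\<Sum>i\<in>A. f i) q = (\<Sum>i\<in>A. B (f i) q)"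
  using assms by (induction A rule: infinite_finite_induct) (auto simp: zero add polys_sum)

lemma diff: "p \<in> polys N \<Longrightarrow> q \<in> polys N \<Longrightarrow> r \<in> polys N \<Longrightarrow> B (p - q) r = B p r - B q r"
  using add[of p "- q" r] scale[of "- 1" q r] by (simp add: polys_uminus mconst_uminus)

text \<open>The degenerate case of the Cauchy-Schwarz inequality; \<open>t\<close> is the value at
  which the quadratic would be -1.\<close>

lemma null:
  assumes r: "r \<in> polys N" "B r r = 0" and w: "w \<in> polys N"
  shows "B r w = 0"
proof (rule ccontr)
  assume nz: "B r w \<noteq> 0"
  define t where "t = - (B w w + 1) / (2 * B r w)"
  let ?v = "mconst t * r"
  have v: "?v \<in> polys N" using r by (intro polys_intros)
  have "B (w + ?v) (w + ?v) = B w (w + ?v) + B ?v (w + ?v)" by (rule add[OF w v polys_add[OF w v]])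
  also have "\<dots> = (B w w + B w ?v) + (B ?v w + B ?v ?v)"
    by (simp only: add_right[OF w v w] add_right[OF w v v])
  also have "\<dots> = B w w + 2 * t * B r w + t\<^sup>2 * B r r"
    by (simp only: scale scale_right sym[of w r]) (simp add: power2_eq_square)
  also have "\<dots> = - 1" using nz r by (simp add: t_def field_simps)
  finally show False using psd[of "w + ?v"] polys_add[OF w v] by simp
qed

definition proj :: "mpoly list \<Rightarrow> mpoly \<Rightarrow> mpoly" where
  "proj es v = (\<Sum>i<length es. mconst (B v (es ! i)) * es ! i)"

definition orthonormal :: "mpoly list \<Rightarrow> bool" where
  "orthonormal es \<longleftrightarrow> set es \<subseteq> polys N \<and>
     (\<forall>i<length es. \<forall>j<length es. B (es ! i) (es ! j) = (if i = j then 1 else 0))"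

lemma polys_proj: "set es \<subseteq> polys N \<Longrightarrow> proj es v \<in> polys N"
  unfolding proj_def by (intro polys_intros) auto

lemma proj_inner:
  assumes es: "set es \<subseteq> polys N" and q: "q \<in> polys N"
  shows "B (proj es v) q = (\<Sum>i<length es. B v (es ! i) * B (es ! i) q)"
  unfolding proj_def using assms by (subst sum_left) (auto simp: scale intro!: polys_mult)

lemma residual_orthogonal:
  assumes es: "orthonormal es" and v: "v \<in> polys N" and j: "j < length es"
  shows "B (v - proj es v) (es ! j) = 0"
proof -
  have s: "set es \<subseteq> polys N" using es by (simp add: orthonormal_def)
  have ej: "es ! j \<in> polys N" using s j by auto
  have "B (proj es v) (es ! j) = (\<Sum>i<length es. if i = j then B v (es ! i) else 0)"
    unfolding proj_inner[OF s ej] using es j by (intro sum.cong) (auto simp: orthonormal_def)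
  then show ?thesis using j by (simp add: diff[OF v polys_proj[OF s] ej])
qed

theorem gram_schmidt:
  assumes "set vs \<subseteq> polys N"
  obtains es where "orthonormal es" "length es \<le> length vs"
    "\<And>v. v \<in> set vs \<Longrightarrow> B (v - proj es v) (v - proj es v) = 0"
proof -
  have "\<exists>es. orthonormal es \<and> length es \<le> length vs \<and> (\<forall>v\<in>set vs. B (v - proj es v) (v - proj es v) = 0)"
    using assms
  proof (induction vs)
    case Nil
    show ?case by (intro exI[of _ "[]"]) (simp add: orthonormal_def)
  next
    case (Cons v vs)
    then obtain es where es: "orthonormal es" "length es \<le> length vs"
      "\<And>v. v \<in> set vs \<Longrightarrow> B (v - proj es v) (v - proj es v) = 0" by auto
    have s: "set es \<subseteq> polys N" using es(1) by (simp add: orthonormal_def)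
    have v: "v \<in> polys N" using Cons.prems by simp
    define w where "w = v - proj es v"
    have w: "w \<in> polys N" unfolding w_def by (intro polys_diff v polys_proj s)
    show ?case
    proof (cases "B w w = 0")
      \<comment> \<open>A vector that is null modulo the system so far is skipped, as it cannot be
        normalised.\<close>
      case True
      then show ?thesis using es by (intro exI[of _ es]) (auto simp: w_def)
    next
      case False
      define c where "c = sqrt (B w w)"
      have c: "c > 0" "c * c = B w w" using False psd[OF w] by (auto simp: c_def)
      define e where "e = mconst (1 / c) * w"
      have e: "e \<in> polys N" unfolding e_def by (intro polys_intros w)
      have eo: "B (es ! j) e = 0" "B e (es ! j) = 0" if "j < length es" for j
        using residual_orthogonal[OF es(1) v that] unfolding e_def w_def[symmetric]
        by (simp_all add: scale scale_right sym[of "es ! j" w])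
      have ee: "B e e = 1" unfolding e_def scale scale_right c(2)[symmetric] using c(1) by simp
      let ?es = "es @ [e]"
      have proj': "proj ?es x = proj es x + mconst (B x e) * e" for x
        unfolding proj_def by (simp add: nth_append)
      have on: "orthonormal ?es"
        using es(1) e eo ee unfolding orthonormal_def by (auto simp: nth_append less_Suc_eq)
      have pe: "B (proj es x) e = 0" for x
        unfolding proj_inner[OF s e] by (intro sum.neutral) (auto simp: eo)
      have "B (x - proj ?es x) (x - proj ?es x) = 0" if x: "x \<in> set (v # vs)" for x
      proof (cases "x = v")
        case True
        have "B v e = B w e + B (proj es v) e"
          using add[OF w polys_proj[OF s] e, of v] by (simp add: w_def)
        also have "B w e = c" unfolding e_def scale_right c(2)[symmetric] using c(1) by simp
        also have "c + B (proj es v) e = c" by (simp add: pe)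
        finally have "mconst (B v e) * e = w"
          unfolding e_def mult.assoc[symmetric] mconst_mult[symmetric] using c(1) by simp
        then have "v - proj ?es v = 0" by (simp add: proj' w_def algebra_simps)
        then show ?thesis using True by (simp add: zero)
      next
        case False
        then have "x \<in> set vs" using x by simp
        then have xp: "x \<in> polys N" and xr: "B (x - proj es x) (x - proj es x) = 0"
          using Cons.prems es(3) by auto
        have rp: "x - proj es x \<in> polys N" by (intro polys_diff xp polys_proj s)
        have "B x e = B (x - proj es x) e + B (proj es x) e"
          using add[OF rp polys_proj[OF s] e, of x] by simp
        also have "\<dots> = 0" by (simp add: pe null[OF rp xr e])
        finally show ?thesis using xr by (simp add: proj')
      qed
      then show ?thesis using on es(2) by (intro exI[of _ ?es]) auto
    qed
  qed
  then obtain es where "orthonormal es \<and> length es \<le> length vs \<and> (\<forall>v\<in>set vs. B (v - proj es v) (v - proj es v) = 0)"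
    by (rule exE)
  then show ?thesis by (intro that[of es]) simp_all
qed

text \<open>Projection is linear, so the residual of a combination is the combination of null
  residuals. Parseval's identity therefore holds for \<open>F\<close> even if \<open>F\<close> lies
  outside the span of \<open>es\<close>.\<close>

lemma residual_null_span:
  assumes es: "orthonormal es" and vs: "\<And>j. j \<in> J \<Longrightarrow> v j \<in> polys N"
    and null_v: "\<And>j. j \<in> J \<Longrightarrow> B (v j - proj es (v j)) (v j - proj es (v j)) = 0"
    and F: "F = (\<Sum>j\<in>J. mconst (c j) * v j)"
  shows "F - proj es F = (\<Sum>j\<in>J. mconst (c j) * (v j - proj es (v j)))"
    and "B F F = (\<Sum>i<length es. (B F (es ! i))\<^sup>2)"
proof -
  have s: "set es \<subseteq> polys N" using es by (simp add: orthonormal_def)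
  have "proj es F = (\<Sum>j\<in>J. mconst (c j) * proj es (v j))"
  proof -
    have BF: "B F (es ! i) = (\<Sum>j\<in>J. c j * B (v j) (es ! i))" if "i < length es" for i
    proof -
      have ei: "es ! i \<in> polys N" using s that by auto
      have "B F (es ! i) = (\<Sum>j\<in>J. B (mconst (c j) * v j) (es ! i))"
        unfolding F by (rule sum_left[OF polys_mult[OF polys_mconst vs] ei])
      then show ?thesis by (simp only: scale)
    qed
    have "proj es F = (\<Sum>i<length es. \<Sum>j\<in>J. mconst (c j) * (mconst (B (v j) (es ! i)) * es ! i))"
      unfolding proj_def
    proof (intro sum.cong refl)
      fix i assume "i \<in> {..<length es}"
      then have "mconst (B F (es ! i)) * es ! i = mconst (\<Sum>j\<in>J. c j * B (v j) (es ! i)) * es ! i"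
        by (simp only: BF lessThan_iff)
      then show "mconst (B F (es ! i)) * es ! i = (\<Sum>j\<in>J. mconst (c j) * (mconst (B (v j) (es ! i)) * es ! i))"
        by (simp only: mconst_sum mconst_mult sum_distrib_right mult.assoc)
    qed
    also have "\<dots> = (\<Sum>j\<in>J. mconst (c j) * proj es (v j))"
      by (subst sum.swap) (simp add: proj_def sum_distrib_left)
    finally show ?thesis .
  qed
  then show r: "F - proj es F = (\<Sum>j\<in>J. mconst (c j) * (v j - proj es (v j)))"
    by (simp add: F sum_subtractf right_diff_distrib)
  have Fp: "F \<in> polys N" unfolding F by (intro polys_intros vs)
  have rj: "v j - proj es (v j) \<in> polys N" if "j \<in> J" for j by (intro polys_diff vs that polys_proj s)
  have "B (F - proj es F) F = (\<Sum>j\<in>J. c j * B (v j - proj es (v j)) F)"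
    unfolding r using Fp rj by (subst sum_left) (auto simp: scale intro!: polys_mult)
  also have "\<dots> = 0" using null[OF rj null_v Fp] by (intro sum.neutral) auto
  finally have "B F F = B (proj es F) F" by (simp add: diff[OF Fp polys_proj[OF s] Fp])
  also have "\<dots> = (\<Sum>i<length es. (B F (es ! i))\<^sup>2)"
    unfolding proj_inner[OF s Fp] by (simp add: power2_eq_square sym[of _ F])
  finally show "B F F = (\<Sum>i<length es. (B F (es ! i))\<^sup>2)" .
qed

end

lemma psd_form_sphere:
  assumes g: "g \<in> polys (Suc n)" and pos: "\<And>y. dot (Suc n) y y = 1 \<Longrightarrow> peval g y \<ge> 0"
  shows "psd_form (Suc n) (\<lambda>p q. sphere_mean n (p * q * g))"
proof
  show "sphere_mean n (p * q * g) = sphere_mean n (q * p * g)" for p q by (simp add: mult.commute)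
  show "sphere_mean n ((p + q) * r * g) = sphere_mean n (p * r * g) + sphere_mean n (q * r * g)"
    if "p \<in> polys (Suc n)" "q \<in> polys (Suc n)" "r \<in> polys (Suc n)" for p q r
    using that g by (simp add: distrib_right sphere_mean_add polys_mult)
  show "sphere_mean n (mconst c * p * q * g) = c * sphere_mean n (p * q * g)" for c p q
    by (simp add: mult.assoc sphere_mean_cmult)
  show "sphere_mean n (p * p * g) \<ge> 0" for p
    by (intro sphere_mean_nonneg) (simp add: pos)
qed

text \<open>Polynomials in \<open>x\<close> and \<open>y\<close> of degree at most \<open>k\<close> in \<open>x\<close>; here \<open>y\<close> has one coordinate more than \<open>x\<close>.\<close>

definition biform :: "nat \<Rightarrow> nat \<Rightarrow> ((nat \<Rightarrow> real) \<Rightarrow> (nat \<Rightarrow> real) \<Rightarrow> real) \<Rightarrow> bool" where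
  "biform n k F \<longleftrightarrow> (\<exists>L. (\<forall>(p, q)\<in>set L. p \<in> polys_le n k \<and> q \<in> polys (Suc n)) \<and>
     (\<forall>x y. F x y = (\<Sum>(p, q)\<leftarrow>L. peval p x * peval q y)))"

lemma biform_product: "p \<in> polys_le n k \<Longrightarrow> q \<in> polys (Suc n) \<Longrightarrow> biform n k (\<lambda>x y. peval p x * peval q y)"
  unfolding biform_def by (intro exI[of _ "[(p, q)]"]) simp

lemma biform_add:
  assumes "biform n k F" "biform n k G"
  shows "biform n k (\<lambda>x y. F x y + G x y)"
proof -
  from assms obtain L M where "\<forall>(p, q)\<in>set L. p \<in> polys_le n k \<and> q \<in> polys (Suc n)"
    "\<forall>x y. F x y = (\<Sum>(p, q)\<leftarrow>L. peval p x * peval q y)"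
    "\<forall>(p, q)\<in>set M. p \<in> polys_le n k \<and> q \<in> polys (Suc n)"
    "\<forall>x y. G x y = (\<Sum>(p, q)\<leftarrow>M. peval p x * peval q y)" unfolding biform_def by blast
  then show ?thesis unfolding biform_def by (intro exI[of _ "L @ M"]) auto
qed

lemma biform_0: "biform n k (\<lambda>x y. 0)"
  unfolding biform_def by (intro exI[of _ "[]"]) simp

lemma biform_sum: "(\<And>i. i \<in> A \<Longrightarrow> biform n k (F i)) \<Longrightarrow> biform n k (\<lambda>x y. \<Sum>i\<in>A. F i x y)"
  by (induction A rule: infinite_finite_induct) (auto intro: biform_add simp: biform_0)

lemma biform_mult:
  assumes F: "biform n k F" and p: "p \<in> polys_le n l" and q: "q \<in> polys (Suc n)"
  shows "biform n (l + k) (\<lambda>x y. peval p x * peval q y * F x y)"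
proof -
  from F obtain L where L: "\<forall>(p, q)\<in>set L. p \<in> polys_le n k \<and> q \<in> polys (Suc n)"
    "\<forall>x y. F x y = (\<Sum>(p, q)\<leftarrow>L. peval p x * peval q y)" unfolding biform_def by blast
  have "\<forall>(p', q')\<in>set (map (\<lambda>(p', q'). (p * p', q * q')) L). p' \<in> polys_le n (l + k) \<and> q' \<in> polys (Suc n)"
    using L(1) p q by (auto intro: polys_le_mult polys_mult)
  moreover have "peval p x * peval q y * F x y = (\<Sum>(p', q')\<leftarrow>map (\<lambda>(p', q'). (p * p', q * q')) L. peval p' x * peval q' y)" for x y
  proof -
    have "(\<Sum>(p', q')\<leftarrow>map (\<lambda>(p', q'). (p * p', q * q')) M. peval p' x * peval q' y)
        = peval p x * peval q y * (\<Sum>(p', q')\<leftarrow>M. peval p' x * peval q' y)" for M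
      by (induction M) (auto simp: algebra_simps)
    then show ?thesis using L(2) by simp
  qed
  ultimately show ?thesis unfolding biform_def by blast
qed

lemma biform_mono: "biform n k F \<Longrightarrow> k \<le> k' \<Longrightarrow> biform n k' F"
  unfolding biform_def by (force elim: polys_le_mono)

lemma biform_dot:
  assumes "biform n k F" shows "biform n (Suc k) (\<lambda>x y. dot n x y * F x y)"
proof -
  have "biform n (1 + k) (\<lambda>x y. \<Sum>i<n. peval (mvar i) x * peval (mvar i) y * F x y)"
    by (intro biform_sum biform_mult assms polys_le_mvar polys_mvar) auto
  then show ?thesis by (simp add: dot_def sum_distrib_right)
qed

lemma peval_ball_poly [simp]: "peval (ball_poly n) x = 1 - dot n x x"
  by (simp add: ball_poly_def dot_self)

lemma polys_le_ball_poly: "ball_poly n \<in> polys_le n 2"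
proof -
  have "(mvar i)\<^sup>2 \<in> polys_le n 2" if "i < n" for i
    using polys_le_power[OF polys_le_mvar[OF that order_refl], of 2] by simp
  then show ?thesis unfolding ball_poly_def by (intro polys_le_diff polys_le_sum) auto
qed

text \<open>\<open>s\<close> stands for the last coordinate of either lift. Replacing
  \<open>s^2\<close> by \<open>1 - dot n x x\<close> leaves a part free of \<open>s\<close> and a
  part linear in \<open>s\<close>, whose cofactor has one degree less in \<open>x\<close>; after
  squaring, this makes room for \<open>ball_poly n\<close> in the truncation.\<close>

lemma power_split:
  obtains A B where "biform n (Suc k) A" "biform n k B"
    "\<And>x s y. s\<^sup>2 = 1 - dot n x x \<Longrightarrow> (dot n x y + s * y n) ^ Suc k = A x y + s * B x y"
proof -
  have "\<exists>A B. biform n (Suc k) A \<and> biform n k B \<and>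
    (\<forall>x s y. s\<^sup>2 = 1 - dot n x x \<longrightarrow> (dot n x y + s * y n) ^ Suc k = A x y + s * B x y)"
  proof (induction k)
    case 0
    have "biform n (Suc 0) (\<lambda>x y. dot n x y * (peval 1 x * peval 1 y))"
      by (intro biform_dot biform_product) auto
    moreover have "biform n 0 (\<lambda>x y. peval 1 x * peval (mvar n) y)"
      by (intro biform_product polys_mvar) auto
    ultimately show ?case
      by (intro exI[of _ "\<lambda>x y. dot n x y * (peval 1 x * peval 1 y)"] exI[of _ "\<lambda>x y. peval 1 x * peval (mvar n) y"]) simp
  next
    case (Suc k)
    then obtain A B where AB: "biform n (Suc k) A" "biform n k B"
      "\<And>x s y. s\<^sup>2 = 1 - dot n x x \<Longrightarrow> (dot n x y + s * y n) ^ Suc k = A x y + s * B x y" by blast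
    let ?A = "\<lambda>x y. dot n x y * A x y + peval (ball_poly n) x * peval (mvar n) y * B x y"
    let ?B = "\<lambda>x y. dot n x y * B x y + peval 1 x * peval (mvar n) y * A x y"
    have "biform n (2 + k) (\<lambda>x y. peval (ball_poly n) x * peval (mvar n) y * B x y)"
      by (intro biform_mult AB polys_le_ball_poly polys_mvar) simp
    then have "biform n (Suc (Suc k)) ?A" by (intro biform_add biform_dot AB) simp
    moreover have "biform n (Suc k) ?B"
      using biform_mult[OF AB(1), of 1 0 "mvar n"] by (intro biform_add biform_dot AB) (simp add: polys_mvar)
    moreover have "(dot n x y + s * y n) ^ Suc (Suc k) = ?A x y + s * ?B x y" if s: "s\<^sup>2 = 1 - dot n x x" for x s y
    proof -
      have "(dot n x y + s * y n) ^ Suc (Suc k) = (dot n x y + s * y n) * (A x y + s * B x y)"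
        by (simp only: power_Suc[of _ "Suc k"] AB(3)[OF s])
      also have "\<dots> = dot n x y * A x y + s\<^sup>2 * y n * B x y + s * (dot n x y * B x y + y n * A x y)"
        by (simp add: algebra_simps power2_eq_square)
      finally show ?thesis unfolding s by simp
    qed
    ultimately show ?case by blast
  qed
  then show ?thesis using that by blast
qed

lemma poly_split:
  fixes u :: "real poly"
  assumes u: "degree u \<le> Suc r"
  obtains A B where "biform n (Suc r) A" "biform n r B"
    "\<And>x s y. s\<^sup>2 = 1 - dot n x x \<Longrightarrow> poly u (dot n x y + s * y n) = A x y + s * B x y"
proof -
  have one: "biform n k (\<lambda>x y. 1)" for k
    using biform_product[of 1 n k 1] by simp
  have "\<forall>k. \<exists>AB. k \<le> Suc r \<longrightarrow> biform n (Suc r) (fst AB) \<and> biform n r (snd AB) \<and>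
    (\<forall>x s y. s\<^sup>2 = 1 - dot n x x \<longrightarrow> (dot n x y + s * y n) ^ k = fst AB x y + s * snd AB x y)"
  proof
    fix k
    show "\<exists>AB. k \<le> Suc r \<longrightarrow> biform n (Suc r) (fst AB) \<and> biform n r (snd AB) \<and>
      (\<forall>x s y. s\<^sup>2 = 1 - dot n x x \<longrightarrow> (dot n x y + s * y n) ^ k = fst AB x y + s * snd AB x y)"
    proof (cases k)
      case 0
      then show ?thesis by (intro exI[of _ "(\<lambda>x y. 1, \<lambda>x y. 0)"]) (simp add: one biform_0)
    next
      case (Suc j)
      obtain A B where "biform n (Suc j) A" "biform n j B"
        "\<And>x s y. s\<^sup>2 = 1 - dot n x x \<Longrightarrow> (dot n x y + s * y n) ^ Suc j = A x y + s * B x y"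
        using power_split[of n j] by blast
      then show ?thesis by (intro exI[of _ "(A, B)"]) (auto simp: Suc intro: biform_mono)
    qed
  qed
  from choice[OF this] obtain AB where AB: "\<And>k. k \<le> Suc r \<Longrightarrow> biform n (Suc r) (fst (AB k))"
    "\<And>k. k \<le> Suc r \<Longrightarrow> biform n r (snd (AB k))"
    "\<And>k x s y. k \<le> Suc r \<Longrightarrow> s\<^sup>2 = 1 - dot n x x \<Longrightarrow> (dot n x y + s * y n) ^ k = fst (AB k) x y + s * snd (AB k) x y"
    by blast
  have sc: "biform n k (\<lambda>x y. c * F x y)" if "biform n k F" for k c F
    using biform_mult[OF that, of "mconst c" 0 1] by simp
  show ?thesis
  proof (rule that[of "\<lambda>x y. \<Sum>k\<le>degree u. coeff u k * fst (AB k) x y" "\<lambda>x y. \<Sum>k\<le>degree u. coeff u k * snd (AB k) x y"])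
    show "biform n (Suc r) (\<lambda>x y. \<Sum>k\<le>degree u. coeff u k * fst (AB k) x y)"
      "biform n r (\<lambda>x y. \<Sum>k\<le>degree u. coeff u k * snd (AB k) x y)"
      using u by (auto intro!: biform_sum sc AB)
    fix x s y assume s: "s\<^sup>2 = 1 - dot n x x"
    show "poly u (dot n x y + s * y n) = (\<Sum>k\<le>degree u. coeff u k * fst (AB k) x y) + s * (\<Sum>k\<le>degree u. coeff u k * snd (AB k) x y)"
      unfolding poly_altdef sum_distrib_left sum.distrib[symmetric]
      using u by (intro sum.cong refl) (subst AB(3)[OF _ s], auto simp: algebra_simps)
  qed
qed

text \<open>An orthonormal system for the second factors diagonalises their Gram matrix.\<close>

theorem sos_average:
  assumes F: "biform n k F" and g: "g \<in> polys (Suc n)" and pos: "\<And>y. dot (Suc n) y y = 1 \<Longrightarrow> peval g y \<ge> 0"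
  obtains \<sigma> G where "\<sigma> \<in> sos n" "\<sigma> \<in> polys_le n (2 * k)" "\<And>x. G x \<in> polys (Suc n)"
    "\<And>x y. peval (G x) y = F x y" "\<And>x. sphere_mean n (G x * G x * g) = peval \<sigma> x"
proof -
  interpret psd_form "Suc n" "\<lambda>p q. sphere_mean n (p * q * g)" by (rule psd_form_sphere[OF g pos])
  from F obtain L where L: "\<forall>(p, q)\<in>set L. p \<in> polys_le n k \<and> q \<in> polys (Suc n)"
    "\<forall>x y. F x y = (\<Sum>(p, q)\<leftarrow>L. peval p x * peval q y)" unfolding biform_def by blast
  define p where "p j = fst (L ! j)" for j
  define q where "q j = snd (L ! j)" for j
  have pq: "p j \<in> polys_le n k" "q j \<in> polys (Suc n)" if "j < length L" for j
    using L(1) nth_mem[OF that] by (auto simp: p_def q_def case_prod_beta)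
  have Fsum: "F x y = (\<Sum>j<length L. peval (p j) x * peval (q j) y)" for x y
    using L(2) by (simp add: sum_list_sum_nth p_def q_def case_prod_beta atLeast0LessThan)
  obtain es where es: "orthonormal es" "length es \<le> length (map snd L)"
    "\<And>v. v \<in> set (map snd L) \<Longrightarrow> sphere_mean n ((v - proj es v) * (v - proj es v) * g) = 0"
    by (rule gram_schmidt[of "map snd L"]) (use L(1) in auto)
  have s: "set es \<subseteq> polys (Suc n)" using es(1) by (simp add: orthonormal_def)
  define G where "G x = (\<Sum>j<length L. mconst (peval (p j) x) * q j)" for x
  \<comment> \<open>\<open>R i\<close> is the \<open>i\<close>-th coordinate of \<open>G x\<close>
    in the orthonormal system, as a polynomial in \<open>x\<close>. The weighted mean of the square
    of \<open>G x\<close> is the sum of the squares of these coordinates.\<close>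
  define R where "R i = (\<Sum>j<length L. mconst (sphere_mean n (q j * es ! i * g)) * p j)" for i
  have R: "R i \<in> polys_le n k" for i unfolding R_def by (intro polys_le_sum polys_le_cmult pq) auto
  have RG: "sphere_mean n (G x * es ! i * g) = peval (R i) x" if "i < length es" for i x
  proof -
    have ei: "es ! i \<in> polys (Suc n)" using s that by auto
    have "sphere_mean n (G x * es ! i * g) = (\<Sum>j<length L. sphere_mean n (mconst (peval (p j) x) * q j * es ! i * g))"
      unfolding G_def by (rule sum_left[OF polys_mult[OF polys_mconst pq(2)] ei]) simp
    also have "\<dots> = (\<Sum>j<length L. peval (p j) x * sphere_mean n (q j * es ! i * g))"
      by (simp only: scale)
    also have "\<dots> = peval (R i) x" by (simp add: R_def mult.commute)
    finally show ?thesis .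
  qed
  define \<sigma> where "\<sigma> = (\<Sum>i<length es. (R i)\<^sup>2)"
  show ?thesis
  proof (rule that[of \<sigma> G])
    show "\<sigma> \<in> sos n" unfolding \<sigma>_def sos_def using polys_le_imp_polys[OF R] by blast
    show "\<sigma> \<in> polys_le n (2 * k)" unfolding \<sigma>_def by (intro polys_le_sum polys_le_power R)
    show "G x \<in> polys (Suc n)" for x unfolding G_def by (intro polys_intros pq) auto
    show "peval (G x) y = F x y" for x y by (simp add: G_def Fsum)
    show "sphere_mean n (G x * G x * g) = peval \<sigma> x" for x
    proof -
      have "sphere_mean n (G x * G x * g) = (\<Sum>i<length es. (sphere_mean n (G x * es ! i * g))\<^sup>2)"
        by (rule residual_null_span(2)[OF es(1) _ _ G_def, of x]) (use pq es(3) in \<open>auto simp: q_def\<close>)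
      also have "\<dots> = peval \<sigma> x" unfolding \<sigma>_def by (simp add: RG)
      finally show ?thesis .
    qed
  qed
qed

text \<open>Adding the kernels of both lifts of \<open>x\<close> turns
  \<open>(A + s * B)^2 + (A - s * B)^2\<close> into \<open>2 * A^2 + 2 * s^2 * B^2\<close>. Averaged
  against \<open>g\<close>, the two squares become sums of squares in \<open>x\<close>, and
  \<open>s^2\<close> becomes the factor \<open>ball_poly n\<close>.\<close>

theorem kernel_average_in_preordering:
  fixes u :: "real poly"
  assumes u: "degree u \<le> r" and r: "r \<ge> 1" and g: "g \<in> polys n"
    and pos: "\<And>x. x \<in> unit_ball n \<Longrightarrow> peval g x \<ge> 0"
    and f: "f \<in> polys n" and avg: "\<And>X. dot (Suc n) X X = 1 \<Longrightarrow> sphere_mean n (upoly (u\<^sup>2) (lform (Suc n) X) * g) = peval f X"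
  shows "f \<in> preordering n (2 * r)"
proof -
  let ?N = "Suc n"
  obtain r' where r': "r = Suc r'" using r by (cases r) auto
  have gN: "g \<in> polys ?N" using g by (rule polys_mono) simp
  have posN: "peval g y \<ge> 0" if "dot ?N y y = 1" for y
    using pos[OF sphere_restrict_ball[OF that]] by (simp add: peval_restrict[OF g])
  obtain A B where AB: "biform n (Suc r') A" "biform n r' B"
    "\<And>x s y. s\<^sup>2 = 1 - dot n x x \<Longrightarrow> poly u (dot n x y + s * y n) = A x y + s * B x y"
    using poly_split[of u r' n] u r' by metis
  obtain \<sigma>0 G0 where 0: "\<sigma>0 \<in> sos n" "\<sigma>0 \<in> polys_le n (2 * r)" "\<And>x. G0 x \<in> polys ?N"
    "\<And>x y. peval (G0 x) y = A x y" "\<And>x. sphere_mean n (G0 x * G0 x * g) = peval \<sigma>0 x"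
    using sos_average[OF AB(1) gN posN] unfolding r' by metis
  obtain \<sigma>1 G1 where 1: "\<sigma>1 \<in> sos n" "\<sigma>1 \<in> polys_le n (2 * r')" "\<And>x. G1 x \<in> polys ?N"
    "\<And>x y. peval (G1 x) y = B x y" "\<And>x. sphere_mean n (G1 x * G1 x * g) = peval \<sigma>1 x"
    using sos_average[OF AB(2) gN posN] by metis
  have "peval f x = peval (\<sigma>0 + \<sigma>1 * ball_poly n) x" if x: "x \<in> unit_ball n" for x
  proof -
    let ?s = "hgt n x"
    have s: "?s\<^sup>2 = 1 - dot n x x" "(- ?s)\<^sup>2 = 1 - dot n x x"
      using x by (simp_all add: hgt_def unit_ball_iff)
    have du: "dot ?N (up n x) y = dot n x y + ?s * y n" "dot ?N (dn n x) y = dot n x y + (- ?s) * y n" for y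
    proof -
      have "dot n (up n x) y = dot n x y" "dot n (dn n x) y = dot n x y" by (intro dot_cong; simp add: up_def dn_def)+
      then show "dot ?N (up n x) y = dot n x y + ?s * y n" "dot ?N (dn n x) y = dot n x y + (- ?s) * y n"
        by (simp_all add: dot_Suc, simp_all add: up_def dn_def)
    qed
    let ?U = "upoly (u\<^sup>2) (lform ?N (up n x)) * g" and ?D = "upoly (u\<^sup>2) (lform ?N (dn n x)) * g"
    have UD: "?U \<in> polys ?N" "?D \<in> polys ?N" by (intro polys_mult polys_zonal gN)+
    \<comment> \<open>\<open>g\<close> ignores the last coordinate, so the reflection carries one
      kernel into the other and both lifts give the same average.\<close>
    have "sphere_mean n ?D = sphere_mean n ?U"
    proof (rule sphere_mean_reflect[OF UD])
      fix y
      have "dot n x (y(n := - y n)) = dot n x y" by (intro dot_cong) auto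
      moreover have "peval g (y(n := - y n)) = peval g y" by (intro peval_cong[OF g]) auto
      ultimately show "peval ?D y = peval ?U (y(n := - y n))" by (simp add: du)
    qed
    then have "2 * sphere_mean n ?U = sphere_mean n (?U + ?D)" by (simp add: sphere_mean_add UD)
    also have "\<dots> = sphere_mean n (mconst 2 * (G0 x * G0 x * g) + mconst (2 * (1 - dot n x x)) * (G1 x * G1 x * g))"
    proof (rule sphere_mean_cong)
      fix y
      have "poly (u\<^sup>2) (dot ?N (up n x) y) + poly (u\<^sup>2) (dot ?N (dn n x) y) = (A x y + ?s * B x y)\<^sup>2 + (A x y + (- ?s) * B x y)\<^sup>2"
        unfolding du poly_power AB(3)[OF s(1)] AB(3)[OF s(2)] ..
      also have "\<dots> = 2 * (A x y * A x y) + 2 * ?s\<^sup>2 * (B x y * B x y)"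
        by (simp add: power2_eq_square algebra_simps)
      finally have "poly (u\<^sup>2) (dot ?N (up n x) y) + poly (u\<^sup>2) (dot ?N (dn n x) y) = 2 * (A x y * A x y) + 2 * (1 - dot n x x) * (B x y * B x y)"
        unfolding s(1) .
      then show "peval (?U + ?D) y = peval (mconst 2 * (G0 x * G0 x * g) + mconst (2 * (1 - dot n x x)) * (G1 x * G1 x * g)) y"
        by (simp only: peval_add peval_mult peval_mconst peval_upoly peval_lform 0 1 distrib_right[symmetric] mult.assoc[symmetric])
    qed (intro polys_intros gN polys_zonal 0 1)+
    also have "\<dots> = 2 * peval \<sigma>0 x + 2 * (1 - dot n x x) * peval \<sigma>1 x"
      by (subst sphere_mean_add) (intro polys_intros gN 0 1, intro polys_intros gN 0 1, simp only: sphere_mean_cmult 0 1)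
    finally have "sphere_mean n ?U = peval \<sigma>0 x + (1 - dot n x x) * peval \<sigma>1 x" by (simp add: algebra_simps)
    then show ?thesis using avg[OF ball_sphere_up[OF x]] by (simp add: peval_up[OF f])
  qed
  moreover have s1: "\<sigma>1 * ball_poly n \<in> polys_le n (2 * r)"
    using polys_le_mult[OF 1(2) polys_le_ball_poly] by (simp add: r')
  ultimately have "f - (\<sigma>0 + \<sigma>1 * ball_poly n) = 0"
    by (intro polys_zero_on_ball[of _ n] polys_diff polys_add f polys_le_imp_polys[OF 0(2)] polys_le_imp_polys[OF s1]) simp_all
  then have "f = \<sigma>0 + \<sigma>1 * ball_poly n" by simp
  moreover have "total_degree \<sigma>0 \<le> 2 * r" "total_degree (\<sigma>1 * ball_poly n) \<le> 2 * r"
    using 0(2) s1 by (simp_all add: polys_le_def)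
  ultimately show ?thesis
    unfolding preordering_def using 0(1) 1(1) by blast
qed

section \<open>The lower bound and the constant gamma\<close>

text \<open>The constant polynomial 1 is its own component of degree 0.\<close>

lemma gamma_ge_1: "gamma n d \<ge> 1"
proof -
  let ?P = "\<lambda>k :: nat. if k = 0 then 1 else 0 :: mpoly"
  have "?P k \<in> H_space n k" for k
    by (simp add: H_space_def ball_inner_def)
  then have "decomposes n d 1 ?P" unfolding decomposes_def by simp
  moreover have "sup_norm n 1 = 1" using ball_nonempty by (simp add: sup_norm_def)
  ultimately have "ereal (sup_norm n (?P 0) / sup_norm n 1) \<le> gamma n d"
    unfolding gamma_def by (intro Sup_upper) (auto intro!: exI[of _ "1 :: mpoly"] exI[of _ ?P] exI[of _ "0 :: nat"])
  then show ?thesis using \<open>sup_norm n 1 = 1\<close> by (simp add: one_ereal_def)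
qed

text \<open>Machin's formula, with the smaller arctangent dropped and the larger one bounded by its
  argument.\<close>

lemma pi_le: "pi \<le> 16 / 5"
proof -
  have "arctan (1 / 5) \<le> 1 / 5" by (rule arctan_le_self) simp
  moreover have "arctan (1 / 239) \<ge> 0" by simp
  ultimately show ?thesis using machin by linarith
qed

lemma pi_square_bound: "sqrt 2 * pi\<^sup>2 \<le> 16"
proof -
  have "sqrt 2 \<le> 3 / 2" by (rule real_le_lsqrt) (auto simp: power2_eq_square)
  have "pi\<^sup>2 \<le> (16 / 5)\<^sup>2" using pi_le by (intro power_mono) auto
  then have "sqrt 2 * pi\<^sup>2 \<le> 3 / 2 * (16 / 5)\<^sup>2" using \<open>sqrt 2 \<le> 3 / 2\<close> by (intro mult_mono) auto
  also have "\<dots> \<le> 16" by (simp add: power2_eq_square)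
  finally show ?thesis .
qed

theorem lower_bound_error:
  assumes n: "n \<ge> 1" and d: "d \<ge> 1" and f: "f \<in> polys_le n d"
    and r: "real r \<ge> 2 * real n * real d * sqrt (real d)"
  obtains \<epsilon> where "f - mconst (fmin n f - \<epsilon>) \<in> preordering n (2 * r)"
    "\<epsilon> \<le> 2 * (real n)\<^sup>2 * real d ^ 3 / (real r)\<^sup>2 * (fmax n f - fmin n f)"
proof -
  define x where "x = (real n)\<^sup>2 * real d ^ 3 / (real r)\<^sup>2"
  have "2 * real n * real d * sqrt (real d) > 0" using n d by simp
  then have r0: "real r > 0" using r by linarith
  then have r1: "r \<ge> 1" by simp
  have "(2 * real n * real d * sqrt (real d))\<^sup>2 \<le> (real r)\<^sup>2" using r by (intro power_mono) auto
  moreover have "(2 * real n * real d * sqrt (real d))\<^sup>2 = 4 * ((real n)\<^sup>2 * real d ^ 3)"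
    by (simp add: power_mult_distrib) (simp add: power2_eq_square power3_eq_cube)
  ultimately have "4 * ((real n)\<^sup>2 * real d ^ 3) \<le> (real r)\<^sup>2" by simp
  then have x4: "x \<le> 1 / 4" using r0 by (simp add: x_def field_simps)
  have x0: "x \<ge> 0" by (simp add: x_def)
  obtain u :: "real poly" where u: "degree u \<le> r" "zonal n (u\<^sup>2) = 1"
    "zonal n (u\<^sup>2 * [:1, -1:]) \<le> (real n)\<^sup>2 * pi\<^sup>2 / (8 * (real r)\<^sup>2)"
    using extremal_kernel[OF n r1] .
  define \<delta> where "\<delta> = (real n)\<^sup>2 * pi\<^sup>2 / (8 * (real r)\<^sup>2)"
  define \<eta> where "\<eta> = sqrt 2 * real d ^ 3 * \<delta>"
  have "\<eta> = (sqrt 2 * pi\<^sup>2) * (x / 8)" by (simp add: \<eta>_def \<delta>_def x_def mult_ac)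
  also have "\<dots> \<le> 16 * (x / 8)" using x0 by (intro mult_right_mono pi_square_bound) simp
  finally have \<eta>: "\<eta> \<le> 2 * x" by simp
  have \<eta>0: "\<eta> \<ge> 0" by (simp add: \<eta>_def \<delta>_def)
  have fn: "f \<in> polys n" using f by (rule polys_le_imp_polys)
  define D where "D = fmax n f - fmin n f"
  define c where "c = (fmax n f + fmin n f) / 2"
  define h where "h = f - mconst c"
  have h: "h \<in> polys_le n d" unfolding h_def by (intro polys_le_diff f polys_le_mconst)
  have hs: "sup_norm n h \<le> D / 2"
  proof (rule sup_norm_least)
    fix z assume "z \<in> unit_ball n"
    then show "\<bar>peval h z\<bar> \<le> D / 2"
      using fmin_le[OF fn] fmax_ge[OF fn] by (fastforce simp: h_def c_def D_def abs_le_iff field_simps)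
  qed
  obtain g where g: "g \<in> polys_le n d" "sup_norm n (g - h) \<le> \<eta> / (1 - \<eta>) * sup_norm n h"
    "\<And>X. dot (Suc n) X X = 1 \<Longrightarrow> sphere_mean n (upoly (u\<^sup>2) (lform (Suc n) X) * g) = peval h X"
    using kernel_inverse[OF n d h, of "u\<^sup>2" \<delta> \<eta>] u \<eta> x4 by (auto simp: \<delta>_def[symmetric] \<eta>_def[symmetric] poly_power)
  define \<epsilon> where "\<epsilon> = \<eta> / (1 - \<eta>) * (D / 2)"
  have \<eta>1: "\<eta> \<le> 1 / 2" using \<eta> x4 by simp
  have gh: "sup_norm n (g - h) \<le> \<epsilon>"
    unfolding \<epsilon>_def using g(2) hs \<eta>0 \<eta>1 by (elim order_trans) (intro mult_left_mono, auto)
  have D0: "D \<ge> 0" using hs sup_norm_nonneg[OF polys_le_imp_polys[OF h]] by linarith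
  \<comment> \<open>This shift is what the bounds on \<open>h\<close> and \<open>g - h\<close> ask
    for to make \<open>g\<close> nonnegative. Constants are fixed by the averaging, so it turns the
    average \<open>h\<close> into \<open>f - fmin + \<epsilon>\<close>.\<close>
  let ?G = "g + mconst (D / 2 + \<epsilon>)"
  have gn: "g \<in> polys n" using g(1) by (rule polys_le_imp_polys)
  have hn: "h \<in> polys n" using h by (rule polys_le_imp_polys)
  have gN: "g \<in> polys (Suc n)" using gn by (rule polys_mono) simp
  have "f - mconst (fmin n f - \<epsilon>) \<in> preordering n (2 * r)"
  proof (rule kernel_average_in_preordering[OF u(1) r1, of ?G])
    show "?G \<in> polys n" by (intro polys_add gn polys_mconst)
    show "f - mconst (fmin n f - \<epsilon>) \<in> polys n" by (intro polys_diff fn polys_mconst)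
    fix z assume z: "z \<in> unit_ball n"
    have "\<bar>peval (g - h) z\<bar> \<le> \<epsilon>" using sup_norm_upper[OF polys_diff[OF gn hn] z] gh by linarith
    moreover have "\<bar>peval h z\<bar> \<le> D / 2" using sup_norm_upper[OF hn z] hs by linarith
    ultimately have "- \<epsilon> \<le> peval g z - peval h z" "- (D / 2) \<le> peval h z"
      unfolding abs_le_iff by simp_all
    then show "peval ?G z \<ge> 0" by simp
  next
    fix X assume X: "dot (Suc n) X X = 1"
    let ?q = "upoly (u\<^sup>2) (lform (Suc n) X)"
    have "?q * ?G = ?q * g + mconst (D / 2 + \<epsilon>) * ?q" by (simp add: algebra_simps)
    then have "sphere_mean n (?q * ?G) = sphere_mean n (?q * g) + (D / 2 + \<epsilon>) * sphere_mean n ?q"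
      by (simp only: sphere_mean_add[OF polys_mult[OF polys_zonal gN] polys_mult[OF polys_mconst polys_zonal]] sphere_mean_cmult)
    also have "\<dots> = peval h X + (D / 2 + \<epsilon>)" by (simp add: g(3)[OF X] sphere_mean_zonal[OF n X] u(2))
    also have "\<dots> = peval (f - mconst (fmin n f - \<epsilon>)) X" by (simp add: h_def c_def D_def field_simps)
    finally show "sphere_mean n (?q * ?G) = peval (f - mconst (fmin n f - \<epsilon>)) X" .
  qed
  moreover have "\<epsilon> \<le> 2 * x * D"
  proof -
    have "\<eta> / (1 - \<eta>) \<le> 4 * x"
    proof -
      have "\<eta> / (1 - \<eta>) \<le> \<eta> / (1 / 2)" using \<eta>0 \<eta>1 by (intro divide_left_mono) auto
      then show ?thesis using \<eta> by simp
    qed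
    then have "\<epsilon> \<le> 4 * x * (D / 2)" unfolding \<epsilon>_def using D0 by (intro mult_right_mono) auto
    then show ?thesis by (simp add: mult_ac)
  qed
  ultimately show ?thesis using that by (simp add: x_def D_def)
qed

theorem lb_error:
  assumes n: "n \<ge> 1" and d: "d \<ge> 1" and f: "f \<in> polys_le n d"
    and r: "real r \<ge> 2 * real n * real d * sqrt (real d)"
  shows "ereal (fmin n f) - lb n f r \<le> C_B n d / ereal ((real r)\<^sup>2) * ereal (fmax n f - fmin n f)"
proof -
  obtain \<epsilon> where \<epsilon>: "f - mconst (fmin n f - \<epsilon>) \<in> preordering n (2 * r)"
    "\<epsilon> \<le> 2 * (real n)\<^sup>2 * real d ^ 3 / (real r)\<^sup>2 * (fmax n f - fmin n f)"
    using lower_bound_error[OF assms] .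
  have "2 * real n * real d * sqrt (real d) > 0" using n d by simp
  then have r0: "real r > 0" using r by linarith
  have fn: "f \<in> polys n" using f by (rule polys_le_imp_polys)
  obtain z where z: "z \<in> unit_ball n" using ball_nonempty by blast
  have D0: "fmax n f - fmin n f \<ge> 0" using fmin_le[OF fn z] fmax_ge[OF fn z] by linarith
  let ?a = "2 * (real n)\<^sup>2 * real d ^ 3"
  have "ereal (fmin n f - \<epsilon>) \<le> lb n f r" unfolding lb_def using \<epsilon>(1) by (intro SUP_upper) simp
  then have "ereal (fmin n f) - lb n f r \<le> ereal (fmin n f) - ereal (fmin n f - \<epsilon>)"
    by (intro ereal_minus_mono) auto
  also have "\<dots> \<le> ereal (?a / (real r)\<^sup>2 * (fmax n f - fmin n f))" using \<epsilon>(2) by simp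
  also have "\<dots> = ereal ?a / ereal ((real r)\<^sup>2) * ereal (fmax n f - fmin n f)"
    using r0 by simp
  also have "\<dots> \<le> C_B n d / ereal ((real r)\<^sup>2) * ereal (fmax n f - fmin n f)"
  proof (intro ereal_mult_right_mono ereal_divide_right_mono)
    have "ereal ?a * 1 \<le> ereal ?a * gamma n d" by (intro ereal_mult_left_mono gamma_ge_1) simp
    then show "ereal ?a \<le> C_B n d" by (simp add: C_B_def)
  qed (use r0 D0 in auto)
  finally show ?thesis .
qed

section \<open>Upper bound for \<open>gamma\<close>\<close>

lemma sphere_mean_pow2_AE_zero:
  assumes p: "p \<in> polys (Suc n)" and z: "sphere_mean n (p * p) = 0"
  shows "AE x in ball_measure n. peval p (up n x) = 0 \<and> peval p (dn n x) = 0"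
proof -
  let ?f = "\<lambda>x. (peval (p * p) (up n x) + peval (p * p) (dn n x)) / 2"
  have int: "integrable (ball_measure n) ?f"
    by (intro integrable_divide_zero Bochner_Integration.integrable_add integrable_peval_ball polys_mult p) auto
  have "AE x in ball_measure n. ?f x = 0"
    using integral_nonneg_eq_0_iff_AE[OF int] z unfolding sphere_mean_def by simp
  then show ?thesis
  proof eventually_elim
    case (elim x)
    then have "peval p (up n x) * peval p (up n x) + peval p (dn n x) * peval p (dn n x) = 0" by simp
    then show ?case by (simp add: sum_squares_eq_zero_iff)
  qed
qed

text \<open>A mean of at most \<open>M\<close> forces a value of at most \<open>M\<close>, even
  inside a set of full measure. In \<open>sup_square_le\<close> this set is where the residuals of
  all monomials vanish.\<close>

lemma sphere_mean_AE_exists: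
  assumes p: "p \<in> polys (Suc n)" and le: "sphere_mean n p \<le> M"
    and Q: "AE x in ball_measure n. Q (up n x) \<and> Q (dn n x)"
  obtains y where "dot (Suc n) y y = 1" "Q y" "peval p y \<le> M"
proof (rule ccontr)
  assume "\<not> thesis"
  then have gt: "peval p y > M" if "dot (Suc n) y y = 1" "Q y" for y
    using that \<open>\<And>y. _ \<Longrightarrow> _ \<Longrightarrow> _ \<Longrightarrow> thesis\<close> by force
  let ?f = "\<lambda>x. (peval (p - mconst M) (up n x) + peval (p - mconst M) (dn n x)) / 2"
  have pM: "p - mconst M \<in> polys (Suc n)" using p by (intro polys_intros)
  have int: "integrable (ball_measure n) ?f"
    by (intro integrable_divide_zero Bochner_Integration.integrable_add integrable_peval_ball pM) auto
  have pos: "AE x in ball_measure n. ?f x > 0"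
    using Q AE_ball_measure
  proof eventually_elim
    case (elim x)
    then show ?case using gt[of "up n x"] gt[of "dn n x"] by (simp add: unit_ball_iff)
  qed
  then have nn: "AE x in ball_measure n. 0 \<le> ?f x" by eventually_elim simp
  have "(LINT x|ball_measure n. ?f x) \<le> 0"
    using sphere_mean_diff[OF p polys_mconst[of M]] le unfolding sphere_mean_def[symmetric] by simp
  then have "(LINT x|ball_measure n. ?f x) = 0" using integral_nonneg_AE[OF nn] by simp
  then have "AE x in ball_measure n. ?f x = 0" using integral_nonneg_eq_0_iff_AE[OF int nn] by simp
  then have "AE x in ball_measure n. False" using pos by eventually_elim simp
  then show False using not_AE_False_ball by blast
qed

text \<open>By rotation invariance the Christoffel function of \<open>polys_le (n + 1) d\<close> is constant on the
  sphere, so it is its own average, the dimension.\<close>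

theorem sup_square_le:
  assumes n: "n \<ge> 1" and f: "f \<in> polys_le (Suc n) d" and X: "dot (Suc n) X X = 1"
  shows "(peval f X)\<^sup>2 \<le> real (card (monoms (Suc n) d)) * sphere_mean n (f * f)"
proof -
  let ?N = "Suc n"
  have "psd_form ?N (\<lambda>p q. sphere_mean n (p * q * 1))" by (intro psd_form_sphere) auto
  then interpret psd_form ?N "\<lambda>p q. sphere_mean n (p * q)" by simp
  obtain ms where ms: "set ms = monoms ?N d" "distinct ms"
    using finite_distinct_list[OF finite_monoms] by blast
  define vs where "vs = map (\<lambda>m. single m (1 :: real)) ms"
  have vs: "set vs \<subseteq> polys ?N" using ms by (auto simp: vs_def monoms_def intro!: polys_single)
  obtain es where es: "orthonormal es" "length es \<le> length vs"
    "\<And>v. v \<in> set vs \<Longrightarrow> sphere_mean n ((v - proj es v) * (v - proj es v)) = 0"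
    using gram_schmidt[OF vs] by blast
  have M: "length es \<le> card (monoms ?N d)" using es(2) ms by (simp add: vs_def distinct_card[symmetric])
  have s: "set es \<subseteq> polys ?N" using es(1) by (simp add: orthonormal_def)
  define Phi where "Phi = (\<Sum>i<length es. es ! i * es ! i)"
  have Phi: "Phi \<in> polys ?N" unfolding Phi_def using s by (intro polys_intros) auto
  have "sphere_mean n Phi = (\<Sum>i<length es. 1)" unfolding Phi_def
    using s es(1) by (subst sphere_mean_sum) (auto intro!: polys_mult simp: orthonormal_def)
  then have PhiM: "sphere_mean n Phi \<le> real (card (monoms ?N d))" using M by simp
  have "AE x in ball_measure n. \<forall>v\<in>set vs. peval (v - proj es v) (up n x) = 0 \<and> peval (v - proj es v) (dn n x) = 0"
    using vs by (intro AE_finite_allI sphere_mean_pow2_AE_zero es(3) polys_diff polys_proj s) auto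
  then have "AE x in ball_measure n. (\<forall>v\<in>set vs. peval (v - proj es v) (up n x) = 0) \<and> (\<forall>v\<in>set vs. peval (v - proj es v) (dn n x) = 0)"
    by eventually_elim blast
  \<comment> \<open>One point where the Christoffel function \<open>Phi\<close> is at most the
    dimension is enough: instead of comparing \<open>Phi\<close> at different points, the isometry
    \<open>T\<close> transports \<open>f\<close> from \<open>X\<close> to \<open>X0\<close>. Being
    null, the residuals are zero only almost everywhere, so \<open>X0\<close> has to avoid the
    exceptional set.\<close>
  from sphere_mean_AE_exists[OF Phi PhiM this]
  obtain X0 where X0: "dot ?N X0 X0 = 1" "\<forall>v\<in>set vs. peval (v - proj es v) X0 = 0" "peval Phi X0 \<le> real (card (monoms ?N d))"
    by blast
  obtain T where T: "symmetric_isometry ?N T" "\<And>i. i < ?N \<Longrightarrow> T X0 i = X i"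
    using symmetric_isometry_transitive[OF X0(1) X] by blast
  obtain F where F: "F \<in> polys_le ?N d" "\<And>y. peval F y = peval f (T y)"
    using sphere_mean_isometry[OF n T(1) f] by blast
  have fN: "f \<in> polys ?N" "F \<in> polys ?N" using f F by (auto intro: polys_le_imp_polys)
  obtain FF where FF: "FF \<in> polys_le ?N (d + d)" "\<And>y. peval FF y = peval (f * f) (T y)" "sphere_mean n FF = sphere_mean n (f * f)"
    using sphere_mean_isometry[OF n T(1) polys_le_mult[OF f f]] by blast
  have BF: "sphere_mean n (F * F) = sphere_mean n (f * f)"
    unfolding FF(3)[symmetric] by (intro sphere_mean_cong polys_mult fN polys_le_imp_polys[OF FF(1)]) (simp add: F FF)
  have fX: "peval f X = peval F X0"
    unfolding F(2) by (rule peval_cong[OF fN(1)]) (simp add: T)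
  define v where "v m = single m (1 :: real)" for m :: "nat \<Rightarrow>\<^sub>0 nat"
  have vin: "v m \<in> set vs" if "m \<in> keys F" for m
    using that F(1) ms by (auto simp: v_def vs_def polys_le_iff)
  have Fexp: "F = (\<Sum>m\<in>keys F. mconst (lookup F m) * v m)"
    unfolding v_def by (rule mpoly_expand)
  have vp: "v m \<in> polys ?N" if "m \<in> keys F" for m using vin[OF that] vs by blast
  note res = residual_null_span[OF es(1) vp es(3)[OF vin] Fexp]
  have "peval (F - proj es F) X0 = 0"
    using X0(2) vin by (subst res(1)) auto
  then have "peval F X0 = (\<Sum>i<length es. sphere_mean n (F * es ! i) * peval (es ! i) X0)"
    by (simp add: proj_def)
  then have "(peval F X0)\<^sup>2 \<le> (\<Sum>i<length es. (sphere_mean n (F * es ! i))\<^sup>2) * (\<Sum>i<length es. (peval (es ! i) X0)\<^sup>2)"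
    by (simp only: Cauchy_Schwarz_ineq_sum)
  also have "(\<Sum>i<length es. (sphere_mean n (F * es ! i))\<^sup>2) = sphere_mean n (F * F)"
    by (rule res(2)[symmetric])
  also have "(\<Sum>i<length es. (peval (es ! i) X0)\<^sup>2) = peval Phi X0" by (simp add: Phi_def power2_eq_square)
  also have "sphere_mean n (F * F) * peval Phi X0 \<le> sphere_mean n (F * F) * real (card (monoms ?N d))"
    by (intro mult_left_mono X0(3) psd fN)
  finally show ?thesis unfolding fX BF by (simp add: mult.commute)
qed

text \<open>Pythagoras: of two components, the one of larger index is orthogonal to all polynomials
  of smaller degree, in particular to the other.\<close>

lemma decomposition_norm:
  assumes dec: "decomposes n d p P" and k: "k \<le> d"
  shows "sphere_mean n (P k * P k) \<le> sphere_mean n (p * p)"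
proof -
  have H: "P j \<in> H_space n j" if "j \<le> d" for j using dec that by (simp add: decomposes_def)
  have Pn: "P j \<in> polys n" if "j \<le> d" for j using H[OF that] by (auto simp: H_space_def intro: polys_le_imp_polys)
  have PN: "P j \<in> polys (Suc n)" if "j \<le> d" for j using Pn[OF that] by (rule polys_mono) simp
  have lt: "sphere_mean n (P j * P i) = 0" if "i < j" "j \<le> d" for i j
  proof -
    have "P i \<in> polys_le n i" using H[of i] that by (simp add: H_space_def)
    then have "total_degree (P i) < j" using that by (simp add: polys_le_def)
    then have "ball_inner n (P j) (P i) = 0" using H[of j] Pn[of i] that by (simp add: H_space_def)
    then show ?thesis using Pn that by (simp add: ball_inner_eq)
  qed
  have orth: "sphere_mean n (P i * P j) = 0" if "i \<noteq> j" "i \<le> d" "j \<le> d" for i j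
    using lt[of i j] lt[of j i] that by (cases "i < j") (auto simp: mult.commute)
  have "p * p = (\<Sum>i\<le>d. \<Sum>j\<le>d. P i * P j)"
    using dec by (simp add: decomposes_def sum_product)
  also have "sphere_mean n \<dots> = (\<Sum>i\<le>d. sphere_mean n (\<Sum>j\<le>d. P i * P j))"
    by (intro sphere_mean_sum polys_sum polys_mult PN) auto
  also have "\<dots> = (\<Sum>i\<le>d. \<Sum>j\<le>d. sphere_mean n (P i * P j))"
    by (intro sum.cong refl sphere_mean_sum polys_mult PN) auto
  also have "\<dots> = (\<Sum>i\<le>d. sphere_mean n (P i * P i))"
  proof (intro sum.cong refl)
    fix i assume "i \<in> {..d}"
    then have "(\<Sum>j\<le>d. sphere_mean n (P i * P j)) = (\<Sum>j\<le>d. if j = i then sphere_mean n (P i * P i) else 0)"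
      by (intro sum.cong) (auto simp: orth)
    also have "\<dots> = sphere_mean n (P i * P i)" using \<open>i \<in> {..d}\<close> by simp
    finally show "(\<Sum>j\<le>d. sphere_mean n (P i * P j)) = sphere_mean n (P i * P i)" .
  qed
  finally show ?thesis
    using k by (simp add: member_le_sum[of k "{..d}" "\<lambda>i. sphere_mean n (P i * P i)"] sphere_mean_nonneg)
qed

text \<open>The estimate passes through the mean square norm, which does not grow under projection
  to a component; only the return to the sup norm costs a factor. The square root of the dimension
  would do, and it is rounded up to the dimension.\<close>

theorem gamma_le:
  assumes n: "n \<ge> 1"
  shows "gamma n d \<le> ereal (real (card (monoms (Suc n) d)))"
  unfolding gamma_def
proof (rule Sup_least, clarify)
  fix p P k
  assume p: "p \<in> polys_le n d" and dec: "decomposes n d p P" and k: "k \<le> d"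
  let ?M = "real (card (monoms (Suc n) d))"
  have "0 \<in> monoms (Suc n) d" by (simp add: monoms_def)
  then have "card (monoms (Suc n) d) \<noteq> 0" using finite_monoms by auto
  then have M1: "?M \<ge> 1" by simp
  have pn: "p \<in> polys n" using p by (rule polys_le_imp_polys)
  have pN: "p \<in> polys (Suc n)" using pn by (rule polys_mono) simp
  have "P k \<in> H_space n k" using dec k by (simp add: decomposes_def)
  then have Pk: "P k \<in> polys_le n d" using k by (auto simp: H_space_def intro: polys_le_mono)
  have Pn: "P k \<in> polys n" using Pk by (rule polys_le_imp_polys)
  have PN: "P k \<in> polys_le (Suc n) d" using Pk by (rule polys_le_mono) auto
  have pp: "sphere_mean n (p * p) \<le> (sup_norm n p)\<^sup>2"
  proof -
    have "sphere_mean n (p * p) \<le> sphere_mean n (mconst ((sup_norm n p)\<^sup>2))"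
    proof (intro sphere_mean_mono polys_mult pN polys_mconst)
      fix y assume "dot (Suc n) y y = 1"
      then have "\<bar>peval p y\<bar> \<le> sup_norm n p" by (rule sup_norm_sphere[OF pn])
      then have "\<bar>peval p y\<bar>\<^sup>2 \<le> (sup_norm n p)\<^sup>2" by (intro power_mono) auto
      then show "peval (p * p) y \<le> peval (mconst ((sup_norm n p)\<^sup>2)) y" by (simp add: power2_eq_square)
    qed
    then show ?thesis by simp
  qed
  have "sup_norm n (P k) \<le> ?M * sup_norm n p"
  proof (rule sup_norm_least)
    fix x assume x: "x \<in> unit_ball n"
    have "(peval (P k) x)\<^sup>2 \<le> ?M * sphere_mean n (P k * P k)"
      using sup_square_le[OF n PN ball_sphere_up[OF x]] by (simp add: peval_up[OF Pn])
    also have "\<dots> \<le> ?M * (sup_norm n p)\<^sup>2"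
      using decomposition_norm[OF dec k] pp by (intro mult_left_mono) auto
    also have "\<dots> \<le> ?M\<^sup>2 * (sup_norm n p)\<^sup>2"
      using M1 by (intro mult_right_mono) (auto simp: power2_eq_square)
    also have "\<dots> = (?M * sup_norm n p)\<^sup>2" by (simp add: power_mult_distrib)
    finally show "\<bar>peval (P k) x\<bar> \<le> ?M * sup_norm n p"
      using sup_norm_nonneg[OF pn] by (simp add: abs_le_square_iff[symmetric])
  qed
  then have "sup_norm n (P k) / sup_norm n p \<le> ?M"
    using sup_norm_nonneg[OF pn] by (cases "sup_norm n p = 0") (auto simp: field_simps)
  then show "ereal (sup_norm n (P k) / sup_norm n p) \<le> ereal ?M" by simp
qed

text \<open>A monomial of degree \<open>d + 1\<close> is one of the \<open>n\<close> variables times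
  a monomial of degree \<open>d\<close>, so each degree costs a factor \<open>n + 1\<close>. This is
  the bound for growth in \<open>n\<close>.\<close>

lemma card_monoms_le_variables: "card (monoms n d) \<le> (n + 1) ^ d"
proof (induction d)
  case 0
  have "monoms n 0 \<subseteq> {0}"
  proof
    fix m assume "m \<in> monoms n 0"
    then have "(\<Sum>i\<in>keys m. lookup m i) = 0" by (simp add: monoms_def mdeg_def)
    then have "\<forall>i\<in>keys m. lookup m i = 0" by simp
    then have "lookup m i = 0" for i by (metis in_keys_iff)
    then show "m \<in> {0}" by (simp add: poly_mapping_eqI)
  qed
  then show ?case using card_mono[of "{0}" "monoms n 0"] by simp
next
  case (Suc d)
  have "monoms n (Suc d) \<subseteq> monoms n d \<union> (\<Union>i<n. (\<lambda>m. single i 1 + m) ` monoms n d)"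
  proof
    fix m assume m: "m \<in> monoms n (Suc d)"
    show "m \<in> monoms n d \<union> (\<Union>i<n. (\<lambda>m. single i 1 + m) ` monoms n d)"
    proof (cases "mdeg m \<le> d")
      case True
      then show ?thesis using m by (simp add: monoms_def)
    next
      case False
      have mk: "keys m \<subseteq> {..<n}" "mdeg m = Suc d" using m False by (auto simp: monoms_def)
      obtain ws where ws: "set ws \<subseteq> {..<n}" "length ws = mdeg m" "mlist ws = m"
        using monomial_as_list[OF mk(1)] .
      then obtain w vs where wv: "ws = w # vs" using mk(2) by (cases ws) auto
      have "mlist vs \<in> monoms n d" using ws mk(2) wv by (auto simp: monoms_def keys_mlist mdeg_mlist)
      then show ?thesis using ws wv by auto
    qed
  qed
  then have "card (monoms n (Suc d)) \<le> card (monoms n d \<union> (\<Union>i<n. (\<lambda>m. single i 1 + m) ` monoms n d))"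
    by (intro card_mono) (auto simp: finite_monoms)
  also have "\<dots> \<le> card (monoms n d) + (\<Sum>i<n. card ((\<lambda>m. single i 1 + m) ` monoms n d))"
    by (intro order_trans[OF card_Un_le] add_left_mono card_UN_le) simp
  also have "\<dots> \<le> card (monoms n d) + (\<Sum>i<n. card (monoms n d))"
    by (intro add_left_mono sum_mono card_image_le finite_monoms)
  also have "\<dots> = (n + 1) * card (monoms n d)" by simp
  also have "\<dots> \<le> (n + 1) * (n + 1) ^ d" by (intro mult_left_mono Suc) simp
  finally show ?case by simp
qed

text \<open>Each exponent lies between 0 and \<open>d\<close>. This is the bound for growth in
  \<open>d\<close>.\<close>

lemma card_monoms_le_degree: "card (monoms n d) \<le> (d + 1) ^ n"
proof -
  have "card (monoms n d) \<le> card (PiE {..<n} (\<lambda>_. {..d}))"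
  proof (rule card_inj_on_le)
    show "inj_on (\<lambda>m. restrict (lookup m) {..<n}) (monoms n d)"
    proof (rule inj_onI)
      fix a b assume ab: "a \<in> monoms n d" "b \<in> monoms n d" "restrict (lookup a) {..<n} = restrict (lookup b) {..<n}"
      have "lookup a i = lookup b i" for i
      proof (cases "i < n")
        case True
        then show ?thesis using fun_cong[OF ab(3), of i] by simp
      next
        case False
        then have "i \<notin> keys a" "i \<notin> keys b" using ab by (auto simp: monoms_def)
        then show ?thesis by (simp add: in_keys_iff)
      qed
      then show "a = b" by (intro poly_mapping_eqI)
    qed
    show "(\<lambda>m. restrict (lookup m) {..<n}) ` monoms n d \<subseteq> PiE {..<n} (\<lambda>_. {..d})"
    proof (clarsimp simp: PiE_iff)
      fix m i assume m: "m \<in> monoms n d" and i: "i < n"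
      have "lookup m i \<le> (\<Sum>j<n. lookup m j)" using i by (intro member_le_sum) auto
      also have "\<dots> = mdeg m" using m by (intro mdeg_superset[symmetric]) (auto simp: monoms_def)
      finally show "lookup m i \<le> d" using m by (simp add: monoms_def)
    qed
  qed (auto intro: finite_PiE)
  then show ?thesis by (simp add: card_PiE)
qed

lemma C_B_le:
  assumes "n \<ge> 1"
  shows "C_B n d \<le> ereal (2 * real n ^ 2 * real d ^ 3 * real (card (monoms (Suc n) d)))"
proof -
  have "C_B n d \<le> ereal (2 * real n ^ 2 * real d ^ 3) * ereal (real (card (monoms (Suc n) d)))"
    unfolding C_B_def by (intro ereal_mult_left_mono gamma_le assms) simp
  then show ?thesis by simp
qed

theorem theorem3:
  shows "(\<forall>(n::nat) (d::nat) (f::mpoly) (r::nat).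
            n \<ge> 1 \<longrightarrow> d \<ge> 1 \<longrightarrow> f \<in> polys n \<longrightarrow> total_degree f = d \<longrightarrow>
            real r \<ge> 2 * real n * real d * sqrt (real d) \<longrightarrow>
            ereal (fmin n f) - lb n f r
              \<le> C_B n d / ereal ((real r)\<^sup>2) * ereal (fmax n f - fmin n f))
       \<and> (\<forall>d\<ge>1. \<exists>Q :: real poly. \<forall>n\<ge>1. C_B n d \<le> ereal (poly Q (real n)))
       \<and> (\<forall>n\<ge>1. \<exists>Q :: real poly. \<forall>d\<ge>1. C_B n d \<le> ereal (poly Q (real d)))"
proof (intro conjI allI impI)
  fix n d r :: nat and f :: mpoly
  assume "n \<ge> 1" "d \<ge> 1" "f \<in> polys n" "total_degree f = d" "real r \<ge> 2 * real n * real d * sqrt (real d)"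
  then show "ereal (fmin n f) - lb n f r \<le> C_B n d / ereal ((real r)\<^sup>2) * ereal (fmax n f - fmin n f)"
    by (intro lb_error) (auto simp: polys_le_def)
next
  fix d :: nat
  \<comment> \<open>The monomials live on the sphere with its \<open>n + 1\<close> coordinates,
    hence the base \<open>n + 2\<close>.\<close>
  have "C_B n d \<le> ereal (poly (smult (2 * real d ^ 3) ([:0, 1:]\<^sup>2 * [:2, 1:] ^ d)) (real n))" if "n \<ge> 1" for n
  proof -
    have "real (card (monoms (Suc n) d)) \<le> real ((Suc n + 1) ^ d)"
      using card_monoms_le_variables[of "Suc n" d] by (simp only: of_nat_le_iff)
    then have "2 * real n ^ 2 * real d ^ 3 * real (card (monoms (Suc n) d)) \<le> 2 * real n ^ 2 * real d ^ 3 * (2 + real n) ^ d"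
      by (intro mult_left_mono) (auto simp: add.commute)
    then show ?thesis by (intro order_trans[OF C_B_le[OF that, of d]]) (simp add: poly_power mult_ac)
  qed
  then show "\<exists>Q :: real poly. \<forall>n\<ge>1. C_B n d \<le> ereal (poly Q (real n))" by blast
next
  fix n :: nat assume n: "n \<ge> 1"
  \<comment> \<open>The exponent \<open>Suc n\<close> again counts the coordinates of the
    sphere.\<close>
  have "C_B n d \<le> ereal (poly (smult (2 * real n ^ 2) ([:0, 1:] ^ 3 * [:1, 1:] ^ Suc n)) (real d))" for d
  proof -
    have "real (card (monoms (Suc n) d)) \<le> real ((d + 1) ^ Suc n)"
      using card_monoms_le_degree[of "Suc n" d] by (simp only: of_nat_le_iff)
    also have "real ((d + 1) ^ Suc n) = (1 + real d) ^ Suc n"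
      by (simp only: of_nat_power of_nat_add of_nat_1 add.commute)
    finally have "2 * real n ^ 2 * real d ^ 3 * real (card (monoms (Suc n) d)) \<le> 2 * real n ^ 2 * real d ^ 3 * (1 + real d) ^ Suc n"
      by (rule mult_left_mono) simp
    then show ?thesis by (intro order_trans[OF C_B_le[OF n, of d]]) (simp add: poly_power algebra_simps)
  qed
  then show "\<exists>Q :: real poly. \<forall>d\<ge>1. C_B n d \<le> ereal (poly Q (real d))" by blast
qed

end
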